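(* Let $A$ be a game and let $\sigma,\tau$ be innocent strategies on $A$. Then $\sigma$ and $\tau$ are observationally equivalent, i.e. $\sigma \leq_{ib} \tau$ and $\tau \leq_{ib} \sigma$, if and only if $\mathsf{obs}(\sigma) = \mathsf{obs}(\tau)$.
   Context: Setting: standard (Hyland–Ong / Abramsky–McCusker) game semantics for PCF: arenas, justified sequences, plays, the function-space game $A \rightarrow B$, strategies (non-empty, even-prefix-closed, deterministic sets of even-length plays), innocent strategies, composition. The two players are O and P. $s' \sqsubseteq s$ means $s'$ is a prefix of $s$. O-view of a play: $\llcorner \epsilon \lrcorner = \epsilon$; $\llcorner s o \lrcorner = \llcorner s \lrcorner o$ for an O-move $o$; $\llcorner s o t p \lrcorner = \llcorner s \lrcorner o p$ when the O-move $o$ justifies the P-move $p$. $\Sigma$ is the game with an initial O-question $q$ and a P-answer $a$ justified by $q$, plays $\epsilon, q, qa$; its only strategies are $\top=\{\epsilon,qa\}$ and $\bot=\{\epsilon\}$. For a strategy $\sigma$ on $A$ and a strategy $\alpha$ on $A \rightarrow \Sigma$, the composite $\sigma;\alpha$ is a strategy on $\Sigma$, hence $\top$ or $\bot$. $\sigma \leq_{ib} \tau$ means: for every innocent $\alpha : A \rightarrow \Sigma$, if $\sigma;\alpha = \top$ then $\tau;\alpha = \top$. A play $s$ is O-innocent if whenever $s_1 o_1 \sqsubseteq s$ and $s_2 o_2 \sqsubseteq s$ with $o_1,o_2$ O-moves and $\llcorner s_1 \lrcorner = \llcorner s_2 \lrcorner$, then $o_1 = o_2$. A play is complete if every question in it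 is answered, and single-threaded if it contains exactly one occurrence of an initial move. For a play $s$, $\mathsf{ovw}(s) = \{ \llcorner t \lrcorner : t \sqsubseteq s \}$. For an innocent strategy $\sigma$, $\mathsf{obs}(\sigma) = \{ \mathsf{ovw}(s) : s \in \sigma,\ s \text{ complete, O-innocent and single-threaded} \}$. *)

theory Defs
  imports Main "HOL-Library.Sublist"
begin

section \<open>Arenas and justified sequences\<close>

datatype player = Opponent | Proponent
datatype kind = Question | Answer

text \<open>In \<open>enables\<close>, the source \<open>None\<close> is the extra symbol (usually written as a star) that
  enables the initial moves.\<close>

record 'm arena =
  moves :: "'m set"
  owner :: "'m \<Rightarrow> player"
  kind_of :: "'m \<Rightarrow> kind"
  enables :: "'m option \<Rightarrow> 'm \<Rightarrow> bool"

definition arena :: "('m, 'z) arena_scheme \<Rightarrow> bool" where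
  "arena A \<longleftrightarrow>
     (\<forall>x m. enables A x m \<longrightarrow> m \<in> moves A \<and> set_option x \<subseteq> moves A) \<and>
     (\<forall>m. enables A None m \<longrightarrow>
        owner A m = Opponent \<and> kind_of A m = Question \<and> (\<forall>n. \<not> enables A (Some n) m)) \<and>
     (\<forall>m n. enables A (Some m) n \<longrightarrow> owner A m \<noteq> owner A n) \<and>
     (\<forall>m n. enables A (Some m) n \<and> kind_of A n = Answer \<longrightarrow> kind_of A m = Question)"

text \<open>A sequence with justification pointers: each occurrence carries the position of its
  justifier, or \<open>None\<close> if it is an occurrence of an initial move.\<close>

type_synonym 'm jseq = "('m \<times> nat option) list"

abbreviation move_at :: "'m jseq \<Rightarrow> nat \<Rightarrow> 'm" where
  "move_at s i \<equiv> fst (s ! i)"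

abbreviation ptr :: "'m jseq \<Rightarrow> nat \<Rightarrow> nat option" where
  "ptr s i \<equiv> snd (s ! i)"

definition justified :: "('m, 'z) arena_scheme \<Rightarrow> 'm jseq \<Rightarrow> bool" where
  "justified A s \<longleftrightarrow> (\<forall>i < length s.
     case ptr s i of
       None \<Rightarrow> enables A None (move_at s i)
     | Some j \<Rightarrow> j < i \<and> enables A (Some (move_at s j)) (move_at s i))"

text \<open>The subsequence of \<open>s\<close> at the positions in \<open>I\<close>, with the pointers renumbered; a pointer
  to an occurrence outside \<open>I\<close> is erased.\<close>

definition sub :: "'m jseq \<Rightarrow> nat set \<Rightarrow> 'm jseq" where
  "sub s I = map (\<lambda>i. (move_at s i,
       case ptr s i of
         None \<Rightarrow> None
       | Some j \<Rightarrow> if j \<in> I then Some (card (I \<inter> {..<j})) else None))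
     (filter (\<lambda>i. i \<in> I) [0..<length s])"

section \<open>Views and plays\<close>

text \<open>Positions occurring in the P-view and in the O-view of the prefix of length \<open>n\<close> of \<open>s\<close>.
  The test \<open>j < i\<close> always succeeds in justified sequences.\<close>

fun pview_pos :: "('m, 'z) arena_scheme \<Rightarrow> 'm jseq \<Rightarrow> nat \<Rightarrow> nat set" where
  "pview_pos A s 0 = {}"
| "pview_pos A s (Suc i) =
     (if owner A (move_at s i) = Proponent then insert i (pview_pos A s i)
      else (case ptr s i of
              None \<Rightarrow> {i}
            | Some j \<Rightarrow> if j < i then insert i (insert j (pview_pos A s j)) else {i}))"

fun oview_pos :: "('m, 'z) arena_scheme \<Rightarrow> 'm jseq \<Rightarrow> nat \<Rightarrow> nat set" where
  "oview_pos A s 0 = {}"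
| "oview_pos A s (Suc i) =
     (if owner A (move_at s i) = Opponent then insert i (oview_pos A s i)
      else (case ptr s i of
              None \<Rightarrow> {i}
            | Some j \<Rightarrow> if j < i then insert i (insert j (oview_pos A s j)) else {i}))"

definition pview :: "('m, 'z) arena_scheme \<Rightarrow> 'm jseq \<Rightarrow> 'm jseq" where
  "pview A s = sub s (pview_pos A s (length s))"

definition oview :: "('m, 'z) arena_scheme \<Rightarrow> 'm jseq \<Rightarrow> 'm jseq" where
  "oview A s = sub s (oview_pos A s (length s))"

definition alternating :: "('m, 'z) arena_scheme \<Rightarrow> 'm jseq \<Rightarrow> bool" where
  "alternating A s \<longleftrightarrow>
     (\<forall>i. Suc i < length s \<longrightarrow> owner A (move_at s i) \<noteq> owner A (move_at s (Suc i)))"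

definition visible :: "('m, 'z) arena_scheme \<Rightarrow> 'm jseq \<Rightarrow> bool" where
  "visible A s \<longleftrightarrow> (\<forall>i < length s. \<forall>j. ptr s i = Some j \<longrightarrow>
     j \<in> (if owner A (move_at s i) = Proponent then pview_pos A s i else oview_pos A s i))"

definition open_question :: "('m, 'z) arena_scheme \<Rightarrow> 'm jseq \<Rightarrow> nat \<Rightarrow> bool" where
  "open_question A s i \<longleftrightarrow> i < length s \<and> kind_of A (move_at s i) = Question \<and>
     \<not> (\<exists>k < length s. kind_of A (move_at s k) = Answer \<and> ptr s k = Some i)"

text \<open>Every answer, by either player, answers the most recent open question.\<close>

definition well_bracketed :: "('m, 'z) arena_scheme \<Rightarrow> 'm jseq \<Rightarrow> bool" where
  "well_bracketed A s \<longleftrightarrow> (\<forall>i < length s. kind_of A (move_at s i) = Answer \<longrightarrow>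
     (\<exists>j. ptr s i = Some j \<and> open_question A (take i s) j \<and>
          (\<forall>k. open_question A (take i s) k \<longrightarrow> k \<le> j)))"

definition legal :: "('m, 'z) arena_scheme \<Rightarrow> 'm jseq \<Rightarrow> bool" where
  "legal A s \<longleftrightarrow> justified A s \<and> alternating A s \<and> visible A s \<and> well_bracketed A s"

section \<open>Games\<close>

record 'm game = "'m arena" +
  plays :: "'m jseq set"

text \<open>The plays are the legal sequences of the arena, except that a game may restrict the opening
  of further threads (nothing else: a legal extension of a play by a non-initial move is a play).
  This covers both the convention that every legal sequence is a play and the convention that a
  play has at most one occurrence of an initial move.\<close>

definition game :: "'m game \<Rightarrow> bool" where
  "game A \<longleftrightarrow> arena A \<and>
     plays A \<subseteq> Collect (legal A) \<and>
     [] \<in> plays A \<and>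
     (\<forall>s t. t \<in> plays A \<and> prefix s t \<longrightarrow> s \<in> plays A) \<and>
     (\<forall>m. enables A None m \<longrightarrow> [(m, None)] \<in> plays A) \<and>
     (\<forall>s m j. s \<in> plays A \<and> legal A (s @ [(m, Some j)]) \<longrightarrow> s @ [(m, Some j)] \<in> plays A)"

definition with_plays :: "'m arena \<Rightarrow> 'm jseq set \<Rightarrow> 'm game" where
  "with_plays X P = \<lparr>moves = moves X, owner = owner X, kind_of = kind_of X,
     enables = enables X, plays = P\<rparr>"

text \<open>The thread of position \<open>i\<close>: the positions hereditarily justified by \<open>i\<close>.\<close>

definition thread :: "'m jseq \<Rightarrow> nat \<Rightarrow> nat set" where
  "thread s i = {k. k < length s \<and> (i, k) \<in> {(j, k). k < length s \<and> ptr s k = Some j}\<^sup>*}"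

definition threads :: "'m jseq \<Rightarrow> 'm jseq set" where
  "threads s = {sub s (thread s i) | i. i < length s \<and> ptr s i = None}"

text \<open>The plays of the exponential of \<open>A\<close>, in which arbitrarily many threads of \<open>A\<close> may be
  opened, and the promotion of a strategy, which plays each thread separately. If every legal
  sequence is a play of \<open>A\<close>, then \<open>bang_plays A = plays A\<close>, and \<open>promote A \<sigma> = \<sigma>\<close> for innocent
  \<open>\<sigma>\<close>.\<close>

definition bang_plays :: "'m game \<Rightarrow> 'm jseq set" where
  "bang_plays A = {s. legal A s \<and> threads s \<subseteq> plays A}"

definition promote :: "'m game \<Rightarrow> 'm jseq set \<Rightarrow> 'm jseq set" where
  "promote A \<sigma> = {s \<in> bang_plays A. threads s \<subseteq> \<sigma>}"

section \<open>Function space\<close>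

fun opposite :: "player \<Rightarrow> player" where
  "opposite Opponent = Proponent"
| "opposite Proponent = Opponent"

fun fun_enables :: "('a, 'y) arena_scheme \<Rightarrow> ('b, 'z) arena_scheme \<Rightarrow>
    ('a + 'b) option \<Rightarrow> 'a + 'b \<Rightarrow> bool" where
  "fun_enables A B None (Inr b) = enables B None b"
| "fun_enables A B None (Inl a) = False"
| "fun_enables A B (Some (Inr b')) (Inr b) = enables B (Some b') b"
| "fun_enables A B (Some (Inl a')) (Inl a) = enables A (Some a') a"
| "fun_enables A B (Some (Inr b)) (Inl a) = (enables B None b \<and> enables A None a)"
| "fun_enables A B (Some (Inl a)) (Inr b) = False"

definition fun_arena :: "('a, 'y) arena_scheme \<Rightarrow> ('b, 'z) arena_scheme \<Rightarrow> ('a + 'b) arena" where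
  "fun_arena A B = \<lparr>moves = moves A <+> moves B,
     owner = case_sum (opposite \<circ> owner A) (owner B),
     kind_of = case_sum (kind_of A) (kind_of B),
     enables = fun_enables A B\<rparr>"

definition left :: "('a + 'b) jseq \<Rightarrow> 'a jseq" where
  "left s = map (apfst projl) (sub s {i. i < length s \<and> isl (move_at s i)})"

definition right :: "('a + 'b) jseq \<Rightarrow> 'b jseq" where
  "right s = map (apfst projr) (sub s {i. i < length s \<and> \<not> isl (move_at s i)})"

definition fun_game :: "'a game \<Rightarrow> 'b game \<Rightarrow> ('a + 'b) game" where
  "fun_game A B = with_plays (fun_arena A B)
     {s. legal (fun_arena A B) s \<and> left s \<in> bang_plays A \<and> right s \<in> plays B}"

section \<open>Strategies\<close>

definition strategy :: "'m game \<Rightarrow> 'm jseq set \<Rightarrow> bool" where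
  "strategy A \<sigma> \<longleftrightarrow>
     \<sigma> \<subseteq> {s \<in> plays A. even (length s)} \<and>
     \<sigma> \<noteq> {} \<and>
     (\<forall>s t. t \<in> \<sigma> \<and> prefix s t \<and> even (length s) \<longrightarrow> s \<in> \<sigma>) \<and>
     (\<forall>s a b c. s @ [a, b] \<in> \<sigma> \<and> s @ [a, c] \<in> \<sigma> \<longrightarrow> b = c)"

text \<open>Equality of the extended views says that \<open>b\<close> and \<open>b'\<close> are the same move with the same
  justifier in the common view; the pointers of \<open>b\<close> and \<open>b'\<close> themselves are positions in
  different plays.\<close>

definition innocent :: "'m game \<Rightarrow> 'm jseq set \<Rightarrow> bool" where
  "innocent A \<sigma> \<longleftrightarrow> (\<forall>s a b t a'.
     s @ [a, b] \<in> \<sigma> \<and> t \<in> \<sigma> \<and> t @ [a'] \<in> plays A \<and> pview A (t @ [a']) = pview A (s @ [a]) \<longrightarrow>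
     (\<exists>b'. t @ [a', b'] \<in> \<sigma> \<and> pview A (t @ [a', b']) = pview A (s @ [a, b])))"

definition innocent_strategy :: "'m game \<Rightarrow> 'm jseq set \<Rightarrow> bool" where
  "innocent_strategy A \<sigma> \<longleftrightarrow> strategy A \<sigma> \<and> innocent A \<sigma>"

text \<open>Composition of \<open>\<sigma>\<close> on \<open>A\<close> with \<open>\<alpha>\<close> on \<open>fun_game A B\<close>. As \<open>\<sigma>\<close> has no domain, an
  interaction sequence is just a sequence over the moves of \<open>A\<close> and \<open>B\<close>, and its restriction to
  these two components is the sequence itself.\<close>

definition compose :: "'a game \<Rightarrow> 'a jseq set \<Rightarrow> ('a + 'b) jseq set \<Rightarrow> 'b jseq set" where
  "compose A \<sigma> \<alpha> = {right u | u. left u \<in> promote A \<sigma> \<and> u \<in> \<alpha>}"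

section \<open>Observational preorder\<close>

datatype sigma_move = Sigma_q | Sigma_a

definition Sigma_top :: "sigma_move jseq set" where
  "Sigma_top = {[], [(Sigma_q, None), (Sigma_a, Some 0)]}"

definition Sigma_game :: "sigma_move game" where
  "Sigma_game = \<lparr>moves = UNIV,
     owner = (\<lambda>m. case m of Sigma_q \<Rightarrow> Opponent | Sigma_a \<Rightarrow> Proponent),
     kind_of = (\<lambda>m. case m of Sigma_q \<Rightarrow> Question | Sigma_a \<Rightarrow> Answer),
     enables = (\<lambda>x m. (x, m) \<in> {(None, Sigma_q), (Some Sigma_q, Sigma_a)}),
     plays = {[], [(Sigma_q, None)], [(Sigma_q, None), (Sigma_a, Some 0)]}\<rparr>"

definition leq_ib :: "'m game \<Rightarrow> 'm jseq set \<Rightarrow> 'm jseq set \<Rightarrow> bool" where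
  "leq_ib A \<sigma> \<tau> \<longleftrightarrow> (\<forall>\<alpha>. innocent_strategy (fun_game A Sigma_game) \<alpha> \<longrightarrow>
     compose A \<sigma> \<alpha> = Sigma_top \<longrightarrow> compose A \<tau> \<alpha> = Sigma_top)"

section \<open>Observations\<close>

text \<open>As for \<open>innocent\<close>, the two O-moves are compared together with their justifiers in the
  common view.\<close>

definition O_innocent :: "('m, 'z) arena_scheme \<Rightarrow> 'm jseq \<Rightarrow> bool" where
  "O_innocent A s \<longleftrightarrow> (\<forall>s1 o1 s2 o2.
     prefix (s1 @ [o1]) s \<and> prefix (s2 @ [o2]) s \<and>
     owner A (fst o1) = Opponent \<and> owner A (fst o2) = Opponent \<and>
     oview A s1 = oview A s2 \<longrightarrow> oview A (s1 @ [o1]) = oview A (s2 @ [o2]))"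

definition complete :: "('m, 'z) arena_scheme \<Rightarrow> 'm jseq \<Rightarrow> bool" where
  "complete A s \<longleftrightarrow> \<not> (\<exists>i. open_question A s i)"

definition single_threaded :: "('m, 'z) arena_scheme \<Rightarrow> 'm jseq \<Rightarrow> bool" where
  "single_threaded A s \<longleftrightarrow> card {i. i < length s \<and> enables A None (move_at s i)} = 1"

definition ovw :: "('m, 'z) arena_scheme \<Rightarrow> 'm jseq \<Rightarrow> 'm jseq set" where
  "ovw A s = {oview A t | t. prefix t s}"

definition obs :: "('m, 'z) arena_scheme \<Rightarrow> 'm jseq set \<Rightarrow> 'm jseq set set" where
  "obs A \<sigma> = {ovw A s | s. s \<in> \<sigma> \<and> complete A s \<and> O_innocent A s \<and> single_threaded A s}"

end

theory Submission
  imports Defs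
begin

text \<open>If \<open>obs \<sigma> \<subseteq> obs \<tau>\<close> and a test succeeds on \<open>\<sigma>\<close> in the interaction \<open>s\<close>, the threads of \<open>s\<close>
  are replaced one at a time, the last one opened first, by threads of \<open>\<tau>\<close>. When it is the turn of the
  thread opened at position \<open>r\<close>, everything else (the test, \<open>\<sigma>\<close> in the older threads and \<open>\<tau>\<close> in
  the younger ones) acts on that thread as a deterministic opponent that sees only the view of the
  interaction in which the Proponent moves of the thread jump to their justifiers and all the other
  moves are visible. Hence the thread is O-innocent (although an arbitrary thread of an interaction
  with an innocent test need not be O-innocent once the other threads are forgotten), so \<open>obs\<close>
  supplies a thread of \<open>\<tau>\<close> with the same O-views, and the interaction can be replayed against it.

  Conversely, a play \<open>s\<close> witnessing an observation of \<open>\<sigma>\<close> defines the innocent test that plays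
  according to the O-views of \<open>s\<close> and succeeds at its final one. Its success on \<open>\<tau>\<close> gives a play
  \<open>t\<close> of \<open>\<tau>\<close> whose O-views are among those of \<open>s\<close>, and the test defined by \<open>t\<close> gives in the same
  way a play of \<open>\<sigma>\<close>, which is \<open>s\<close> by determinism; so \<open>s\<close> and \<open>t\<close> have the same O-views.\<close>

section \<open>Subsequences\<close>

text \<open>Replacing a thread may repeat, drop or reorder whatever follows its opening, so younger
  threads can vanish or move, while the positions up to the opening \<open>r\<close> keep their
  place (\<open>IV_initial\<close>). Hence the youngest thread comes first, and the intermediate
  stages are indexed by positions: threads opened below \<open>k\<close> belong to \<sigma>, the
  others to \<tau>. The obstacle is that the new thread shares a set of O-views with the old one but
  not the order of its moves, so the two interactions cannot be compared position by position. They
  are compared by states: \<open>iv\<close> is the part of an interaction on which the surroundings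
  of the thread act, and every state of the new interaction is a state of the old one. The crux is
  \<open>iv_compare\<close>: positions at which Opponent has the same view of the thread alone have
  comparable states, and states that end in a move of the thread then coincide. A set of O-views
  carries no order, yet it must show where its play ends. Completeness provides this: along a play,
  O-views at points without open questions become strictly longer.\<close>

definition rk :: "nat set \<Rightarrow> nat \<Rightarrow> nat" where
  "rk I i = card (I \<inter> {..<i})"

lemma rk_0 [simp]: "rk I 0 = 0"
  by (simp add: rk_def)

lemma rk_Suc: "rk I (Suc i) = (if i \<in> I then Suc (rk I i) else rk I i)"
  by (simp add: rk_def lessThan_Suc Int_insert_right)

lemma rk_mono: "i \<le> j \<Longrightarrow> rk I i \<le> rk I j"
  unfolding rk_def by (rule card_mono) auto

lemma rk_less: "i < j \<Longrightarrow> i \<in> I \<Longrightarrow> rk I i < rk I j"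
  using rk_mono[of "Suc i" j I] by (simp add: rk_Suc)

lemma rk_less_iff: "i \<in> I \<Longrightarrow> j \<in> I \<Longrightarrow> rk I i < rk I j \<longleftrightarrow> i < j"
  by (meson not_less rk_less rk_mono)

lemma rk_inj: "i \<in> I \<Longrightarrow> j \<in> I \<Longrightarrow> rk I i = rk I j \<Longrightarrow> i = j"
  by (metis less_irrefl nat_neq_iff rk_less)

lemma rk_eq_iff: "i \<in> I \<Longrightarrow> j \<in> I \<Longrightarrow> rk I i = rk I j \<longleftrightarrow> i = j"
  using rk_inj by blast

lemma rk_inj_on: "inj_on (rk I) I"
  by (meson inj_onI rk_inj)

lemma rk_ex: "k < rk I n \<Longrightarrow> \<exists>i<n. i \<in> I \<and> rk I i = k"
proof (induction n)
  case (Suc n)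
  then show ?case
    by (cases "n \<in> I") (auto simp: rk_Suc less_Suc_eq)
qed simp

lemma rk_le: "rk I i \<le> i"
  by (induction i) (auto simp: rk_Suc)

lemma rk_initial: "{..<i} \<subseteq> I \<Longrightarrow> rk I i = i"
  by (simp add: rk_def inf.absorb2)

lemma rk_cong: "I \<inter> {..<i} = J \<inter> {..<i} \<Longrightarrow> rk I i = rk J i"
  by (simp add: rk_def)

lemma rk_image:
  assumes "K \<subseteq> I" and "j \<in> I"
  shows "rk (rk I ` K) (rk I j) = rk K j"
proof -
  have "rk I ` K \<inter> {..<rk I j} = rk I ` (K \<inter> {..<j})"
    using assms by (auto simp: rk_less_iff subset_iff)
  moreover have "inj_on (rk I) (K \<inter> {..<j})"
    by (rule inj_on_subset[OF rk_inj_on]) (use assms in auto)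
  ultimately show ?thesis
    by (metis card_image rk_def)
qed

text \<open>The pointer part of \<open>sub\<close>, split off so that it can be handled through
  \<open>rk\<close>, the renumbering used there: \<open>rk I i\<close> is the new position of
  \<open>i\<close>.\<close>

definition ptr_map :: "nat set \<Rightarrow> nat option \<Rightarrow> nat option" where
  "ptr_map I p = (case p of None \<Rightarrow> None | Some j \<Rightarrow> if j \<in> I then Some (rk I j) else None)"

lemma ptr_map_simps [simp]:
  "ptr_map I None = None"
  "j \<in> I \<Longrightarrow> ptr_map I (Some j) = Some (rk I j)"
  "j \<notin> I \<Longrightarrow> ptr_map I (Some j) = None"
  by (auto simp: ptr_map_def)

lemma ptr_map_eq_Some: "ptr_map I p = Some k \<longleftrightarrow> (\<exists>j. p = Some j \<and> j \<in> I \<and> k = rk I j)"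
  by (auto simp: ptr_map_def split: option.splits)

lemma ptr_map_image:
  assumes "K \<subseteq> I"
  shows "ptr_map (rk I ` K) (ptr_map I p) = ptr_map K p"
proof (cases p)
  case (Some j)
  show ?thesis
  proof (cases "j \<in> I")
    case True
    then have "rk I j \<in> rk I ` K \<longleftrightarrow> j \<in> K"
      using assms by (auto dest: rk_inj)
    then show ?thesis
      using Some True assms by (cases "j \<in> K") (auto simp: rk_image)
  next
    case False
    then have "j \<notin> K" using assms by blast
    then show ?thesis
      using Some False by simp
  qed
qed simp

lemma sub_Nil [simp]: "sub [] I = []"
  by (simp add: sub_def)

text \<open>This recursion replaces the filtered list in the definition of \<open>sub\<close>; most
  facts on restriction are inductions from the right that use it.\<close>

lemma sub_snoc:
  "sub (s @ [x]) I = sub s I @ (if length s \<in> I then [(fst x, ptr_map I (snd x))] else [])"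
proof -
  have "map (\<lambda>i. (move_at (s @ [x]) i, ptr_map I (ptr (s @ [x]) i)))
          (filter (\<lambda>i. i \<in> I) [0..<length s])
      = map (\<lambda>i. (move_at s i, ptr_map I (ptr s i))) (filter (\<lambda>i. i \<in> I) [0..<length s])"
    by (rule map_cong) (auto simp: nth_append)
  then show ?thesis
    unfolding sub_def ptr_map_def rk_def by simp
qed

lemma length_sub: "length (sub s I) = rk I (length s)"
  by (induction s rule: rev_induct) (auto simp: sub_snoc rk_Suc)

lemma sub_append_prefix: "\<exists>t. sub (s @ u) I = sub s I @ t"
proof (induction u rule: rev_induct)
  case (snoc x u)
  then show ?case
    using sub_snoc[of "s @ u" x I] by auto
qed simp

lemma sub_take: "sub (take n s) I = take (rk I n) (sub s I)" if "n \<le> length s"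
proof -
  obtain t where "sub s I = sub (take n s) I @ t"
    using sub_append_prefix[of "take n s" "drop n s" I] by auto
  then show ?thesis
    using that by (simp add: length_sub)
qed

lemma sub_nth:
  assumes "i < length s" and "i \<in> I"
  shows "sub s I ! rk I i = (move_at s i, ptr_map I (ptr s i))"
proof -
  have "sub (take (Suc i) s) I = sub (take i s) I @ [(move_at s i, ptr_map I (ptr s i))]"
    using assms by (simp add: take_Suc_conv_app_nth sub_snoc)
  moreover have "sub (take (Suc i) s) I = take (Suc (rk I i)) (sub s I)"
    using assms by (simp add: sub_take rk_Suc)
  moreover have "length (sub (take i s) I) = rk I i"
    using assms by (simp add: length_sub)
  ultimately show ?thesis
    by (metis lessI nth_append_length nth_take)
qed

text \<open>The property of pointers on which renumbering relies. Unlike legality, it survives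
  restriction to an arbitrary set (\<open>back_sub\<close>).\<close>

definition backward :: "'m jseq \<Rightarrow> bool" where
  "backward s \<longleftrightarrow> (\<forall>i<length s. \<forall>j. ptr s i = Some j \<longrightarrow> j < i)"

lemma backD: "backward s \<Longrightarrow> i < length s \<Longrightarrow> ptr s i = Some j \<Longrightarrow> j < i"
  by (simp add: backward_def)

lemma back_append1: "backward (s @ t) \<Longrightarrow> backward s"
  unfolding backward_def by (metis length_append nth_append trans_less_add1)

lemma back_snoc: "backward (s @ [x]) \<longleftrightarrow> backward s \<and> (\<forall>j. snd x = Some j \<longrightarrow> j < length s)"
  by (auto simp: backward_def nth_append less_Suc_eq)

lemma back_take: "backward s \<Longrightarrow> backward (take n s)"
  by (metis append_take_drop_id back_append1)

lemma sub_full: "backward s \<Longrightarrow> {..<length s} \<subseteq> I \<Longrightarrow> sub s I = s"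
proof (induction s rule: rev_induct)
  case (snoc x s)
  have s: "sub s I = s"
    using snoc by (simp add: back_snoc lessThan_Suc)
  have "ptr_map I (snd x) = snd x"
  proof (cases "snd x")
    case (Some j)
    then have "j < length s"
      using snoc.prems(1) by (simp add: back_snoc)
    moreover from this have "{..<j} \<subseteq> I" "j \<in> I"
      using snoc.prems(2) by auto
    ultimately show ?thesis
      using Some by (simp add: rk_initial)
  qed simp
  then show ?case
    using s snoc.prems(2) by (auto simp: sub_snoc)
qed simp

text \<open>Pointers lead to earlier positions, so membership beyond the end of \<open>s\<close>
  never influences a pointer.\<close>

lemma sub_cong:
  assumes "backward s" and "I \<inter> {..<length s} = J \<inter> {..<length s}"
  shows "sub s I = sub s J"
  using assms
proof (induction s rule: rev_induct)
  case (snoc x s)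
  have "backward s" using snoc.prems(1) by (simp add: back_snoc)
  have mem: "i \<in> I \<longleftrightarrow> i \<in> J" if "i \<le> length s" for i
  proof -
    have "i \<in> I \<inter> {..<length (s @ [x])} \<longleftrightarrow> i \<in> J \<inter> {..<length (s @ [x])}"
      using snoc.prems(2) by simp
    then show ?thesis using that by simp
  qed
  then have "I \<inter> {..<length s} = J \<inter> {..<length s}"
    by auto
  with \<open>backward s\<close> have s: "sub s I = sub s J"
    by (rule snoc.IH)
  have "rk I i = rk J i" if "i \<le> length s" for i
    by (rule rk_cong) (use mem that in auto)
  then have "ptr_map I (snd x) = ptr_map J (snd x)"
    using snoc.prems(1) mem by (auto simp: ptr_map_def back_snoc split: option.splits)
  then show ?case
    using s mem by (simp add: sub_snoc)
qed simp

lemma sub_take_eq: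
  assumes "backward s" and "n \<le> length s"
  shows "sub (take n s) I = sub s (I \<inter> {..<n})"
proof -
  have "sub (take n s) I = sub (take n s) (I \<inter> {..<n})"
    by (rule sub_cong) (use assms in \<open>auto simp: back_take\<close>)
  also have "\<dots> = take (rk (I \<inter> {..<n}) n) (sub s (I \<inter> {..<n}))"
    by (rule sub_take) (rule assms)
  also have "\<dots> = sub s (I \<inter> {..<n})"
  proof (rule take_all)
    have "I \<inter> {..<n} \<inter> {..<length s} = I \<inter> {..<n} \<inter> {..<n}"
      using assms(2) by auto
    then show "length (sub s (I \<inter> {..<n})) \<le> rk (I \<inter> {..<n}) n"
      by (simp add: length_sub rk_def)
  qed
  finally show ?thesis .
qed

lemma sub_take_subset:
  "backward s \<Longrightarrow> n \<le> length s \<Longrightarrow> I \<subseteq> {..<n} \<Longrightarrow> sub (take n s) I = sub s I"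
  by (simp add: sub_take_eq inf.absorb1)

lemma back_sub: "backward s \<Longrightarrow> backward (sub s I)"
proof (induction s rule: rev_induct)
  case (snoc x s)
  then show ?case
    by (auto simp: sub_snoc back_snoc length_sub ptr_map_eq_Some rk_less)
qed simp

lemma sub_sub:
  assumes "K \<subseteq> I"
  shows "sub (sub s I) (rk I ` K) = sub s K"
proof (induction s rule: rev_induct)
  case (snoc x s)
  have "length (sub s I) \<in> rk I ` K \<longleftrightarrow> length s \<in> K" if "length s \<in> I"
    using that assms by (auto simp: length_sub) (metis rk_inj subsetD)
  then show ?case
    using snoc assms by (auto simp: sub_snoc ptr_map_image)
qed simp

text \<open>As \<open>n\<close> lies above all of \<open>I\<close> and points backwards, its pointer
  is renumbered by \<open>I\<close> alone.\<close>

lemma sub_insert_last: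
  assumes "backward s" and "n < length s" and "I \<subseteq> {..<n}"
  shows "sub s (insert n I) = sub s I @ [(move_at s n, ptr_map I (ptr s n))]"
proof -
  have "sub s (insert n I) = sub (take (Suc n) s) (insert n I)"
    by (rule sub_take_subset[symmetric]) (use assms in auto)
  also have "\<dots> = sub (take n s) (insert n I) @ [(move_at s n, ptr_map (insert n I) (ptr s n))]"
    using assms(2) by (simp add: take_Suc_conv_app_nth sub_snoc)
  also have "sub (take n s) (insert n I) = sub (take n s) I"
    by (rule sub_cong) (use assms in \<open>auto simp: back_take\<close>)
  also have "sub (take n s) I = sub s I"
    by (rule sub_take_subset) (use assms in auto)
  also have "ptr_map (insert n I) (ptr s n) = ptr_map I (ptr s n)"
  proof (cases "ptr s n")
    case (Some j)
    then have "j < n" using assms by (auto dest: backD)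
    then have "rk (insert n I) j = rk I j" by (intro rk_cong) auto
    then show ?thesis using Some \<open>j < n\<close> by (auto simp: ptr_map_def)
  qed simp
  finally show ?thesis .
qed

section \<open>Jumping views\<close>

text \<open>The positions met when reading \<open>s\<close> backwards from \<open>n\<close>, where a position satisfying \<open>Q\<close> is
  followed by its justifier. The two views are instances, and so is the view of an interaction in
  which only one thread is observed.\<close>

fun jv :: "(nat \<Rightarrow> bool) \<Rightarrow> 'm jseq \<Rightarrow> nat \<Rightarrow> nat set" where
  "jv Q s 0 = {}"
| "jv Q s (Suc i) =
     (if Q i then (case ptr s i of
              None \<Rightarrow> {i}
            | Some j \<Rightarrow> if j < i then insert i (insert j (jv Q s j)) else {i})
      else insert i (jv Q s i))"

lemma jv_step: "\<not> Q i \<Longrightarrow> jv Q s (Suc i) = insert i (jv Q s i)"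
  by simp

lemma jv_jump:
  "Q i \<Longrightarrow> ptr s i = Some j \<Longrightarrow> j < i \<Longrightarrow> jv Q s (Suc i) = insert i (insert j (jv Q s j))"
  by simp

lemma jv_jump':
  "Q i \<Longrightarrow> ptr s i = Some j \<Longrightarrow> j < i \<Longrightarrow> \<not> Q j \<Longrightarrow> jv Q s (Suc i) = insert i (jv Q s (Suc j))"
  by simp

lemma jv_None: "Q i \<Longrightarrow> ptr s i = None \<Longrightarrow> jv Q s (Suc i) = {i}"
  by simp

lemma jv_less: "k \<in> jv Q s n \<Longrightarrow> k < n"
proof (induction n arbitrary: k rule: less_induct)
  case (less n)
  then obtain i where n: "n = Suc i"
    by (cases n) auto
  have "k \<in> jv Q s i \<or> k = i \<or> (\<exists>j<i. k = j \<or> k \<in> jv Q s j)"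
    using less.prems n by (auto split: if_splits option.splits)
  then show ?case
    using less.IH n less_Suc_eq by (metis less_trans)
qed

lemma jv_subset: "jv Q s n \<subseteq> {..<n}"
  using jv_less by auto

lemma jv_top: "n \<in> jv Q s (Suc n)"
  by (auto split: option.splits)

declare jv.simps(2) [simp del]

lemma jv_cong:
  assumes "\<And>i. i < n \<Longrightarrow> Q i = Q' i" and "\<And>i. i < n \<Longrightarrow> ptr s i = ptr s' i"
  shows "jv Q s n = jv Q' s' n"
  using assms
proof (induction n rule: less_induct)
  case (less n)
  show ?case
  proof (cases n)
    case (Suc i)
    then have "jv Q s i = jv Q' s' i" "\<And>j. j < i \<Longrightarrow> jv Q s j = jv Q' s' j"
      using less by auto
    then show ?thesis
      using Suc less.prems by (auto simp: jv.simps(2) split: option.splits)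
  qed simp
qed

text \<open>After a jump the reading goes on below the target, whether or not the target satisfies
  \<open>Q\<close>. Under this condition that is the same as reading from just after the target,
  which makes views nested.\<close>

definition no_chain :: "(nat \<Rightarrow> bool) \<Rightarrow> 'm jseq \<Rightarrow> bool" where
  "no_chain Q s \<longleftrightarrow> (\<forall>i<length s. \<forall>j. Q i \<longrightarrow> ptr s i = Some j \<longrightarrow> \<not> Q j)"

text \<open>Reading backwards has no memory: once \<open>k\<close> is met, the rest is the reading
  that starts there. For the target of a jump this is where \<open>no_chain\<close> enters.\<close>

lemma jv_closed:
  assumes "backward s" and nc: "no_chain Q s"
  shows "n \<le> length s \<Longrightarrow> k \<in> jv Q s n \<Longrightarrow> jv Q s n \<inter> {..k} = jv Q s (Suc k)"
proof (induction n rule: less_induct)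
  case (less n)
  then obtain i where n: "n = Suc i"
    by (cases n) auto
  show ?case
  proof (cases "k = i")
    case True
    then show ?thesis
      using n jv_subset[of Q s n] by (auto simp: less_Suc_eq_le)
  next
    case False
    then have k: "k < i"
      using less.prems(2) n jv_less[of k Q s n] by simp
    show ?thesis
    proof (cases "Q i")
      case True
      then obtain j where j: "ptr s i = Some j" "j < i" "k \<in> insert j (jv Q s j)"
        using less.prems(2) n k by (auto simp: jv.simps(2) split: option.splits if_splits)
      have nQ: "\<not> Q j"
        using nc[unfolded no_chain_def, rule_format, of i j] less.prems(1) n True j(1) by simp
      have "k \<in> jv Q s (Suc j)"
        using j nQ by (simp add: jv_step)
      moreover have "Suc j < n" using j n by simp
      ultimately have "jv Q s (Suc j) \<inter> {..k} = jv Q s (Suc k)"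
        using less.IH[of "Suc j"] less.prems by simp
      moreover have "jv Q s n \<inter> {..k} = jv Q s (Suc j) \<inter> {..k}"
        using n k jv_jump'[OF True j(1,2) nQ] by auto
      ultimately show ?thesis by simp
    next
      case False
      then have "k \<in> jv Q s i"
        using less.prems(2) n k by (auto simp: jv_step)
      then have "jv Q s i \<inter> {..k} = jv Q s (Suc k)"
        using less.IH[of i] less.prems n by simp
      moreover have "jv Q s n \<inter> {..k} = jv Q s i \<inter> {..k}"
        using n False k by (auto simp: jv_step)
      ultimately show ?thesis by simp
    qed
  qed
qed

lemma jv_mono:
  "backward s \<Longrightarrow> no_chain Q s \<Longrightarrow> n \<le> length s \<Longrightarrow> k \<in> jv Q s n \<Longrightarrow> jv Q s (Suc k) \<subseteq> jv Q s n"
  using jv_closed[of s Q n k] by blast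

lemma jv_ptr:
  assumes "backward s" "no_chain Q s" "n \<le> length s" "k \<in> jv Q s n" "Q k" "ptr s k = Some j"
  shows "j \<in> jv Q s n"
proof -
  have "k < length s"
    using jv_less[OF assms(4)] assms(3) by simp
  then have "j < k"
    using assms(1,6) backD by blast
  then show ?thesis
    using jv_mono[OF assms(1-4)] jv_jump[of Q k s j, OF assms(5,6)] by blast
qed

text \<open>The reading never leaves \<open>I\<close>, so deleting the positions outside
  \<open>I\<close> only renumbers its result.\<close>

lemma jv_sub:
  assumes "backward s" and Q: "\<And>i. i < length s \<Longrightarrow> i \<in> I \<Longrightarrow> Q' (rk I i) = Q i"
  shows "n \<le> length s \<Longrightarrow> jv Q s n \<subseteq> I \<Longrightarrow> jv Q' (sub s I) (rk I n) = rk I ` jv Q s n"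
proof (induction n rule: less_induct)
  case (less n)
  show ?case
  proof (cases n)
    case (Suc i)
    have i: "i \<in> I"
      using less.prems(2) Suc jv_top[of i Q s] by auto
    have rk: "rk I n = Suc (rk I i)"
      using i Suc by (simp add: rk_Suc)
    have Qi: "Q' (rk I i) = Q i"
      using Q less.prems(1) i Suc by simp
    have nth: "ptr (sub s I) (rk I i) = ptr_map I (ptr s i)"
      using i Suc less.prems(1) by (simp add: sub_nth)
    show ?thesis
    proof (cases "Q i")
      case True
      then have Q': "Q' (rk I i)" using Qi by simp
      show ?thesis
      proof (cases "ptr s i")
        case None
        then have "ptr (sub s I) (rk I i) = None" using nth by simp
        then show ?thesis
          unfolding Suc rk[unfolded Suc] by (simp add: jv_None[of Q, OF True None] jv_None[of Q', OF Q'])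
      next
        case (Some j)
        then have j: "j < i"
          using assms(1) less.prems(1) Suc backD by (metis Suc_le_lessD)
        have sub: "j \<in> I" "jv Q s j \<subseteq> I"
          using less.prems(2) unfolding Suc jv_jump[of Q, OF True Some j] by auto
        have p: "rk I j < rk I i" "ptr (sub s I) (rk I i) = Some (rk I j)"
          using j nth Some sub by (auto simp: rk_less)
        have "jv Q' (sub s I) (rk I j) = rk I ` jv Q s j"
          using less.IH[of j] less.prems(1) Suc j sub by simp
        then show ?thesis
          unfolding Suc rk[unfolded Suc] jv_jump[of Q, OF True Some j] jv_jump[of Q', OF Q' p(2,1)] by simp
      qed
    next
      case False
      then have Q': "\<not> Q' (rk I i)" using Qi by simp
      have "jv Q s i \<subseteq> I"
        using less.prems(2) unfolding Suc jv_step[of Q, OF False] by simp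
      then have "jv Q' (sub s I) (rk I i) = rk I ` jv Q s i"
        using less.IH[of i] less.prems(1) Suc by simp
      then show ?thesis
        unfolding Suc rk[unfolded Suc] jv_step[of Q, OF False] jv_step[of Q', OF Q'] by simp
    qed
  qed simp
qed

text \<open>Here the reading may leave \<open>T\<close>, but only by single steps: jumps start and
  end in \<open>T\<close>, so the deleted positions are merely stepped over.\<close>

lemma jv_project:
  assumes "backward s"
    and Q: "\<And>i. i < length s \<Longrightarrow> i \<in> T \<Longrightarrow> Q' (rk T i) = Q i"
    and QT: "\<And>i. i < length s \<Longrightarrow> Q i \<Longrightarrow> i \<in> T"
    and pT: "\<And>i j. i < length s \<Longrightarrow> Q i \<Longrightarrow> ptr s i = Some j \<Longrightarrow> j \<in> T"
  shows "n \<le> length s \<Longrightarrow> jv Q' (sub s T) (rk T n) = rk T ` (jv Q s n \<inter> T)"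
proof (induction n rule: less_induct)
  case (less n)
  show ?case
  proof (cases n)
    case (Suc i)
    have len: "i < length s" using Suc less.prems by simp
    show ?thesis
    proof (cases "i \<in> T")
      case False
      have "\<not> Q i" using QT[OF len] False by blast
      then show ?thesis
        using False Suc less.IH[of i] len by (simp add: rk_Suc jv_step)
    next
      case i: True
      have rk: "rk T n = Suc (rk T i)"
        using i Suc by (simp add: rk_Suc)
      have Qi: "Q' (rk T i) = Q i"
        using Q[OF len i] .
      have nth: "ptr (sub s T) (rk T i) = ptr_map T (ptr s i)"
        using i len by (simp add: sub_nth)
      show ?thesis
      proof (cases "Q i")
        case True
        then have Q': "Q' (rk T i)" using Qi by simp
        show ?thesis
        proof (cases "ptr s i")
          case None
          then have "ptr (sub s T) (rk T i) = None" using nth by simp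
          then show ?thesis
            unfolding Suc rk[unfolded Suc] using i by (simp add: jv_None[of Q, OF True None] jv_None[of Q', OF Q'])
        next
          case (Some j)
          then have j: "j < i"
            using assms(1) len backD by blast
          have jT: "j \<in> T"
            using pT[OF len True Some] .
          have p: "rk T j < rk T i" "ptr (sub s T) (rk T i) = Some (rk T j)"
            using j nth Some jT by (auto simp: rk_less)
          have "jv Q' (sub s T) (rk T j) = rk T ` (jv Q s j \<inter> T)"
            using less.IH[of j] len Suc j by simp
          then show ?thesis
            unfolding Suc rk[unfolded Suc] jv_jump[of Q, OF True Some j] jv_jump[of Q', OF Q' p(2,1)]
            using i jT by simp
        qed
      next
        case False
        then have Q': "\<not> Q' (rk T i)" using Qi by simp
        have "jv Q' (sub s T) (rk T i) = rk T ` (jv Q s i \<inter> T)"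
          using less.IH[of i] len Suc by simp
        then show ?thesis
          unfolding Suc rk[unfolded Suc] jv_step[of Q, OF False] jv_step[of Q', OF Q'] using i by simp
      qed
    qed
  qed simp
qed

section \<open>The views of the two players as jumping views\<close>

definition gv :: "('m, 'z) arena_scheme \<Rightarrow> player \<Rightarrow> 'm jseq \<Rightarrow> nat \<Rightarrow> nat set" where
  "gv A p s n = jv (\<lambda>i. owner A (move_at s i) \<noteq> p) s n"

definition view :: "('m, 'z) arena_scheme \<Rightarrow> player \<Rightarrow> 'm jseq \<Rightarrow> nat \<Rightarrow> 'm jseq" where
  "view A p s n = sub s (gv A p s n)"

lemma player_neq [simp]: "p \<noteq> Opponent \<longleftrightarrow> p = Proponent" "p \<noteq> Proponent \<longleftrightarrow> p = Opponent"
  by (cases p; simp)+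

lemma player_third: "p \<noteq> q \<Longrightarrow> q \<noteq> r \<Longrightarrow> p = (r :: player)"
  by (cases p; cases q; cases r) auto

lemma oview_pos_gv: "oview_pos A s n = gv A Opponent s n"
  unfolding gv_def by (induction n rule: less_induct)
    (case_tac x, auto simp: jv.simps(2) split: option.splits)

lemma pview_pos_gv: "pview_pos A s n = gv A Proponent s n"
  unfolding gv_def by (induction n rule: less_induct)
    (case_tac x, auto simp: jv.simps(2) split: option.splits)

lemma gv_less: "k \<in> gv A p s n \<Longrightarrow> k < n"
  unfolding gv_def by (rule jv_less)

lemma gv_subset: "gv A p s n \<subseteq> {..<n}"
  using gv_less by blast

lemma gv_take: "m \<le> n \<Longrightarrow> n \<le> length s \<Longrightarrow> gv A p (take n s) m = gv A p s m"
  unfolding gv_def by (rule jv_cong) auto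

lemma gv_append: "m \<le> length s \<Longrightarrow> gv A p (s @ t) m = gv A p s m"
  unfolding gv_def by (rule jv_cong) (auto simp: nth_append)

lemma oview_view: "oview A s = view A Opponent s (length s)"
  by (simp add: oview_def view_def oview_pos_gv)

lemma pview_view: "pview A s = view A Proponent s (length s)"
  by (simp add: pview_def view_def pview_pos_gv)

lemma view_take:
  "backward s \<Longrightarrow> m \<le> n \<Longrightarrow> n \<le> length s \<Longrightarrow> view A p (take n s) m = view A p s m"
  unfolding view_def gv_take
  by (rule sub_take_subset) (use gv_subset[of A p s m] in auto)

lemma oview_take: "backward s \<Longrightarrow> n \<le> length s \<Longrightarrow> oview A (take n s) = view A Opponent s n"
  by (simp add: oview_view view_take)

lemma gv_sub:
  assumes "backward s" and "n \<le> length s" and "gv A p s n \<subseteq> I"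
  shows "gv A p (sub s I) (rk I n) = rk I ` gv A p s n"
  using assms(2,3) unfolding gv_def
  by (intro jv_sub[OF assms(1)]) (auto simp: sub_nth)

lemma view_sub:
  assumes "backward s" and "n \<le> length s" and "gv A p s n \<subseteq> I"
  shows "view A p (sub s I) (rk I n) = view A p s n"
  unfolding view_def gv_sub[OF assms] by (rule sub_sub) (rule assms)

lemma gv_own: "owner A (move_at s n) = p \<Longrightarrow> gv A p s (Suc n) = insert n (gv A p s n)"
  unfolding gv_def by (rule jv_step) simp

lemma view_own:
  assumes "backward s" and "n < length s" and "owner A (move_at s n) = p"
  shows "view A p s (Suc n) = view A p s n @ [(move_at s n, ptr_map (gv A p s n) (ptr s n))]"
  unfolding view_def gv_own[OF assms(3)] by (rule sub_insert_last[OF assms(1,2) gv_subset])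

section \<open>The last open question\<close>

text \<open>The stack of open questions as a recursion along pointers: an answer to \<open>j\<close>
  uncovers whatever was on top just before \<open>j\<close>. In contrast to the quantified
  definition of open questions, this form follows the same jumps as a view. The value
  \<open>None\<close> for malformed pointers is a mere default.\<close>

fun lo :: "('m, 'z) arena_scheme \<Rightarrow> 'm jseq \<Rightarrow> nat \<Rightarrow> nat option" where
  "lo A s 0 = None"
| "lo A s (Suc i) =
     (if kind_of A (move_at s i) = Question then Some i
      else (case ptr s i of None \<Rightarrow> None | Some j \<Rightarrow> if j < i then lo A s j else None))"

declare lo.simps(2) [simp del]

lemma kind_neq [simp]: "k \<noteq> Question \<longleftrightarrow> k = Answer" "k \<noteq> Answer \<longleftrightarrow> k = Question"
  by (cases k; simp)+

lemma lo_Question: "kind_of A (move_at s i) = Question \<Longrightarrow> lo A s (Suc i) = Some i"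
  by (simp add: lo.simps)

lemma lo_Answer:
  "kind_of A (move_at s i) = Answer \<Longrightarrow> ptr s i = Some j \<Longrightarrow> j < i \<Longrightarrow> lo A s (Suc i) = lo A s j"
  by (simp add: lo.simps)

lemma lo_less: "lo A s n = Some j \<Longrightarrow> j < n"
proof (induction n arbitrary: j rule: less_induct)
  case (less n)
  then obtain i where n: "n = Suc i" by (cases n) auto
  show ?case
    using less.prems less.IH unfolding n lo.simps
    by (auto split: if_splits option.splits) (meson less_SucI less_trans)
qed

lemma lo_cong: "(\<And>i. i < n \<Longrightarrow> s ! i = t ! i) \<Longrightarrow> lo A s n = lo A t n"
proof (induction n rule: less_induct)
  case (less n)
  show ?case
  proof (cases n)
    case (Suc i)
    then have "\<And>j. j < i \<Longrightarrow> lo A s j = lo A t j" "s ! i = t ! i"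
      using less by auto
    then show ?thesis
      unfolding Suc lo.simps by (auto split: option.splits)
  qed simp
qed

lemma lo_append: "n \<le> length s \<Longrightarrow> lo A (s @ t) n = lo A s n"
  by (rule lo_cong) (simp add: nth_append)

lemma lo_take: "m \<le> n \<Longrightarrow> n \<le> length s \<Longrightarrow> lo A (take n s) m = lo A s m"
  by (rule lo_cong) simp

definition open_at :: "('m, 'z) arena_scheme \<Rightarrow> 'm jseq \<Rightarrow> nat \<Rightarrow> nat \<Rightarrow> bool" where
  "open_at A s n j \<longleftrightarrow> j < n \<and> kind_of A (move_at s j) = Question \<and>
     \<not> (\<exists>k<n. kind_of A (move_at s k) = Answer \<and> ptr s k = Some j)"

lemma open_question_take: "n \<le> length s \<Longrightarrow> open_question A (take n s) j \<longleftrightarrow> open_at A s n j"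
  by (auto simp: open_question_def open_at_def)

definition bracketed_upto :: "('m, 'z) arena_scheme \<Rightarrow> 'm jseq \<Rightarrow> nat \<Rightarrow> bool" where
  "bracketed_upto A s n \<longleftrightarrow> (\<forall>i<n. kind_of A (move_at s i) = Answer \<longrightarrow>
     ptr s i \<noteq> None \<and> ptr s i = lo A s i)"

lemma bracketed_upto_mono: "bracketed_upto A s n \<Longrightarrow> m \<le> n \<Longrightarrow> bracketed_upto A s m"
  unfolding bracketed_upto_def by (meson less_le_trans)

lemma bracketed_uptoD:
  assumes "bracketed_upto A s n" "i < n" "kind_of A (move_at s i) = Answer"
  shows "lo A s i = ptr s i" "ptr s i \<noteq> None"
  using assms unfolding bracketed_upto_def by (metis, blast)

text \<open>In the answer case the answered question was the most recent open one, so every question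
  asked after it is closed; and no older question was answered while it was open. Hence the open
  questions are again those from just before it.\<close>

lemma lo_open:
  "bracketed_upto A s n \<Longrightarrow>
   (case lo A s n of None \<Rightarrow> \<forall>k. \<not> open_at A s n k
    | Some j \<Rightarrow> open_at A s n j \<and> (\<forall>k. open_at A s n k \<longrightarrow> k \<le> j))"
proof (induction n rule: less_induct)
  case (less n)
  have IH: "case lo A s m of None \<Rightarrow> \<forall>k. \<not> open_at A s m k
    | Some j \<Rightarrow> open_at A s m j \<and> (\<forall>k. open_at A s m k \<longrightarrow> k \<le> j)" if "m < n" for m
  proof (rule less.IH[OF that])
    show "bracketed_upto A s m"
      using bracketed_upto_mono[OF less.prems] that by simp
  qed
  show ?case
  proof (cases n)
    case 0
    then show ?thesis by (simp add: open_at_def)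
  next
    case (Suc i)
    show ?thesis
    proof (cases "kind_of A (move_at s i)")
      case Question
      have "open_at A s n i"
      proof -
        have "ptr s k \<noteq> Some i" if "k < n" "kind_of A (move_at s k) = Answer" for k
        proof
          assume k: "ptr s k = Some i"
          then have "lo A s k = Some i"
            using bracketed_uptoD(1)[OF less.prems that] by simp
          then show False
            using lo_less[of A s k i] that Suc by simp
        qed
        then show ?thesis
          using Question Suc by (auto simp: open_at_def)
      qed
      then show ?thesis
        using Question Suc by (auto simp: lo_Question open_at_def)
    next
      case Answer
      then obtain j where j: "ptr s i = Some j" "lo A s i = Some j"
        using bracketed_uptoD[OF less.prems, of i] Suc by auto
      then have "j < i" by (auto dest: lo_less)
      have ji: "open_at A s i j" "\<And>k. open_at A s i k \<Longrightarrow> k \<le> j"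
        using IH[of i] Suc j by auto
      have "open_at A s n k \<longleftrightarrow> open_at A s j k" for k
      proof
        assume k: "open_at A s n k"
        then have "k \<noteq> i" using Answer by (auto simp: open_at_def)
        then have "open_at A s i k"
          using k Suc by (auto simp: open_at_def)
        then have "k \<le> j" using ji by simp
        moreover have "k \<noteq> j"
          using k Answer j Suc by (auto simp: open_at_def)
        ultimately show "open_at A s j k"
          using k \<open>j < i\<close> Suc by (auto simp: open_at_def)
      next
        assume k: "open_at A s j k"
        have "ptr s m \<noteq> Some k" if m: "m < n" "kind_of A (move_at s m) = Answer" for m
        proof
          assume mk: "ptr s m = Some k"
          have "\<not> m < j" using k m mk by (auto simp: open_at_def)
          moreover have "m \<noteq> j" using ji m by (auto simp: open_at_def)
          moreover have "m \<noteq> i" using j mk k by (auto simp: open_at_def)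
          ultimately have "j < m" "m < i" using m Suc by auto
          then have "open_at A s m j"
            using ji by (auto simp: open_at_def)
          moreover have "lo A s m = Some k"
            using bracketed_uptoD(1)[OF less.prems m] mk by simp
          ultimately have "j \<le> k"
            using IH[of m] m by auto
          then show False using k by (simp add: open_at_def)
        qed
        then show "open_at A s n k"
          using k \<open>j < i\<close> Suc by (auto simp: open_at_def)
      qed
      moreover have "lo A s n = lo A s j"
        using lo_Answer[OF Answer j(1) \<open>j < i\<close>] Suc by simp
      ultimately show ?thesis
        using IH[of j] \<open>j < i\<close> Suc by (simp split: option.splits)
    qed
  qed
qed

lemma well_bracketed_iff: "well_bracketed A s \<longleftrightarrow> bracketed_upto A s (length s)"
proof
  assume wb: "well_bracketed A s"
  \<comment> \<open>Induction over prefixes, because \<open>lo_open\<close> speaks about a prefix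
    already known to be bracketed.\<close>
  have "bracketed_upto A s n" if "n \<le> length s" for n
    using that
  proof (induction n)
    case 0
    then show ?case by (simp add: bracketed_upto_def)
  next
    case (Suc n)
    then have IH: "bracketed_upto A s n" by simp
    have "ptr s n \<noteq> None \<and> ptr s n = lo A s n" if a: "kind_of A (move_at s n) = Answer"
    proof -
      obtain j where j: "ptr s n = Some j" "open_at A s n j" "\<And>k. open_at A s n k \<Longrightarrow> k \<le> j"
        using wb a Suc.prems unfolding well_bracketed_def
        by (metis Suc_le_lessD less_imp_le open_question_take)
      then show ?thesis
        using lo_open[OF IH] by (auto split: option.splits intro: antisym)
    qed
    then show ?case
      using IH unfolding bracketed_upto_def by (metis less_Suc_eq)
  qed
  then show "bracketed_upto A s (length s)" by simp
next
  assume b: "bracketed_upto A s (length s)"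
  show "well_bracketed A s"
    unfolding well_bracketed_def
  proof (intro allI impI)
    fix i assume i: "i < length s" "kind_of A (move_at s i) = Answer"
    then obtain j where j: "ptr s i = Some j" "lo A s i = Some j"
      using bracketed_uptoD[OF b] by auto
    have "bracketed_upto A s i"
      using bracketed_upto_mono[OF b] i by simp
    then show "\<exists>j. ptr s i = Some j \<and> open_question A (take i s) j \<and>
        (\<forall>k. open_question A (take i s) k \<longrightarrow> k \<le> j)"
      using lo_open[of A s i] j i by (auto simp: open_question_take)
  qed
qed

lemma complete_iff_lo: "well_bracketed A s \<Longrightarrow> complete A s \<longleftrightarrow> lo A s (length s) = None"
  using lo_open[of A s "length s"] open_question_take[of "length s" s A]
  by (auto simp: well_bracketed_iff complete_def split: option.splits)

section \<open>Legal sequences\<close>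

text \<open>Legality position by position, with views and brackets in recursive form, so that an
  extension is legal by a condition on its last move alone.\<close>

definition legal_at :: "('m, 'z) arena_scheme \<Rightarrow> 'm jseq \<Rightarrow> nat \<Rightarrow> bool" where
  "legal_at A s i \<longleftrightarrow>
     (i > 0 \<longrightarrow> owner A (move_at s (i - 1)) \<noteq> owner A (move_at s i)) \<and>
     (case ptr s i of None \<Rightarrow> enables A None (move_at s i)
      | Some j \<Rightarrow> j < i \<and> j \<in> gv A (owner A (move_at s i)) s i \<and>
          enables A (Some (move_at s j)) (move_at s i)) \<and>
     (kind_of A (move_at s i) = Answer \<longrightarrow> ptr s i \<noteq> None \<and> ptr s i = lo A s i)"

lemma legal_Nil [simp]: "legal A []"
  by (simp add: legal_def justified_def alternating_def visible_def well_bracketed_def)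

lemma legal_iff:
  "legal A s \<longleftrightarrow> (\<forall>i<length s. legal_at A s i)"
proof
  assume l: "legal A s"
  show "\<forall>i<length s. legal_at A s i"
  proof (intro allI impI)
    fix i assume i: "i < length s"
    have 1: "i > 0 \<longrightarrow> owner A (move_at s (i - 1)) \<noteq> owner A (move_at s i)"
    proof
      assume "i > 0"
      then have "Suc (i - 1) < length s" "Suc (i - 1) = i" using i by auto
      then show "owner A (move_at s (i - 1)) \<noteq> owner A (move_at s i)"
        using l unfolding legal_def alternating_def by metis
    qed
    have 2: "case ptr s i of None \<Rightarrow> enables A None (move_at s i)
      | Some j \<Rightarrow> j < i \<and> enables A (Some (move_at s j)) (move_at s i)"
      using l i by (simp add: legal_def justified_def)
    have 3: "\<forall>j. ptr s i = Some j \<longrightarrow> j \<in> gv A (owner A (move_at s i)) s i"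
      using l i unfolding legal_def visible_def oview_pos_gv pview_pos_gv
      by (cases "owner A (move_at s i)") fastforce+
    have 4: "kind_of A (move_at s i) = Answer \<longrightarrow> ptr s i \<noteq> None \<and> ptr s i = lo A s i"
      using l i unfolding legal_def well_bracketed_iff bracketed_upto_def by blast
    show "legal_at A s i"
      unfolding legal_at_def by (intro conjI 1 4) (use 2 3 in \<open>auto split: option.splits\<close>)
  qed
next
  assume "\<forall>i<length s. legal_at A s i"
  note r = this[unfolded legal_at_def]
  show "legal A s"
    unfolding legal_def
  proof (intro conjI)
    show "justified A s"
      unfolding justified_def using r by (auto split: option.splits)
    show "alternating A s"
      unfolding alternating_def using r by fastforce
    show "visible A s"
      unfolding visible_def oview_pos_gv pview_pos_gv using r
      by (auto split: option.splits)
    show "well_bracketed A s"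
      unfolding well_bracketed_iff bracketed_upto_def using r by blast
  qed
qed


lemma legal_at_append: "i < length s \<Longrightarrow> legal_at A (s @ t) i \<longleftrightarrow> legal_at A s i"
  unfolding legal_at_def
  by (auto simp: nth_append gv_append lo_append split: option.splits)

lemma legal_snoc: "legal A (s @ [x]) \<longleftrightarrow> legal A s \<and> legal_at A (s @ [x]) (length s)"
  unfolding legal_iff by (auto simp: less_Suc_eq legal_at_append)

lemma legal_take: "legal A s \<Longrightarrow> legal A (take n s)"
  unfolding legal_iff
  by (metis append_take_drop_id legal_at_append length_take min_less_iff_conj)

lemma legal_prefix: "legal A t \<Longrightarrow> prefix s t \<Longrightarrow> legal A s"
  by (metis legal_take append_eq_conv_conj prefix_def)

lemma legal_backward: "legal A s \<Longrightarrow> backward s"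
  unfolding backward_def legal_iff legal_at_def by fastforce

lemma legal_alternates:
  "legal A s \<Longrightarrow> Suc i < length s \<Longrightarrow> owner A (move_at s i) \<noteq> owner A (move_at s (Suc i))"
  by (auto simp: legal_def alternating_def)

lemma legal_initial: "legal A s \<Longrightarrow> i < length s \<Longrightarrow> ptr s i = None \<Longrightarrow> enables A None (move_at s i)"
  unfolding legal_iff legal_at_def by fastforce

lemma legal_ptr:
  assumes "legal A s" "i < length s" "ptr s i = Some j"
  shows "j < i" "enables A (Some (move_at s j)) (move_at s i)" "j \<in> gv A (owner A (move_at s i)) s i"
  using assms unfolding legal_iff legal_at_def by fastforce+

lemma legal_answer:
  assumes "legal A s" "i < length s" "kind_of A (move_at s i) = Answer"
  shows "ptr s i \<noteq> None" "ptr s i = lo A s i"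
  using assms unfolding legal_iff legal_at_def by blast+

lemma arena_initial: "arena A \<Longrightarrow> enables A None m \<Longrightarrow> owner A m = Opponent \<and> kind_of A m = Question"
  by (simp add: arena_def)

lemma arena_owner: "arena A \<Longrightarrow> enables A (Some m) n \<Longrightarrow> owner A m \<noteq> owner A n"
  by (simp add: arena_def)

section \<open>Owners, justifiers and views in legal sequences\<close>

lemma legal_initial_iff:
  assumes "arena A" "legal A s" "i < length s"
  shows "enables A None (move_at s i) \<longleftrightarrow> ptr s i = None"
  using legal_initial[OF assms(2,3)] legal_ptr[OF assms(2,3)] assms(1)
  by (cases "ptr s i") (auto simp: arena_def)

lemma legal_no_chain:
  assumes "arena A" "legal A s"
  shows "no_chain (\<lambda>i. owner A (move_at s i) \<noteq> p) s"
  unfolding no_chain_def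
proof (intro allI impI)
  fix i j assume i: "i < length s" "owner A (move_at s i) \<noteq> p" "ptr s i = Some j"
  show "\<not> owner A (move_at s j) \<noteq> p"
    using player_third[OF arena_owner[OF assms(1) legal_ptr(2)[OF assms(2) i(1,3)]] i(2)] by simp
qed

lemma legal_P_ptr:
  assumes "arena A" "legal A s" "i < length s" "owner A (move_at s i) = Proponent"
  obtains j where "ptr s i = Some j" "j < i" "owner A (move_at s j) = Opponent"
proof (cases "ptr s i")
  case None
  then show ?thesis
    using legal_initial[OF assms(2,3)] arena_initial[OF assms(1)] assms(4) by fastforce
next
  case (Some j)
  have "owner A (move_at s j) \<noteq> owner A (move_at s i)"
    using legal_ptr(2)[OF assms(2,3) Some] arena_owner[OF assms(1)] by blast
  then show ?thesis
    using that[OF Some] legal_ptr(1)[OF assms(2,3) Some] assms(4) by simp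
qed

lemma gv_mono:
  assumes "arena A" "legal A s" "n \<le> length s" "k \<in> gv A p s n"
  shows "gv A p s (Suc k) \<subseteq> gv A p s n"
  using jv_mono[OF legal_backward[OF assms(2)] legal_no_chain[OF assms(1,2)] assms(3)] assms(4)
  unfolding gv_def by blast

lemma gv_None: "owner A (move_at s n) \<noteq> p \<Longrightarrow> ptr s n = None \<Longrightarrow> gv A p s (Suc n) = {n}"
  unfolding gv_def by (rule jv_None) simp_all

lemma gv_other:
  assumes "arena A" "legal A s" "n < length s" "owner A (move_at s n) \<noteq> p" "ptr s n = Some j"
  shows "gv A p s (Suc n) = insert n (gv A p s (Suc j))" "j < n" "owner A (move_at s j) = p"
proof -
  show j: "j < n"
    using legal_ptr(1)[OF assms(2,3,5)] .
  show o: "owner A (move_at s j) = p"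
    using player_third[OF arena_owner[OF assms(1) legal_ptr(2)[OF assms(2,3,5)]] assms(4)] .
  show "gv A p s (Suc n) = insert n (gv A p s (Suc j))"
    unfolding gv_def by (rule jv_jump') (use assms(4,5) j o in simp_all)
qed

lemma gv_top: "n \<in> gv A p s (Suc n)"
  unfolding gv_def by (rule jv_top)

lemma view_other:
  assumes "arena A" "legal A s" "n < length s" "owner A (move_at s n) \<noteq> p" "ptr s n = Some j"
  shows "view A p s (Suc n) = view A p s (Suc j) @ [(move_at s n, Some (rk (gv A p s (Suc j)) j))]"
proof -
  note j = gv_other[OF assms]
  have "gv A p s (Suc j) \<subseteq> {..<n}"
    using gv_subset[of A p s "Suc j"] j(2) by auto
  then show ?thesis
    unfolding view_def j(1)
    using assms(3,5) gv_top[of j A p s]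
    by (simp add: sub_insert_last[OF legal_backward[OF assms(2)]])
qed

lemma length_view: "n \<le> length s \<Longrightarrow> length (view A p s n) = rk (gv A p s n) n"
proof -
  assume "n \<le> length s"
  then have "gv A p s n \<inter> {..<length s} = gv A p s n \<inter> {..<n}"
    using gv_subset[of A p s n] by auto
  then show ?thesis
    by (simp add: view_def length_sub rk_def)
qed

lemma view_0 [simp]: "view A p s 0 = []"
  using length_view[of 0 s A p] by simp

lemma last_view:
  assumes "backward s" "n < length s"
  shows "view A p s (Suc n) \<noteq> []" "fst (last (view A p s (Suc n))) = move_at s n"
    "length (view A p s (Suc n)) = Suc (rk (gv A p s (Suc n)) n)"
proof -
  let ?I = "gv A p s (Suc n)"
  have len: "length (view A p s (Suc n)) = Suc (rk ?I n)"
    using assms(2) gv_top[of n A p s] by (simp add: length_view rk_Suc)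
  have "view A p s (Suc n) ! rk ?I n = (move_at s n, ptr_map ?I (ptr s n))"
    unfolding view_def by (rule sub_nth) (use assms gv_top in auto)
  moreover have "view A p s (Suc n) \<noteq> []"
    using len by force
  ultimately show "view A p s (Suc n) \<noteq> []" "fst (last (view A p s (Suc n))) = move_at s n"
    "length (view A p s (Suc n)) = Suc (rk ?I n)"
    using len by (simp_all add: last_conv_nth)
qed

text \<open>When \<open>p\<close> is to move, the last move, if any, is the other player's. Either
  it is a question, hence itself the last open one, or it answers a move \<open>j\<close> of
  \<open>p\<close>; then both the view and the stack of open questions continue from
  \<open>j\<close>, again with \<open>p\<close> to move.\<close>

lemma view_lo:
  assumes "arena A" "legal A s"
  shows "n \<le> length s \<Longrightarrow> n = 0 \<or> owner A (move_at s (n - 1)) \<noteq> p \<Longrightarrow> gv A p s n \<subseteq> I \<Longrightarrow>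
    lo A (sub s I) (rk I n) = map_option (rk I) (lo A s n) \<and>
    (\<forall>j. lo A s n = Some j \<longrightarrow> j \<in> gv A p s n)"
proof (induction n rule: less_induct)
  case (less n)
  show ?case
  proof (cases n)
    case (Suc i)
    then have len: "i < length s" and own: "owner A (move_at s i) \<noteq> p"
      using less.prems by auto
    have i: "i \<in> I"
      using less.prems(3) gv_top[of i A p s] Suc by auto
    have rk: "rk I n = Suc (rk I i)" using i Suc by (simp add: rk_Suc)
    have nth: "sub s I ! rk I i = (move_at s i, ptr_map I (ptr s i))"
      by (rule sub_nth[OF len i])
    show ?thesis
    proof (cases "kind_of A (move_at s i)")
      case Question
      then show ?thesis
        unfolding rk unfolding Suc using nth gv_top by (simp add: lo_Question)
    next
      case Answer
      then obtain j where j: "ptr s i = Some j"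
        using legal_answer(1)[OF assms(2) len] by auto
      note o = gv_other[OF assms len own j]
      have sub: "gv A p s (Suc j) \<subseteq> I" "gv A p s j \<subseteq> gv A p s (Suc j)"
        using less.prems(3) unfolding Suc o(1) gv_own[OF o(3)] by auto
      have jI: "j \<in> I" using sub gv_top by blast
      have "j = 0 \<or> owner A (move_at s (j - 1)) \<noteq> p"
        using legal_alternates[OF assms(2), of "j - 1"] o(2,3) len by (cases j) auto
      then have IH: "lo A (sub s I) (rk I j) = map_option (rk I) (lo A s j)"
        "\<forall>k. lo A s j = Some k \<longrightarrow> k \<in> gv A p s j"
        using less.IH[of j] o(2) len sub Suc by auto
      have 1: "lo A s (Suc i) = lo A s j"
        by (rule lo_Answer[OF Answer j o(2)])
      have 2: "lo A (sub s I) (Suc (rk I i)) = lo A (sub s I) (rk I j)"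
        by (rule lo_Answer) (use nth Answer j jI o(2) in \<open>simp_all add: rk_less\<close>)
      show ?thesis
        unfolding rk 2 unfolding Suc 1 IH(1)
        using IH(2) sub(2) o(1) by auto
    qed
  qed simp
qed

section \<open>Extending legal sequences\<close>

lemma view_append: "backward (s @ t) \<Longrightarrow> m \<le> length s \<Longrightarrow> view A p (s @ t) m = view A p s m"
  using view_take[of "s @ t" m "length s" A p] by simp

lemma view_snoc:
  assumes "legal A (w @ [x])" "owner A (fst x) = p"
  shows "view A p (w @ [x]) (Suc (length w)) =
    view A p w (length w) @ [(fst x, ptr_map (gv A p w (length w)) (snd x))]"
  using view_own[of "w @ [x]" "length w" A p] view_append[of w "[x]" "length w" A p]
    legal_backward[OF assms(1)] assms(2)
  by (simp add: gv_append)

lemma legal_snoc_ptr: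
  assumes "legal A (w @ [x])" "snd x = Some j"
  shows "j \<in> gv A (owner A (fst x)) w (length w)" "j < length w" "enables A (Some (move_at w j)) (fst x)"
  using legal_ptr[OF assms(1), of "length w" j] assms(2) by (simp_all add: nth_append gv_append)

text \<open>Visibility puts the justifier inside the view, where renumbering is injective, so the
  extended view fixes the pointer as well as the move.\<close>

lemma view_snoc_inj:
  assumes "legal A (w @ [x])" "legal A (w @ [y])" "owner A (fst x) = p"
    and eq: "view A p (w @ [x]) (Suc (length w)) = view A p (w @ [y]) (Suc (length w))"
  shows "x = y"
proof -
  have "fst x = fst y"
    using eq last_view(2)[OF legal_backward[OF assms(1)], of "length w" A p]
      last_view(2)[OF legal_backward[OF assms(2)], of "length w" A p] by simp
  moreover from this have "ptr_map (gv A p w (length w)) (snd x) = ptr_map (gv A p w (length w)) (snd y)"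
    using eq assms(3) by (simp add: view_snoc[OF assms(1)] view_snoc[OF assms(2)])
  moreover have "\<And>j. snd x = Some j \<Longrightarrow> j \<in> gv A p w (length w)"
    using legal_snoc_ptr(1)[OF assms(1)] assms(3) by blast
  moreover have "\<And>j. snd y = Some j \<Longrightarrow> j \<in> gv A p w (length w)"
    using legal_snoc_ptr(1)[OF assms(2)] assms(3) calculation(1) by simp
  ultimately have "snd x = snd y"
    by (cases "snd x"; cases "snd y") (auto simp: rk_eq_iff)
  with \<open>fst x = fst y\<close> show ?thesis
    by (rule prod_eqI)
qed

text \<open>All conditions on a move of \<open>p\<close> can be checked in the view of
  \<open>p\<close>: it shows the last move, it contains the justifier, and by \<open>view_lo\<close>
  it contains the last open question. The move \<open>y\<close> is \<open>x\<close> with its pointer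
  redirected to the position of the same rank in the view of \<open>w\<close>.\<close>

lemma legal_extend:
  assumes ar: "arena A" and w: "legal A w" and v: "legal A (v @ [x])"
    and p: "owner A (fst x) = p"
    and eq: "view A p w (length w) = view A p v (length v)"
  shows "\<exists>y. legal A (w @ [y]) \<and> fst y = fst x \<and> (snd y = None \<longleftrightarrow> snd x = None) \<and>
    view A p (w @ [y]) (Suc (length w)) = view A p (v @ [x]) (Suc (length v))"
proof -
  let ?I = "gv A p w (length w)" and ?J = "gv A p v (length v)"
  have lv: "legal A v" and at: "legal_at A (v @ [x]) (length v)"
    using v by (auto simp: legal_snoc)
  have rkn: "rk ?I (length w) = rk ?J (length v)"
    using eq length_view[of "length w" w A p] length_view[of "length v" v A p] by simp
  \<comment> \<open>A nonempty view ends in the last move of its sequence, so equal views make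
    \<open>p\<close> the player to move after \<open>w\<close> as well.\<close>
  have own: "owner A (move_at w (length w - 1)) \<noteq> p \<and> v \<noteq> []
      \<and> owner A (move_at v (length v - 1)) \<noteq> p" if "w \<noteq> [] \<or> v \<noteq> []"
  proof -
    have ne: "w \<noteq> []" "v \<noteq> []"
      using that eq last_view(1)[OF legal_backward[OF w], of "length w - 1" A p]
        last_view(1)[OF legal_backward[OF lv], of "length v - 1" A p] by auto
    then have "move_at w (length w - 1) = move_at v (length v - 1)"
      using eq last_view(2)[OF legal_backward[OF w], of "length w - 1" A p]
        last_view(2)[OF legal_backward[OF lv], of "length v - 1" A p] by auto
    moreover have "owner A (move_at v (length v - 1)) \<noteq> p"
      using legal_alternates[OF v, of "length v - 1"] ne p by (auto simp: nth_append)
    ultimately show ?thesis using ne by simp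
  qed
  have "\<exists>y. legal_at A (w @ [y]) (length w) \<and> fst y = fst x \<and> (snd y = None \<longleftrightarrow> snd x = None) \<and>
    ptr_map ?I (snd y) = ptr_map ?J (snd x)"
  proof (cases "snd x")
    case None
    then have "enables A None (fst x)"
      using at by (simp add: legal_at_def)
    moreover from this have "kind_of A (fst x) \<noteq> Answer"
      using arena_initial[OF ar] by simp
    ultimately have "legal_at A (w @ [x]) (length w)"
      using own None p by (auto simp: legal_at_def nth_append)
    then show ?thesis using None by (intro exI[of _ x]) simp
  next
    case (Some j)
    have j: "j \<in> ?J" "j < length v" "enables A (Some (move_at v j)) (fst x)"
      using legal_snoc_ptr[OF v Some] p by auto
    have "rk ?J j < rk ?I (length w)"
      using rkn j by (simp add: rk_less)
    then obtain j' where j': "j' < length w" "j' \<in> ?I" "rk ?I j' = rk ?J j"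
      using rk_ex by blast
    have "move_at w j' = move_at v j"
      using sub_nth[OF j'(1,2)] sub_nth[OF j(2,1)] eq j'(3) unfolding view_def by simp
    then have en: "enables A (Some (move_at w j')) (fst x)"
      using j(3) by simp
    have ans: "lo A w (length w) = Some j'" if "kind_of A (fst x) = Answer"
    proof -
      have lo: "lo A v (length v) = Some j"
        using at that Some by (simp add: legal_at_def lo_append)
      have "lo A (sub v ?J) (rk ?J (length v)) = Some (rk ?J j)"
        using view_lo[OF ar lv, of "length v" p ?J] own lo by auto
      moreover have "lo A (sub w ?I) (rk ?I (length w)) = map_option (rk ?I) (lo A w (length w))"
        "\<And>k. lo A w (length w) = Some k \<Longrightarrow> k \<in> ?I"
        using view_lo[OF ar w, of "length w" p ?I] own by auto
      ultimately obtain k where "lo A w (length w) = Some k" "rk ?I k = rk ?I j'" "k \<in> ?I"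
        using eq rkn j'(3) unfolding view_def by (cases "lo A w (length w)") auto
      then show ?thesis
        using rk_inj[OF _ j'(2)] by auto
    qed
    have "legal_at A (w @ [(fst x, Some j')]) (length w)"
      using own p j' en ans unfolding legal_at_def
      by (auto simp: nth_append gv_append lo_append)
    then show ?thesis
      using j' j Some by (intro exI[of _ "(fst x, Some j')"]) simp
  qed
  then obtain y where y: "legal A (w @ [y])" "fst y = fst x" "snd y = None \<longleftrightarrow> snd x = None"
    "ptr_map ?I (snd y) = ptr_map ?J (snd x)"
    using w by (auto simp: legal_snoc)
  have own_y: "owner A (fst y) = p" using y(2) p by simp
  have "view A p (w @ [y]) (Suc (length w)) = view A p (v @ [x]) (Suc (length v))"
    unfolding view_snoc[OF y(1) own_y] view_snoc[OF v p] eq y(2,4) by (rule refl)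
  then show ?thesis
    by (intro exI[of _ y] conjI y(1,2,3))
qed

section \<open>Threads\<close>

text \<open>The guard \<open>j < n\<close> makes the recursion terminate on every sequence; inside a
  sequence that is \<open>backward\<close> it always holds.\<close>

function root :: "'m jseq \<Rightarrow> nat \<Rightarrow> nat" where
  "root s n = (case ptr s n of None \<Rightarrow> n | Some j \<Rightarrow> if j < n then root s j else n)"
  by auto
termination by (relation "measure snd") auto

declare root.simps [simp del]

lemma root_None: "ptr s n = None \<Longrightarrow> root s n = n"
  by (simp add: root.simps[of s n])

lemma root_Some: "ptr s n = Some j \<Longrightarrow> j < n \<Longrightarrow> root s n = root s j"
  by (simp add: root.simps[of s n])

lemma root_le: "root s n \<le> n"
proof (induction n rule: less_induct)
  case (less n)
  show ?case
    unfolding root.simps[of s n] using less by (auto split: option.splits) (meson less_imp_le order_trans)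
qed

lemma root_cong: "(\<And>i. i \<le> n \<Longrightarrow> ptr s i = ptr t i) \<Longrightarrow> root s n = root t n"
proof (induction n rule: less_induct)
  case (less n)
  have "root s j = root t j" if "j < n" for j
    using less.IH[OF that] less.prems that by simp
  then show ?case
    unfolding root.simps[of s n] root.simps[of t n] using less.prems[of n]
    by (auto split: option.splits)
qed

lemma root_append: "n < length s \<Longrightarrow> root (s @ t) n = root s n"
  by (rule root_cong) (simp add: nth_append)

lemma ptr_root: "backward s \<Longrightarrow> n < length s \<Longrightarrow> ptr s (root s n) = None"
proof (induction n rule: less_induct)
  case (less n)
  show ?case
  proof (cases "ptr s n")
    case (Some j)
    then have "j < n" using less.prems backD by blast
    then show ?thesis
      using less Some by (simp add: root_Some)
  qed (simp add: root_None)
qed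

lemma thread_root:
  assumes "backward s" and "ptr s i = None"
  shows "thread s i = {k. k < length s \<and> root s k = i}"
proof -
  let ?R = "{(j, k). k < length s \<and> ptr s k = Some j}"
  have "root s k = i" if "(i, k) \<in> ?R\<^sup>*" for k
    using that
  proof (induction rule: rtrancl_induct)
    case base
    then show ?case using assms(2) by (rule root_None)
  next
    case (step y z)
    then show ?case
      using backD[OF assms(1), of z y] by (simp add: root_Some)
  qed
  moreover have "k < length s \<Longrightarrow> root s k = i \<Longrightarrow> (i, k) \<in> ?R\<^sup>*" for k
  proof (induction k rule: less_induct)
    case (less k)
    show ?case
    proof (cases "ptr s k")
      case None
      then show ?thesis using less.prems by (simp add: root_None)
    next
      case (Some j)
      then have "j < k" using less.prems assms(1) backD by blast
      then have "(i, j) \<in> ?R\<^sup>*" using less Some by (simp add: root_Some)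
      moreover have "(j, k) \<in> ?R" using Some less.prems by simp
      ultimately show ?thesis by (rule rtrancl_into_rtrancl)
    qed
  qed
  ultimately show ?thesis
    unfolding thread_def by blast
qed

text \<open>Not cut off at the length of \<open>s\<close>: \<open>sub\<close> ignores positions
  beyond the end, so their spurious roots do no harm.\<close>

definition tset :: "'m jseq \<Rightarrow> nat \<Rightarrow> nat set" where
  "tset s r = {k. root s k = r}"

lemma tset_ptr: "backward s \<Longrightarrow> i < length s \<Longrightarrow> ptr s i = Some j \<Longrightarrow> j \<in> tset s r \<longleftrightarrow> i \<in> tset s r"
  using backD[of s i j] by (simp add: tset_def root_Some)

lemma sub_thread: "backward s \<Longrightarrow> ptr s i = None \<Longrightarrow> sub s (thread s i) = sub s (tset s i)"
  by (rule sub_cong) (auto simp: thread_root tset_def)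

lemma root_sub:
  assumes "backward s" and cl: "\<And>k j. k \<in> I \<Longrightarrow> k < length s \<Longrightarrow> ptr s k = Some j \<Longrightarrow> j \<in> I"
  shows "k \<in> I \<Longrightarrow> k < length s \<Longrightarrow> root (sub s I) (rk I k) = rk I (root s k) \<and> root s k \<in> I"
proof (induction k rule: less_induct)
  case (less k)
  have nth: "ptr (sub s I) (rk I k) = ptr_map I (ptr s k)"
    using less.prems by (simp add: sub_nth)
  show ?case
  proof (cases "ptr s k")
    case None
    then show ?thesis using nth less.prems by (simp add: root_None)
  next
    case (Some j)
    then have j: "j < k" "j \<in> I" using less.prems assms(1) backD cl by blast+
    then have "ptr (sub s I) (rk I k) = Some (rk I j)" "rk I j < rk I k"
      using nth Some by (simp_all add: rk_less)
    then have "root (sub s I) (rk I k) = root (sub s I) (rk I j)"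
      by (rule root_Some)
    then show ?thesis
      using less.IH[OF j(1,2)] j less.prems root_Some[OF Some j(1)] by simp
  qed
qed

text \<open>A P-view changes threads neither at an O-move, where it jumps to the justifier, nor at a
  P-move, by the assumption on the P-moves below \<open>n\<close>. That assumption is supplied by
  the induction in \<open>P_root\<close>.\<close>

lemma gv_P_root:
  assumes ar: "arena A" and l: "legal A s"
  shows "n \<le> length s \<Longrightarrow> (\<forall>i<n. owner A (move_at s i) = Proponent \<longrightarrow> root s i = root s (i - 1)) \<Longrightarrow>
    k \<in> gv A Proponent s n \<Longrightarrow> root s k = root s (n - 1)"
proof (induction n arbitrary: k rule: less_induct)
  case (less n)
  then obtain i where n: "n = Suc i"
    using gv_less[of k A Proponent s n] by (cases n) auto
  then have len: "i < length s" using less.prems by simp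
  have IH: "root s k = root s (m - 1)" if "m < n" "k \<in> gv A Proponent s m" for m k
  proof (rule less.IH[OF that(1)])
    show "\<forall>i<m. owner A (move_at s i) = Proponent \<longrightarrow> root s i = root s (i - 1)"
      using less.prems(2) that(1) by (meson less_trans)
  qed (use less.prems(1) that in auto)
  show ?case
  proof (cases "owner A (move_at s i)")
    case Proponent
    then have "k = i \<or> k \<in> gv A Proponent s i"
      using less.prems(3) n gv_own by (metis insert_iff)
    moreover have "root s i = root s (i - 1)"
      using less.prems(2) n Proponent by simp
    ultimately show ?thesis
      using IH[of i k] n by auto
  next
    case Opponent
    then have own: "owner A (move_at s i) \<noteq> Proponent" by simp
    show ?thesis
    proof (cases "ptr s i")
      case None
      then show ?thesis
        using less.prems(3) n gv_None[OF own None] by simp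
    next
      case (Some j)
      note o = gv_other[OF ar l len own Some]
      have "k = i \<or> k \<in> gv A Proponent s (Suc j)"
        using less.prems(3) n o(1) by simp
      then show ?thesis
        using IH[of "Suc j" k] o(2) n root_Some[OF Some o(2)] by auto
    qed
  qed
qed

text \<open>The justifier of a P-move lies in the P-view, which stays in the thread of the preceding
  move. So only Opponent can switch threads.\<close>

lemma P_root:
  assumes ar: "arena A" and l: "legal A s"
  shows "i < length s \<Longrightarrow> owner A (move_at s i) = Proponent \<Longrightarrow> root s i = root s (i - 1)"
proof (induction i rule: less_induct)
  case (less i)
  obtain j where j: "ptr s i = Some j" "j < i"
    using legal_P_ptr[OF ar l less.prems] .
  have "j \<in> gv A Proponent s i"
    using legal_ptr(3)[OF l less.prems(1) j(1)] less.prems(2) by simp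
  then have "root s j = root s (i - 1)"
    using gv_P_root[OF ar l, of i j] less by auto
  then show ?case
    using root_Some[OF j] by simp
qed

lemma P_pos:
  assumes "arena A" "legal A s" "i < length s" "owner A (move_at s i) = Proponent"
  shows "0 < i"
  using legal_P_ptr[OF assms] by (metis gr_zeroI not_less0)

lemma gv_P_tset:
  assumes "arena A" "legal A s" "n < length s"
  shows "gv A Proponent s (Suc n) \<subseteq> tset s (root s n)"
  using gv_P_root[OF assms(1,2), of "Suc n"] P_root[OF assms(1,2)] assms(3)
  unfolding tset_def by fastforce

section \<open>The view of an interaction that observes one thread\<close>

definition IV :: "('m, 'z) arena_scheme \<Rightarrow> 'm jseq \<Rightarrow> nat \<Rightarrow> nat \<Rightarrow> nat set" where
  "IV A s r n = jv (\<lambda>i. owner A (move_at s i) = Proponent \<and> root s i = r) s n"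

definition iv :: "('m, 'z) arena_scheme \<Rightarrow> 'm jseq \<Rightarrow> nat \<Rightarrow> nat \<Rightarrow> 'm jseq" where
  "iv A s r n = sub s (IV A s r n)"

lemma IV_less: "k \<in> IV A s r n \<Longrightarrow> k < n"
  unfolding IV_def by (rule jv_less)

lemma IV_subset: "IV A s r n \<subseteq> {..<n}"
  using IV_less by blast

lemma IV_top: "n \<in> IV A s r (Suc n)"
  unfolding IV_def by (rule jv_top)

lemma IV_0 [simp]: "IV A s r 0 = {}"
  by (simp add: IV_def)

lemma IV_step: "\<not> (owner A (move_at s n) = Proponent \<and> root s n = r) \<Longrightarrow>
    IV A s r (Suc n) = insert n (IV A s r n)"
  unfolding IV_def by (rule jv_step)

lemma IV_append: "m \<le> length s \<Longrightarrow> IV A (s @ t) r m = IV A s r m"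
  unfolding IV_def by (rule jv_cong) (auto simp: nth_append root_append)

lemma iv_append:
  assumes "backward (s @ t)" "m \<le> length s"
  shows "iv A (s @ t) r m = iv A s r m"
proof -
  have "IV A s r m \<subseteq> {..<length s}"
    using IV_subset[of A s r m] assms(2) by auto
  then show ?thesis
    using sub_take_subset[of "s @ t" "length s" "IV A s r m"] assms
    by (simp add: iv_def IV_append)
qed

context
  fixes A :: "('m, 'z) arena_scheme" and s :: "'m jseq" and r :: nat
  assumes ar: "arena A" and l: "legal A s"
begin

lemma IV_no_chain: "no_chain (\<lambda>i. owner A (move_at s i) = Proponent \<and> root s i = r) s"
  unfolding no_chain_def using legal_P_ptr[OF ar l] by fastforce

lemma IV_jump:
  assumes "n < length s" "owner A (move_at s n) = Proponent" "root s n = r" "ptr s n = Some j"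
  shows "IV A s r (Suc n) = insert n (IV A s r (Suc j))" "j < n" "owner A (move_at s j) = Opponent"
    "root s j = r"
proof -
  show j: "j < n" "owner A (move_at s j) = Opponent"
    using legal_P_ptr[OF ar l assms(1,2)] assms(4) by auto
  show "IV A s r (Suc n) = insert n (IV A s r (Suc j))"
    unfolding IV_def by (rule jv_jump') (use assms j in simp_all)
  show "root s j = r"
    using assms root_Some[OF assms(4) j(1)] by simp
qed

lemma IV_mono: "n \<le> length s \<Longrightarrow> k \<in> IV A s r n \<Longrightarrow> IV A s r (Suc k) \<subseteq> IV A s r n"
  using jv_mono[OF legal_backward[OF l] IV_no_chain] unfolding IV_def by blast

lemma IV_closed: "n \<le> length s \<Longrightarrow> k \<in> IV A s r n \<Longrightarrow> IV A s r n \<inter> {..k} = IV A s r (Suc k)"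
  using jv_closed[OF legal_backward[OF l] IV_no_chain] unfolding IV_def by blast

text \<open>A jump starts in the thread of \<open>r\<close> and so lands at \<open>r\<close> or
  later; nothing up to \<open>r\<close> is ever skipped. Thus \<open>r\<close>, and with it the
  division of threads into older and younger ones, has the same place in every state.\<close>

lemma IV_initial: "n \<le> length s \<Longrightarrow> {..<min n (Suc r)} \<subseteq> IV A s r n"
proof (induction n rule: less_induct)
  case (less n)
  show ?case
  proof (cases n)
    case (Suc i)
    then have len: "i < length s" using less.prems by simp
    show ?thesis
    proof (cases "owner A (move_at s i) = Proponent \<and> root s i = r")
      case True
      then obtain j where j: "ptr s i = Some j"
        using legal_P_ptr[OF ar l len] by blast
      note o = IV_jump[OF len _ _ j]
      have "r \<le> j"
        using o(4) True root_le[of s j] by simp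
      moreover have "{..<min (Suc j) (Suc r)} \<subseteq> IV A s r (Suc j)"
        using less.IH[of "Suc j"] o(2) True Suc len by simp
      ultimately show ?thesis
        unfolding Suc o(1)[OF conjunct1[OF True] conjunct2[OF True]]
        using o(2) True Suc by (auto simp: min_absorb2)
    next
      case False
      have "{..<min i (Suc r)} \<subseteq> IV A s r i"
        using less.IH[of i] Suc len by simp
      moreover have "{..<min (Suc i) (Suc r)} \<subseteq> insert i {..<min i (Suc r)}"
        by auto
      ultimately show ?thesis
        unfolding Suc IV_step[OF False] by blast
    qed
  qed simp
qed

text \<open>The two claims are proved together because each is used for the other.\<close>

lemma gv_IV:
  "n \<le> length s \<Longrightarrow> gv A Opponent s n \<subseteq> IV A s r n \<and>
    (n = 0 \<or> root s (n - 1) \<noteq> r \<longrightarrow> gv A Proponent s n \<subseteq> IV A s r n)"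
proof (induction n rule: less_induct)
  case (less n)
  show ?case
  proof (cases n)
    case 0
    then show ?thesis
      using gv_subset[of A _ s 0] by auto
  next
    case (Suc i)
    then have len: "i < length s" using less.prems by simp
    have IHi: "gv A Opponent s i \<subseteq> IV A s r i"
      "i = 0 \<or> root s (i - 1) \<noteq> r \<Longrightarrow> gv A Proponent s i \<subseteq> IV A s r i"
      using less.IH[of i] Suc len by auto
    have mono: "IV A s r (Suc k) \<subseteq> IV A s r i" if "k \<in> IV A s r i" for k
      using IV_mono[of i k] that len by simp
    show ?thesis
    proof (cases "owner A (move_at s i)")
      case Opponent
      then have step: "IV A s r (Suc i) = insert i (IV A s r i)"
        by (intro IV_step) simp
      \<comment> \<open>The justifier of the O-move is in the O-view, hence in the state by the
        first claim; from there the P-view is covered by the second claim at an earlier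
        position.\<close>
      have "gv A Proponent s (Suc i) \<subseteq> IV A s r (Suc i)" if "root s i \<noteq> r"
      proof (cases "ptr s i")
        case None
        then show ?thesis
          using gv_None[of A s i Proponent] Opponent step by simp
      next
        case (Some j)
        have "owner A (move_at s i) \<noteq> Proponent" using Opponent by simp
        note o = gv_other[OF ar l len this Some]
        have "j \<in> IV A s r i"
          using legal_ptr(3)[OF l len Some] Opponent IHi(1) by auto
        moreover have "gv A Proponent s (Suc j) \<subseteq> IV A s r (Suc j)"
          using less.IH[of "Suc j"] o(2) Suc len that root_Some[OF Some o(2)] by simp
        ultimately show ?thesis
          using mono[of j] unfolding o(1) step by blast
      qed
      then show ?thesis
        unfolding Suc using IHi(1) gv_own[OF Opponent] step by auto
    next
      case Proponent
      obtain j where j: "ptr s i = Some j"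
        using legal_P_ptr[OF ar l len Proponent] .
      have "owner A (move_at s i) \<noteq> Opponent" using Proponent by simp
      note o = gv_other[OF ar l len this j]
      have IHj: "gv A Opponent s (Suc j) \<subseteq> IV A s r (Suc j)"
        using less.IH[of "Suc j"] o(2) Suc len by simp
      show ?thesis
      proof (cases "root s i = r")
        case True
        then show ?thesis
          unfolding Suc o(1) IV_jump(1)[OF len Proponent True j] using IHj by auto
      next
        case False
        then have step: "IV A s r (Suc i) = insert i (IV A s r i)"
          by (intro IV_step) simp
        have "root s (i - 1) \<noteq> r"
          using P_root[OF ar l len Proponent] False by simp
        then have P: "gv A Proponent s i \<subseteq> IV A s r i"
          using IHi(2) by simp
        moreover have "j \<in> gv A Proponent s i"
          using legal_ptr(3)[OF l len j] Proponent by simp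
        ultimately have "gv A Opponent s (Suc j) \<subseteq> IV A s r i"
          using IHj mono[of j] by blast
        then show ?thesis
          unfolding Suc o(1) gv_own[OF Proponent] step using P by auto
      qed
    qed
  qed
qed

lemma gv_O_IV: "n \<le> length s \<Longrightarrow> gv A Opponent s n \<subseteq> IV A s r n"
  using gv_IV by blast

lemma gv_P_IV: "n < length s \<Longrightarrow> root s n \<noteq> r \<Longrightarrow> gv A Proponent s (Suc n) \<subseteq> IV A s r (Suc n)"
  using gv_IV[of "Suc n"] by simp

text \<open>Whoever makes a move at which no jump starts has a view contained in the state, and the
  justifier lies in that view.\<close>

lemma ptr_IV:
  assumes "n < length s" "\<not> (owner A (move_at s n) = Proponent \<and> root s n = r)" "ptr s n = Some j"
  shows "j \<in> IV A s r n"
proof (cases "owner A (move_at s n)")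
  case Opponent
  then show ?thesis
    using legal_ptr(3)[OF l assms(1,3)] gv_O_IV[of n] assms(1) by auto
next
  case Proponent
  have "n > 0"
    using P_pos[OF ar l assms(1) Proponent] .
  then have "gv A Proponent s n \<subseteq> IV A s r n"
    using gv_P_IV[of "n - 1"] P_root[OF ar l assms(1) Proponent] assms(1,2) Proponent by simp
  then show ?thesis
    using legal_ptr(3)[OF l assms(1,3)] Proponent by auto
qed

text \<open>This ensures that restriction to the state erases no pointer, so that roots can be
  computed inside it.\<close>

lemma IV_ptr:
  assumes "n \<le> length s" "k \<in> IV A s r n" "ptr s k = Some j"
  shows "j \<in> IV A s r n"
proof -
  have k: "k < length s"
    using IV_less[OF assms(2)] assms(1) by simp
  show ?thesis
  proof (cases "owner A (move_at s k) = Proponent \<and> root s k = r")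
    case True
    then show ?thesis
      using jv_ptr[OF legal_backward[OF l] IV_no_chain assms(1), of k j] assms unfolding IV_def by blast
  next
    case False
    then have "j \<in> IV A s r (Suc k)"
      using ptr_IV[OF k False assms(3)] IV_step[OF False] by simp
    then show ?thesis
      using IV_mono[OF assms(1,2)] by blast
  qed
qed

text \<open>The state is closed under pointers, which gives the first equation. Roots up to
  \<open>r\<close> keep their number and later ones get a number above \<open>r\<close>, so the
  state itself shows on which side of \<open>r\<close> a thread was opened.\<close>

lemma iv_root:
  assumes "n \<le> length s" "k \<in> IV A s r n"
  shows "root (iv A s r n) (rk (IV A s r n) k) = rk (IV A s r n) (root s k)"
    and "root (iv A s r n) (rk (IV A s r n) k) = r \<longleftrightarrow> root s k = r"
    and "root (iv A s r n) (rk (IV A s r n) k) < r \<longleftrightarrow> root s k < r"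
proof -
  let ?I = "IV A s r n"
  have k: "k < n" "k < length s"
    using IV_less[OF assms(2)] assms(1) by auto
  show 1: "root (iv A s r n) (rk ?I k) = rk ?I (root s k)"
    unfolding iv_def using root_sub[OF legal_backward[OF l], of ?I k] IV_ptr[OF assms(1)] assms(2) k by blast
  have ini: "{..<min n (Suc r)} \<subseteq> ?I"
    using IV_initial[OF assms(1)] .
  have "rk ?I (root s k) = root s k" if "root s k \<le> r"
    by (rule rk_initial) (use ini that k root_le[of s k] in auto)
  moreover have "Suc r \<le> rk ?I (root s k)" if "r < root s k"
  proof -
    have "{..<Suc r} \<subseteq> ?I"
      using ini that k root_le[of s k] by (simp add: min_def split: if_splits)
    then have "rk ?I (Suc r) = Suc r" by (rule rk_initial)
    then show ?thesis
      using rk_mono[of "Suc r" "root s k" ?I] that by simp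
  qed
  ultimately have "root s k \<le> r \<and> rk ?I (root s k) = root s k \<or> r < root s k \<and> r < rk ?I (root s k)"
    by (metis Suc_le_eq not_less)
  then show "root (iv A s r n) (rk ?I k) = r \<longleftrightarrow> root s k = r"
    "root (iv A s r n) (rk ?I k) < r \<longleftrightarrow> root s k < r"
    unfolding 1 by auto
qed

text \<open>All jumps of the state stay inside the thread, so \<open>jv_project\<close> applies:
  once the other threads are deleted, these are exactly the jumps of an O-view.\<close>

lemma gv_O_thread:
  "n \<le> length s \<Longrightarrow> gv A Opponent (sub s (tset s r)) (rk (tset s r) n) = rk (tset s r) ` (IV A s r n \<inter> tset s r)"
  unfolding gv_def IV_def
proof (rule jv_project[OF legal_backward[OF l]])
  fix i assume i: "i < length s" "i \<in> tset s r"
  then show "(owner A (move_at (sub s (tset s r)) (rk (tset s r) i)) \<noteq> Opponent) =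
      (owner A (move_at s i) = Proponent \<and> root s i = r)"
    by (simp add: sub_nth) (simp add: tset_def)
next
  fix i j assume i: "i < length s" "owner A (move_at s i) = Proponent \<and> root s i = r" "ptr s i = Some j"
  then show "j \<in> tset s r"
    using tset_ptr[OF legal_backward[OF l] i(1,3), of r] by (simp add: tset_def)
qed (auto simp: tset_def)

lemma oview_thread:
  "n \<le> length s \<Longrightarrow> view A Opponent (sub s (tset s r)) (rk (tset s r) n) = sub s (IV A s r n \<inter> tset s r)"
  unfolding view_def by (simp add: gv_O_thread sub_sub)

text \<open>A P-view lies within one thread and is not affected by deleting the others.\<close>

lemma pview_thread:
  assumes "n < length s" "root s n = r"
  shows "view A Proponent (sub s (tset s r)) (Suc (rk (tset s r) n)) = view A Proponent s (Suc n)"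
proof -
  have "view A Proponent (sub s (tset s r)) (rk (tset s r) (Suc n)) = view A Proponent s (Suc n)"
    by (rule view_sub[OF legal_backward[OF l]]) (use gv_P_tset[OF ar l assms(1)] assms in auto)
  then show ?thesis
    using assms(2) by (simp add: rk_Suc tset_def)
qed

text \<open>The P-view stays in the thread. The O-view of \<open>s\<close> is part of the state,
  whose projection is the O-view of the thread, so justifiers of O-moves remain visible. As pointers
  do not leave the thread, the question answered belongs to it, and being the last open question of
  \<open>s\<close> it is also the last one of the thread.\<close>

lemma legal_thread: "legal A (sub s (tset s r))"
proof -
  let ?T = "tset s r" let ?h = "sub s ?T"
  have ex: "\<exists>i<length s. i \<in> ?T \<and> rk ?T i = k" if "k < length ?h" for k
    using that rk_ex by (simp add: length_sub)
  have nth: "?h ! rk ?T i = (move_at s i, ptr_map ?T (ptr s i))" if "i < length s" "i \<in> ?T" for i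
    using that by (rule sub_nth)
  have ptrT: "j \<in> ?T" if "i < length s" "i \<in> ?T" "ptr s i = Some j" for i j
    using tset_ptr[OF legal_backward[OF l] that(1,3)] that(2) by blast
  have lenh: "rk ?T i < length ?h" if "i < length s" "i \<in> ?T" for i
    using that by (simp add: length_sub rk_less)
  show ?thesis
    unfolding legal_def
  proof (intro conjI)
    show "justified A ?h"
      unfolding justified_def
    proof (intro allI impI)
      fix k assume "k < length ?h"
      then obtain i where i: "i < length s" "i \<in> ?T" "k = rk ?T i"
        using ex by blast
      show "case ptr ?h k of None \<Rightarrow> enables A None (move_at ?h k)
          | Some j \<Rightarrow> j < k \<and> enables A (Some (move_at ?h j)) (move_at ?h k)"
      proof (cases "ptr s i")
        case None
        then show ?thesis
          using nth[OF i(1,2)] i(3) legal_initial[OF l i(1)] by simp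
      next
        case (Some j)
        then have j: "j < i" "j \<in> ?T" "j < length s"
          using legal_ptr(1)[OF l i(1)] ptrT[OF i(1,2)] i(1) by auto
        then show ?thesis
          using nth[OF i(1,2)] nth[OF j(3,2)] i(3) Some legal_ptr(2)[OF l i(1) Some]
          by (simp add: rk_less)
      qed
    qed
    show "alternating A ?h"
      unfolding alternating_def
    proof (intro allI impI)
      fix k assume k: "Suc k < length ?h"
      obtain i where i: "i < length s" "i \<in> ?T" "rk ?T i = Suc k"
        using ex[OF k] by blast
      have "k < length ?h" using k by simp
      then obtain i' where i': "i' < length s" "i' \<in> ?T" "rk ?T i' = k"
        using ex by blast
      have "i' < i"
        using i i' rk_less_iff[OF i'(2) i(2)] by simp
      \<comment> \<open>A P-move directly follows a move of its own thread. So a P-move of the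
        thread comes right after its predecessor in \<open>s\<close>, and an O-move of the thread
        that is not last in \<open>s\<close> is followed by a P-move of the thread; either way the
        owners alternate.\<close>
      have "owner A (move_at s i') \<noteq> owner A (move_at s i)"
      proof
        assume eq: "owner A (move_at s i') = owner A (move_at s i)"
        show False
        proof (cases "owner A (move_at s i)")
          case Proponent
          then have "i - 1 \<in> ?T" "i - 1 < i"
            using P_root[OF ar l i(1)] i(2) \<open>i' < i\<close> by (auto simp: tset_def)
          then have "rk ?T (i - 1) = k"
            using i(3) rk_Suc[of ?T "i - 1"] by simp
          then have "i' = i - 1"
            using rk_inj[OF i'(2) \<open>i - 1 \<in> ?T\<close>] i'(3) by simp
          then show False
            using legal_alternates[OF l, of i'] i(1) eq \<open>i' < i\<close> by simp
        next
          case Opponent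
          then have "owner A (move_at s (Suc i')) = Proponent" and len: "Suc i' < length s"
            using legal_alternates[OF l, of i'] eq i(1) \<open>i' < i\<close> by (metis player_neq(1) Suc_lessI less_trans_Suc, linarith)
          then have "Suc i' \<in> ?T"
            using P_root[OF ar l len] i'(2) by (simp add: tset_def)
          then have "Suc i' = i"
            using rk_inj[of "Suc i'" ?T i] i i' by (simp add: rk_Suc)
          then show False
            using Opponent \<open>owner A (move_at s (Suc i')) = Proponent\<close> by simp
        qed
      qed
      then show "owner A (move_at ?h k) \<noteq> owner A (move_at ?h (Suc k))"
        using nth[OF i(1,2)] nth[OF i'(1,2)] i(3) i'(3) by simp
    qed
    show "visible A ?h"
      unfolding visible_def oview_pos_gv pview_pos_gv
    proof (intro allI impI)
      fix k jj assume k: "k < length ?h" "ptr ?h k = Some jj"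
      then obtain i where i: "i < length s" "i \<in> ?T" "k = rk ?T i"
        using ex by blast
      then obtain j where j: "ptr s i = Some j" "jj = rk ?T j" "j \<in> ?T"
        using k(2) nth[OF i(1,2)] by (auto simp: ptr_map_eq_Some)
      note v = legal_ptr(3)[OF l i(1) j(1)]
      have mv: "move_at ?h k = move_at s i"
        using nth[OF i(1,2)] i(3) by simp
      show "jj \<in> (if owner A (move_at ?h k) = Proponent then gv A Proponent ?h k else gv A Opponent ?h k)"
      proof (cases "owner A (move_at s i)")
        case Proponent
        have "i > 0" using P_pos[OF ar l i(1) Proponent] .
        then have "gv A Proponent s i \<subseteq> ?T"
          using gv_P_tset[OF ar l, of "i - 1"] P_root[OF ar l i(1) Proponent] i by (simp add: tset_def)
        then have "gv A Proponent ?h k = rk ?T ` gv A Proponent s i"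
          unfolding i(3) using gv_sub[OF legal_backward[OF l], of i A Proponent ?T] i(1) by simp
        then show ?thesis
          using v Proponent mv j(2) by simp
      next
        case Opponent
        have "j \<in> IV A s r i"
          using v Opponent gv_O_IV[of i] i(1) by auto
        then have "jj \<in> gv A Opponent ?h k"
          unfolding i(3) using gv_O_thread[of i] i(1) j by auto
        then show ?thesis
          using Opponent mv by simp
      qed
    qed
    show "well_bracketed A ?h"
      unfolding well_bracketed_def
    proof (intro allI impI)
      fix k assume k: "k < length ?h" "kind_of A (move_at ?h k) = Answer"
      then obtain i where i: "i < length s" "i \<in> ?T" "k = rk ?T i"
        using ex by blast
      have ans: "kind_of A (move_at s i) = Answer"
        using k(2) nth[OF i(1,2)] i(3) by simp
      obtain j where j: "ptr s i = Some j" "open_at A s i j" "\<And>m. open_at A s i m \<Longrightarrow> m \<le> j"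
        using l i(1) ans open_question_take[of i s A] unfolding legal_def well_bracketed_def
        by (metis less_imp_le)
      have jT: "j \<in> ?T" using ptrT[OF i(1,2) j(1)] .
      have op: "open_at A ?h k (rk ?T m) \<longleftrightarrow> open_at A s i m" if m: "m \<in> ?T" "m < i" for m
      proof -
        have mm: "kind_of A (move_at ?h (rk ?T m)) = kind_of A (move_at s m)" "rk ?T m < k"
          using nth[of m] m i by (auto simp: rk_less)
        have "(\<exists>q<k. kind_of A (move_at ?h q) = Answer \<and> ptr ?h q = Some (rk ?T m)) \<longleftrightarrow>
          (\<exists>q<i. kind_of A (move_at s q) = Answer \<and> ptr s q = Some m)" (is "?L \<longleftrightarrow> ?R")
        proof
          assume ?L
          then obtain q where q: "q < k" "kind_of A (move_at ?h q) = Answer" "ptr ?h q = Some (rk ?T m)"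
            by blast
          then obtain q' where q': "q' < i" "q' \<in> ?T" "rk ?T q' = q"
            using rk_ex i(3) by blast
          then have "ptr_map ?T (ptr s q') = Some (rk ?T m)" "kind_of A (move_at s q') = Answer"
            using q nth[of q'] i(1) by auto
          then show ?R
            using q'(1) m rk_inj by (fastforce simp: ptr_map_eq_Some)
        next
          assume ?R
          then obtain q where q: "q < i" "kind_of A (move_at s q) = Answer" "ptr s q = Some m"
            by blast
          then have "q \<in> ?T"
            using tset_ptr[OF legal_backward[OF l], of q m r] m i(1) by simp
          then have "rk ?T q < k" "?h ! rk ?T q = (move_at s q, Some (rk ?T m))"
            using nth[of q] q i m by (auto simp: rk_less)
          then show ?L using q by auto
        qed
        then show ?thesis
          using mm m by (simp add: open_at_def)
      qed
      have ji: "j < i" using j(2) by (simp add: open_at_def)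
      have max: "q \<le> rk ?T j" if q: "open_at A ?h k q" for q
      proof -
        have "q < k" using q by (simp add: open_at_def)
        then obtain m where m: "m < i" "m \<in> ?T" "rk ?T m = q"
          using rk_ex i(3) by blast
        then have "m \<le> j" using op[of m] q j(3) by simp
        then show ?thesis using m(3) rk_mono by blast
      qed
      have "ptr ?h k = Some (rk ?T j)"
        using nth[OF i(1,2)] i(3) j(1) jT by simp
      moreover have "open_at A ?h k (rk ?T j)"
        using op[OF jT ji] j(2) by simp
      ultimately show "\<exists>j. ptr ?h k = Some j \<and> open_question A (take k ?h) j \<and>
          (\<forall>m. open_question A (take k ?h) m \<longrightarrow> m \<le> j)"
        using max k(1) by (auto simp: open_question_take)
    qed
  qed
qed

end

text \<open>This is Opponent's view in the thread of \<open>r\<close> alone; see \<open>pv_thread\<close>.\<close>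

definition pv :: "('m, 'z) arena_scheme \<Rightarrow> 'm jseq \<Rightarrow> nat \<Rightarrow> nat \<Rightarrow> 'm jseq" where
  "pv A s r n = sub s (IV A s r n \<inter> tset s r)"

definition visP :: "('m, 'z) arena_scheme \<Rightarrow> 'm jseq \<Rightarrow> nat \<Rightarrow> nat \<Rightarrow> bool" where
  "visP A s r n \<longleftrightarrow> owner A (move_at s n) = Proponent \<and> root s n = r"

section \<open>How states and thread views change along an interaction\<close>

lemma iv_0 [simp]: "iv A s r 0 = []"
proof -
  have "sub s {} = []"
    by (simp add: sub_def)
  then show ?thesis by (simp add: iv_def)
qed

context
  fixes A :: "('m, 'z) arena_scheme" and s :: "'m jseq" and r :: nat
  assumes ar: "arena A" and l: "legal A s"
begin

lemma length_iv: "n \<le> length s \<Longrightarrow> length (iv A s r n) = rk (IV A s r n) n"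
proof -
  assume "n \<le> length s"
  then have "IV A s r n \<inter> {..<length s} = IV A s r n \<inter> {..<n}"
    using IV_subset[of A s r n] by auto
  then show ?thesis
    by (simp add: iv_def length_sub rk_def)
qed

lemma length_iv_le: "n \<le> length s \<Longrightarrow> length (iv A s r n) \<le> n"
  by (simp add: length_iv rk_le)

lemma iv_step:
  assumes "n < length s" "\<not> visP A s r n"
  shows "iv A s r (Suc n) = iv A s r n @ [(move_at s n, ptr_map (IV A s r n) (ptr s n))]"
  unfolding iv_def IV_step[OF assms(2)[unfolded visP_def]]
  by (rule sub_insert_last[OF legal_backward[OF l] assms(1) IV_subset])

lemma iv_jump:
  assumes "n < length s" "visP A s r n" "ptr s n = Some j"
  shows "iv A s r (Suc n) = iv A s r (Suc j) @ [(move_at s n, Some (length (iv A s r (Suc j)) - 1))]"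
proof -
  note j = IV_jump[OF ar l assms(1) _ _ assms(3), of r] assms(2)[unfolded visP_def]
  have "IV A s r (Suc j) \<subseteq> {..<n}"
    using IV_subset[of A s r "Suc j"] j(2) assms(2) by (auto simp: visP_def)
  then have "iv A s r (Suc n) = iv A s r (Suc j) @ [(move_at s n, ptr_map (IV A s r (Suc j)) (ptr s n))]"
    unfolding iv_def using j(1) assms(1,2) by (simp add: visP_def sub_insert_last[OF legal_backward[OF l]])
  moreover have "length (iv A s r (Suc j)) = Suc (rk (IV A s r (Suc j)) j)"
    using length_iv[of "Suc j"] IV_top[of j A s r] j(2) assms by (simp add: visP_def rk_Suc)
  ultimately show ?thesis
    using assms(3) IV_top[of j A s r] by simp
qed

lemma iv_nth:
  assumes "n \<le> length s" "k \<in> IV A s r n"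
  shows "iv A s r n ! rk (IV A s r n) k = (move_at s k, ptr_map (IV A s r n) (ptr s k))"
  unfolding iv_def by (rule sub_nth) (use assms IV_less[OF assms(2)] in auto)

lemma last_iv:
  assumes "n < length s"
  shows "iv A s r (Suc n) \<noteq> []" "fst (last (iv A s r (Suc n))) = move_at s n"
    "length (iv A s r (Suc n)) = Suc (rk (IV A s r (Suc n)) n)"
proof -
  have len: "length (iv A s r (Suc n)) = Suc (rk (IV A s r (Suc n)) n)"
    using length_iv[of "Suc n"] assms IV_top[of n A s r] by (simp add: rk_Suc)
  then have "iv A s r (Suc n) \<noteq> []" by force
  with len show "iv A s r (Suc n) \<noteq> []" "fst (last (iv A s r (Suc n))) = move_at s n"
    "length (iv A s r (Suc n)) = Suc (rk (IV A s r (Suc n)) n)"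
    using iv_nth[of "Suc n" n] assms IV_top[of n A s r] by (simp_all add: last_conv_nth)
qed

lemma view_iv:
  assumes "n \<le> length s" "gv A p s n \<subseteq> IV A s r n"
  shows "view A p s n = view A p (iv A s r n) (length (iv A s r n))"
  unfolding length_iv[OF assms(1)]
  using view_sub[OF legal_backward[OF l] assms] by (simp add: iv_def)

lemma gv_iv:
  assumes "n \<le> length s" "gv A p s n \<subseteq> IV A s r n"
  shows "rk (IV A s r n) ` gv A p s n = gv A p (iv A s r n) (length (iv A s r n))"
  unfolding length_iv[OF assms(1)]
  using gv_sub[OF legal_backward[OF l] assms] by (simp add: iv_def)

lemma iv_tset:
  assumes "n \<le> length s" "k \<in> IV A s r n"
  shows "rk (IV A s r n) k \<in> tset (iv A s r n) r \<longleftrightarrow> root s k = r"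
  using iv_root(2)[OF ar l assms] by (simp add: tset_def)

text \<open>Roots can be read off the state, so the state determines Opponent's view of the
  thread.\<close>

lemma pv_iv:
  assumes "n \<le> length s"
  shows "pv A s r n = sub (iv A s r n) (tset (iv A s r n) r)"
proof -
  let ?I = "IV A s r n"
  have "pv A s r n = sub (iv A s r n) (rk ?I ` (?I \<inter> tset s r))"
    unfolding pv_def iv_def by (rule sub_sub[symmetric]) simp
  also have "\<dots> = sub (iv A s r n) (tset (iv A s r n) r)"
  proof (rule sub_cong)
    show "backward (iv A s r n)"
      unfolding iv_def by (rule back_sub[OF legal_backward[OF l]])
    have "m \<in> rk ?I ` (?I \<inter> tset s r) \<longleftrightarrow> m \<in> tset (iv A s r n) r" if "m < length (iv A s r n)" for m
    proof -
      obtain k where k: "k \<in> ?I" "rk ?I k = m"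
        using \<open>m < _\<close> rk_ex unfolding length_iv[OF assms] by blast
      have "m \<in> rk ?I ` (?I \<inter> tset s r) \<longleftrightarrow> k \<in> tset s r"
        using k rk_inj by blast
      then show ?thesis
        using iv_tset[OF assms k(1)] k(2) by (simp add: tset_def)
    qed
    then show "rk ?I ` (?I \<inter> tset s r) \<inter> {..<length (iv A s r n)} =
        tset (iv A s r n) r \<inter> {..<length (iv A s r n)}"
      by blast
  qed
  finally show ?thesis .
qed

lemma pv_hidden: "root s n \<noteq> r \<Longrightarrow> pv A s r (Suc n) = pv A s r n"
  unfolding pv_def by (subst IV_step) (auto simp: tset_def)

lemma pv_visible_O:
  assumes "n < length s" "root s n = r" "owner A (move_at s n) = Opponent"
  shows "pv A s r (Suc n) = pv A s r n @ [(move_at s n, ptr_map (IV A s r n \<inter> tset s r) (ptr s n))]"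
proof -
  have "IV A s r (Suc n) \<inter> tset s r = insert n (IV A s r n \<inter> tset s r)"
    using IV_step[of A s n r] assms by (auto simp: tset_def)
  then show ?thesis
    unfolding pv_def using IV_subset[of A s r n]
    by (simp add: sub_insert_last[OF legal_backward[OF l] assms(1)] subset_iff)
qed

lemma pv_visP:
  assumes "n < length s" "visP A s r n" "ptr s n = Some j"
  shows "\<exists>k. pv A s r (Suc n) = pv A s r (Suc j) @ [(move_at s n, k)]"
proof -
  note j = IV_jump[OF ar l assms(1) _ _ assms(3), of r] assms(2)[unfolded visP_def]
  have "IV A s r (Suc n) \<inter> tset s r = insert n (IV A s r (Suc j) \<inter> tset s r)"
    using j by (auto simp: tset_def)
  moreover have "IV A s r (Suc j) \<inter> tset s r \<subseteq> {..<n}"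
    using IV_subset[of A s r "Suc j"] j by auto
  ultimately show ?thesis
    unfolding pv_def by (simp add: sub_insert_last[OF legal_backward[OF l] assms(1)])
qed

lemma pv_thread: "n \<le> length s \<Longrightarrow> view A Opponent (sub s (tset s r)) (rk (tset s r) n) = pv A s r n"
  unfolding pv_def by (rule oview_thread[OF ar l])

text \<open>Views are nested by \<open>IV_closed\<close>. The second claim excludes jumps, since the
  state just before a jump may contain moves that the jump skips.\<close>

lemma iv_prefix:
  assumes "n \<le> length s" "i \<in> IV A s r n"
  shows "iv A s r (Suc i) = take (Suc (rk (IV A s r n) i)) (iv A s r n)"
    and "\<not> visP A s r i \<Longrightarrow> iv A s r i = take (rk (IV A s r n) i) (iv A s r n)"
proof -
  let ?I = "IV A s r n"
  have i: "i < length s" "i < n" using IV_less[OF assms(2)] assms(1) by auto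
  have eq: "IV A s r (Suc i) = ?I \<inter> {..<Suc i}"
    using IV_closed[OF ar l assms] by (simp add: lessThan_Suc_atMost)
  have "iv A s r (Suc i) = sub (take (Suc i) s) ?I"
    unfolding iv_def eq by (rule sub_take_eq[OF legal_backward[OF l], symmetric]) (use i in simp)
  also have "\<dots> = take (rk ?I (Suc i)) (sub s ?I)"
    by (rule sub_take) (use i in simp)
  finally show 1: "iv A s r (Suc i) = take (Suc (rk ?I i)) (iv A s r n)"
    using assms(2) by (simp add: rk_Suc iv_def)
  assume v: "\<not> visP A s r i"
  have "length (iv A s r i) = rk ?I i"
  proof -
    have "length (iv A s r (Suc i)) = Suc (rk (IV A s r (Suc i)) i)"
      using last_iv(3)[OF i(1)] .
    moreover have "rk (IV A s r (Suc i)) i = rk ?I i"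
      by (rule rk_cong) (auto simp: eq)
    ultimately show ?thesis
      using iv_step[OF i(1) v] by simp
  qed
  moreover have "prefix (iv A s r i) (iv A s r n)"
    using iv_step[OF i(1) v] 1 by (metis prefix_order.trans prefixI take_is_prefix)
  ultimately show "iv A s r i = take (rk ?I i) (iv A s r n)"
    by (metis append_eq_conv_conj prefix_def)
qed

text \<open>Both states contain equally many moves of the thread, and those of the shorter one recur
  in the longer one, so none is left for the part beyond.\<close>

lemma hidden_beyond:
  assumes n: "n1 \<le> length s" "n2 \<le> length s" and eq: "pv A s r n1 = pv A s r n2"
    and pre: "prefix (iv A s r n1) (iv A s r n2)"
    and i: "i \<in> IV A s r n2" "length (iv A s r n1) \<le> rk (IV A s r n2) i"
  shows "root s i \<noteq> r"
proof
  assume r: "root s i = r"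
  let ?x = "iv A s r n1" and ?y = "iv A s r n2" and ?k = "rk (IV A s r n2) i"
  have k: "?k < length ?y"
    using length_iv[OF n(2)] rk_less[of i n2 "IV A s r n2"] i(1) IV_less[OF i(1)] by simp
  have "tset ?x r \<inter> {..<length ?x} = tset ?y r \<inter> {..<length ?x}"
    using pre by (auto simp: tset_def prefix_def root_append)
  then have "length (pv A s r n1) = rk (tset ?y r) (length ?x)"
    using pv_iv[OF n(1)] rk_cong by (metis length_sub)
  moreover have "length (pv A s r n2) = rk (tset ?y r) (length ?y)"
    using pv_iv[OF n(2)] by (simp add: length_sub)
  moreover have "?k \<in> tset ?y r"
    using iv_tset[OF n(2) i(1)] r by simp
  then have "rk (tset ?y r) ?k < rk (tset ?y r) (length ?y)"
    using k by (simp add: rk_less)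
  moreover have "rk (tset ?y r) (length ?x) \<le> rk (tset ?y r) ?k"
    using i(2) by (rule rk_mono)
  ultimately show False
    using eq by simp
qed

text \<open>Determinism can only be applied at actual positions of \<open>s\<close>. The first move
  of the longer state beyond the shorter one provides such a position \<open>i\<close>, and it is
  hidden by \<open>hidden_beyond\<close>.\<close>

lemma hidden_next:
  assumes n: "n1 \<le> length s" "n2 \<le> length s" and eq: "pv A s r n1 = pv A s r n2"
    and pre: "strict_prefix (iv A s r n1) (iv A s r n2)"
  obtains i where "i < n2" "root s i \<noteq> r" "iv A s r i = iv A s r n1" "prefix (iv A s r (Suc i)) (iv A s r n2)"
proof -
  have p: "prefix (iv A s r n1) (iv A s r n2)" and less: "length (iv A s r n1) < length (iv A s r n2)"
    using pre by (auto simp: strict_prefix_def prefix_length_less)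
  obtain i where i: "i \<in> IV A s r n2" "rk (IV A s r n2) i = length (iv A s r n1)"
    using less rk_ex unfolding length_iv[OF n(2)] by blast
  have h: "root s i \<noteq> r"
    using hidden_beyond[OF n eq p i(1)] i(2) by simp
  then have "iv A s r i = take (length (iv A s r n1)) (iv A s r n2)"
    using iv_prefix(2)[OF n(2) i(1)] i(2) by (simp add: visP_def)
  also have "\<dots> = iv A s r n1"
    using p by (metis append_eq_conv_conj prefix_def)
  finally have "iv A s r i = iv A s r n1" .
  moreover have "prefix (iv A s r (Suc i)) (iv A s r n2)"
    unfolding iv_prefix(1)[OF n(2) i(1)] by (rule take_is_prefix)
  ultimately show ?thesis
    using that[of i] IV_less[OF i(1)] h by blast
qed

end

lemma gv_IV_step:
  assumes "arena A" "legal A s" "n < length s" "\<not> visP A s r n"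
  shows "gv A (owner A (move_at s n)) s n \<subseteq> IV A s r n"
proof (cases "owner A (move_at s n)")
  case Opponent
  then show ?thesis
    using gv_O_IV[OF assms(1,2), of n] assms(3) by simp
next
  case Proponent
  have "0 < n" using P_pos[OF assms(1-3) Proponent] .
  moreover have "root s (n - 1) \<noteq> r"
    using P_root[OF assms(1-3) Proponent] assms(4) Proponent by (simp add: visP_def)
  ultimately show ?thesis
    using gv_P_IV[OF assms(1,2), of "n - 1" r] assms(3) Proponent by simp
qed

section \<open>Two interactions in the same state\<close>

context
  fixes A :: "('m, 'z) arena_scheme" and s s' :: "'m jseq" and r n n' :: nat
  assumes ar: "arena A" and l: "legal A s" and l': "legal A s'"
    and n: "n \<le> length s" and n': "n' \<le> length s'"
    and eq: "iv A s r n = iv A s' r n'"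
begin

lemma iv_sync_0: "n = 0 \<longleftrightarrow> n' = 0"
  using last_iv(1)[OF ar l, of "n - 1" r] last_iv(1)[OF ar l', of "n' - 1" r] eq n n'
  by (cases n; cases n') auto

lemma iv_sync_pv: "pv A s r n = pv A s' r n'"
  using pv_iv[OF ar l n] pv_iv[OF ar l' n'] eq by simp

lemma iv_sync_last:
  assumes "n > 0"
  shows "move_at s (n - 1) = move_at s' (n' - 1)"
    and "root s (n - 1) = r \<longleftrightarrow> root s' (n' - 1) = r"
    and "root s (n - 1) < r \<longleftrightarrow> root s' (n' - 1) < r"
proof -
  obtain m m' where m: "n = Suc m" "n' = Suc m'"
    using assms iv_sync_0 by (metis gr0_implies_Suc not_gr_zero)
  have 1: "rk (IV A s r n) m = rk (IV A s' r n') m'"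
    using last_iv(3)[OF ar l, of m r] last_iv(3)[OF ar l', of m' r] n n' eq unfolding m by simp
  show "move_at s (n - 1) = move_at s' (n' - 1)"
    using last_iv(2)[OF ar l, of m r] last_iv(2)[OF ar l', of m' r] n n' eq unfolding m by simp
  show "root s (n - 1) = r \<longleftrightarrow> root s' (n' - 1) = r"
    using iv_root(2)[OF ar l n, where r = r and k = m] iv_root(2)[OF ar l' n', where r = r and k = m'] 1 eq unfolding m by (simp add: IV_top)
  show "root s (n - 1) < r \<longleftrightarrow> root s' (n' - 1) < r"
    using iv_root(3)[OF ar l n, where r = r and k = m] iv_root(3)[OF ar l' n', where r = r and k = m'] 1 eq unfolding m by (simp add: IV_top)
qed

lemma iv_sync_view:
  assumes "gv A p s n \<subseteq> IV A s r n" "gv A p s' n' \<subseteq> IV A s' r n'"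
  shows "view A p s n = view A p s' n'"
  using view_iv[OF ar l n assms(1)] view_iv[OF ar l' n' assms(2)] eq by simp

lemma iv_sync_oview: "view A Opponent s n = view A Opponent s' n'"
  by (rule iv_sync_view) (rule gv_O_IV[OF ar] l l' n n')+

lemma iv_sync_pview:
  assumes "n > 0" "root s (n - 1) \<noteq> r"
  shows "view A Proponent s n = view A Proponent s' n'"
proof (rule iv_sync_view)
  have "n' > 0" "root s' (n' - 1) \<noteq> r"
    using iv_sync_0 iv_sync_last(2) assms by auto
  then show "gv A Proponent s' n' \<subseteq> IV A s' r n'"
    using gv_P_IV[OF ar l', of "n' - 1" r] n' by simp
  show "gv A Proponent s n \<subseteq> IV A s r n"
    using gv_P_IV[OF ar l, of "n - 1" r] n assms by simp
qed

text \<open>Both justifiers lie in the mover's view, which is part of the common state; the extended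
  views say that they agree there, so they agree as pointers within the state.\<close>

lemma iv_sync_step:
  assumes len: "n < length s" "n' < length s'"
    and v: "\<not> visP A s r n" "\<not> visP A s' r n'"
    and own: "owner A (move_at s n) = p" "owner A (move_at s' n') = p"
    and view: "view A p s (Suc n) = view A p s' (Suc n')"
  shows "iv A s r (Suc n) = iv A s' r (Suc n')"
proof -
  let ?K = "gv A p (iv A s r n) (length (iv A s r n))"
  let ?q = "ptr_map (IV A s r n) (ptr s n)" and ?q' = "ptr_map (IV A s' r n') (ptr s' n')"
  have sub: "gv A p s n \<subseteq> IV A s r n" "gv A p s' n' \<subseteq> IV A s' r n'"
    using gv_IV_step[OF ar l len(1) v(1)] gv_IV_step[OF ar l' len(2) v(2)] own by auto
  have K: "rk (IV A s r n) ` gv A p s n = ?K" "rk (IV A s' r n') ` gv A p s' n' = ?K"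
    using gv_iv[OF ar l n sub(1)] gv_iv[OF ar l' n' sub(2)] eq by auto
  have e: "move_at s n = move_at s' n'"
    "ptr_map (gv A p s n) (ptr s n) = ptr_map (gv A p s' n') (ptr s' n')"
    using view view_own[OF legal_backward[OF l] len(1) own(1)]
      view_own[OF legal_backward[OF l'] len(2) own(2)] by auto
  have "ptr_map ?K ?q = ptr_map ?K ?q'"
    using e(2) ptr_map_image[OF sub(1), of "ptr s n"] ptr_map_image[OF sub(2), of "ptr s' n'"]
    unfolding K by simp
  moreover have "\<And>j. ?q = Some j \<Longrightarrow> j \<in> ?K"
    using legal_ptr(3)[OF l len(1)] own(1) unfolding K(1)[symmetric] by (auto simp: ptr_map_eq_Some)
  moreover have "\<And>j. ?q' = Some j \<Longrightarrow> j \<in> ?K"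
    using legal_ptr(3)[OF l' len(2)] own(2) unfolding K(2)[symmetric] by (auto simp: ptr_map_eq_Some)
  ultimately have "?q = ?q'"
    by (cases ?q; cases ?q') (auto simp: rk_eq_iff)
  then show ?thesis
    using iv_step[OF ar l len(1) v(1)] iv_step[OF ar l' len(2) v(2)] eq e(1) by simp
qed

end

lemma thread_position:
  assumes "k < length (sub s (tset s r))"
  obtains i where "i < length s" "root s i = r" "rk (tset s r) i = k" "rk (tset s r) (Suc i) = Suc k"
    "move_at (sub s (tset s r)) k = move_at s i"
proof -
  obtain i where i: "i < length s" "i \<in> tset s r" "rk (tset s r) i = k"
    using assms rk_ex by (metis length_sub)
  then show ?thesis
    using that[of i] sub_nth[OF i(1,2)] by (simp add: tset_def rk_Suc)
qed

section \<open>Deterministic interactions\<close>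

text \<open>The set is read as a partial function from a view to the next move.\<close>

definition det_views :: "'m jseq set \<Rightarrow> bool" where
  "det_views W \<longleftrightarrow> (\<forall>v x y. v @ [x] \<in> W \<and> v @ [y] \<in> W \<longrightarrow> x = y)"

lemma det_viewsD: "det_views W \<Longrightarrow> v @ [x] \<in> W \<Longrightarrow> v @ [y] \<in> W \<Longrightarrow> x = y"
  unfolding det_views_def by blast

text \<open>An interaction around the thread opened at position \<open>r\<close>: Opponent follows the views in
  \<open>OB\<close>, and Proponent follows \<open>VE\<close> in the threads opened before \<open>r\<close> and \<open>VH\<close> in those opened
  after \<open>r\<close>. The thread of \<open>r\<close> itself is not constrained.\<close>

definition follows :: "('m, 'z) arena_scheme \<Rightarrow> nat \<Rightarrow> 'm jseq set \<Rightarrow> 'm jseq set \<Rightarrow> 'm jseq set \<Rightarrow>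
    'm jseq \<Rightarrow> bool" where
  "follows A r OB VE VH s \<longleftrightarrow> (\<forall>n<length s.
     (owner A (move_at s n) = Opponent \<longrightarrow> view A Opponent s (Suc n) \<in> OB) \<and>
     (owner A (move_at s n) = Proponent \<and> root s n < r \<longrightarrow> view A Proponent s (Suc n) \<in> VE) \<and>
     (owner A (move_at s n) = Proponent \<and> r < root s n \<longrightarrow> view A Proponent s (Suc n) \<in> VH))"

context
  fixes A :: "('m, 'z) arena_scheme" and s :: "'m jseq" and r :: nat
    and OB VE VH :: "'m jseq set"
  assumes ar: "arena A" and l: "legal A s"
    and det: "det_views OB" "det_views VE" "det_views VH"
    and fol: "follows A r OB VE VH s"
begin

text \<open>The surroundings act on views that are parts of the state. The state also tells whose
  turn it is and on which side of \<open>r\<close> the current thread was opened, hence which of the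
  three view functions applies.\<close>

lemma hidden_det:
  assumes len: "n < length s" "n' < length s" and eq: "iv A s r n = iv A s r n'"
    and v: "\<not> visP A s r n"
  shows "\<not> visP A s r n' \<and> iv A s r (Suc n) = iv A s r (Suc n')"
proof -
  have le: "n \<le> length s" "n' \<le> length s" using len by auto
  note sync = iv_sync_0[OF ar l l le eq] iv_sync_last[OF ar l l le eq]
  have own: "owner A (move_at s n) = owner A (move_at s n')"
  proof (cases n)
    case 0
    then show ?thesis using sync(1) by simp
  next
    case (Suc m)
    then obtain m' where m': "n' = Suc m'" using sync(1) by (cases n') auto
    have "owner A (move_at s m) = owner A (move_at s m')"
      using sync(2) Suc m' by simp
    moreover have "owner A (move_at s m) \<noteq> owner A (move_at s n)" "owner A (move_at s m') \<noteq> owner A (move_at s n')"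
      using legal_alternates[OF l] len Suc m' by auto
    ultimately show ?thesis
      using player_third by metis
  qed
  show ?thesis
  proof (cases "owner A (move_at s n)")
    case Opponent
    then have v': "\<not> visP A s r n'" using own by (simp add: visP_def)
    have "view A Opponent s (Suc n) \<in> OB" "view A Opponent s (Suc n') \<in> OB"
      using fol len own Opponent by (auto simp: follows_def)
    then have "view A Opponent s (Suc n) = view A Opponent s (Suc n')"
      using view_own[OF legal_backward[OF l] len(1) Opponent] view_own[OF legal_backward[OF l] len(2), of A Opponent] own Opponent
        iv_sync_oview[OF ar l l le eq] det_viewsD[OF det(1)] by fastforce
    then show ?thesis
      using iv_sync_step[OF ar l l le eq len v v' Opponent] own Opponent v' by simp
  next
    case Proponent
    have "n > 0" using P_pos[OF ar l len(1) Proponent] .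
    have P': "owner A (move_at s n') = Proponent" using own Proponent by simp
    have rt: "root s n = root s (n - 1)" "root s n' = root s (n' - 1)"
      using P_root[OF ar l len(1) Proponent] P_root[OF ar l len(2) P'] by auto
    have nr: "root s n \<noteq> r" "root s n' \<noteq> r" "root s n < r \<longleftrightarrow> root s n' < r"
      using v Proponent sync(3,4) \<open>n > 0\<close> rt by (auto simp: visP_def)
    then have v': "\<not> visP A s r n'" by (simp add: visP_def)
    have W: "\<exists>W. det_views W \<and> view A Proponent s (Suc n) \<in> W \<and> view A Proponent s (Suc n') \<in> W"
    proof (cases "root s n < r")
      case True
      then show ?thesis
        using fol len Proponent P' nr det(2) unfolding follows_def by blast
    next
      case False
      then have "r < root s n" "r < root s n'" using nr by auto
      then show ?thesis
        using fol len Proponent P' nr det(3) unfolding follows_def by blast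
    qed
    have "view A Proponent s n = view A Proponent s n'"
      using iv_sync_pview[OF ar l l le eq \<open>n > 0\<close>] nr(1) rt(1) by simp
    then have "view A Proponent s (Suc n) = view A Proponent s (Suc n')"
      using W view_own[OF legal_backward[OF l] len(1) Proponent] view_own[OF legal_backward[OF l] len(2) P'] det_viewsD by fastforce
    then show ?thesis
      using iv_sync_step[OF ar l l le eq len v v' Proponent P'] v' by simp
  qed
qed

lemma hidden_det_root:
  assumes "n < length s" "n' < length s" "iv A s r n = iv A s r n'" "root s n \<noteq> r"
  shows "root s n' \<noteq> r" "iv A s r (Suc n) = iv A s r (Suc n')"
proof -
  have "\<not> visP A s r n" using assms(4) by (simp add: visP_def)
  then have 1: "\<not> visP A s r n'" "iv A s r (Suc n) = iv A s r (Suc n')"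
    using hidden_det[OF assms(1-3)] by auto
  show "iv A s r (Suc n) = iv A s r (Suc n')" by (rule 1)
  show "root s n' \<noteq> r"
    using iv_sync_last(2)[OF ar l l _ _ 1(2)] assms by simp
qed

text \<open>Hidden moves at the ends are peeled off and put back by determinism. When both ends are
  moves of the thread, the states are compared before them if they are O-moves, and after their
  justifiers if they are P-moves; there they must coincide.\<close>

lemma iv_compare:
  "n1 \<le> length s \<Longrightarrow> n2 \<le> length s \<Longrightarrow> pv A s r n1 = pv A s r n2 \<Longrightarrow>
   prefix (iv A s r n1) (iv A s r n2) \<or> prefix (iv A s r n2) (iv A s r n1)"
proof (induction "n1 + n2" arbitrary: n1 n2 rule: less_induct)
  case less
  let ?iv = "iv A s r" and ?pv = "pv A s r"
  \<comment> \<open>The move at \<open>i1\<close> is hidden. Either the other state is already a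
    prefix of the shortened one, or it continues the shortened one by a hidden move, which by
    determinism is the move removed.\<close>
  have hid: ?case if h: "root s i1 \<noteq> r" "m1 = Suc i1" "m1 \<le> length s" "m2 \<le> length s"
      "?pv m1 = ?pv m2" "{m1, m2} = {n1, n2}" "m1 + m2 = n1 + n2" for m1 m2 i1
  proof -
    have "?pv i1 = ?pv m2"
      using pv_hidden[OF ar l h(1)] h(2,5) by simp
    then have "prefix (?iv i1) (?iv m2) \<or> prefix (?iv m2) (?iv i1)"
      using less.hyps[of i1 m2] h by simp
    then consider "prefix (?iv m2) (?iv i1)" | "strict_prefix (?iv i1) (?iv m2)"
      by (metis prefix_order.order_refl strict_prefix_def)
    then have "prefix (?iv m1) (?iv m2) \<or> prefix (?iv m2) (?iv m1)"
    proof cases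
      case 1
      have "prefix (?iv i1) (?iv m1)"
        using iv_step[OF ar l, of i1 r] h by (simp add: visP_def)
      then show ?thesis using 1 prefix_order.trans by blast
    next
      case 2
      obtain i where i: "i < m2" "?iv i = ?iv i1" "root s i \<noteq> r" "prefix (?iv (Suc i)) (?iv m2)"
        using hidden_next[OF ar l _ h(4) \<open>?pv i1 = ?pv m2\<close> 2] h by (metis Suc_leD)
      then have "?iv (Suc i1) = ?iv (Suc i)"
        using hidden_det_root(2)[of i i1] h by simp
      then show ?thesis using i h by simp
    qed
    then show ?case using h(6) by (metis doubleton_eq_iff)
  qed
  show ?case
  proof (cases "n1 = 0 \<or> n2 = 0")
    case True
    then show ?thesis by auto
  next
    case False
    then obtain i1 i2 where i: "n1 = Suc i1" "n2 = Suc i2"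
      by (metis not0_implies_Suc)
    have len: "i1 < length s" "i2 < length s" using i less.prems by auto
    consider "root s i1 \<noteq> r" | "root s i2 \<noteq> r" | "root s i1 = r" "root s i2 = r" by blast
    then show ?thesis
    proof cases
      case 1
      then show ?thesis using hid[of i1 n1 n2] i less.prems by simp
    next
      case 2
      then show ?thesis using hid[of i2 n2 n1] i less.prems by (simp add: insert_commute)
    next
      case 3
      have ex1: "\<exists>v k. ?pv (Suc j) = v @ [(move_at s j, k)]" if "j < length s" "root s j = r" for j
      proof (cases "owner A (move_at s j)")
        case Opponent
        then show ?thesis using pv_visible_O[OF ar l that] by blast
      next
        case Proponent
        then show ?thesis
          using pv_visP[OF ar l that(1), of r] legal_P_ptr[OF ar l that(1)] that(2)
          by (metis visP_def)
      qed
      then have same: "move_at s i1 = move_at s i2"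
        using ex1[OF len(1) 3(1)] ex1[OF len(2) 3(2)] less.prems(3) i by auto
      \<comment> \<open>If the state at \<open>j2\<close> had a proper extension with the same
        thread view, some position in that very state would go on with a hidden move; but the move
        at \<open>j2\<close> belongs to the thread.\<close>
      have no: False if j: "j1 \<le> length s" "j2 < length s" "?pv j1 = ?pv j2"
        "strict_prefix (?iv j2) (?iv j1)" "root s j2 = r" for j1 j2
      proof -
        have le: "j2 \<le> length s" using j by simp
        obtain i where "i < j1" "root s i \<noteq> r" "?iv i = ?iv j2"
          using hidden_next[OF ar l le j(1) j(3)[symmetric] j(4)] by metis
        then show False
          using hidden_det_root(1)[of i j2] j by simp
      qed
      show ?thesis
      proof (cases "owner A (move_at s i1)")
        case Opponent
        have "?pv i1 = ?pv i2"
          using pv_visible_O[OF ar l len(1) 3(1) Opponent] pv_visible_O[OF ar l len(2) 3(2)]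
            same Opponent less.prems(3) i by simp
        then have "prefix (?iv i1) (?iv i2) \<or> prefix (?iv i2) (?iv i1)"
          using less.hyps[of i1 i2] i len by simp
        then have "?iv i1 = ?iv i2"
          using no[of i1 i2] no[of i2 i1] 3 len \<open>?pv i1 = ?pv i2\<close>
          unfolding strict_prefix_def by (metis less_imp_le)
        then show ?thesis
          using hidden_det[OF len, of] Opponent i by (simp add: visP_def)
      next
        case Proponent
        then have P2: "owner A (move_at s i2) = Proponent" using same by simp
        obtain j1 where j1: "ptr s i1 = Some j1" using legal_P_ptr[OF ar l len(1) Proponent] .
        obtain j2 where j2: "ptr s i2 = Some j2" using legal_P_ptr[OF ar l len(2) P2] .
        have v: "visP A s r i1" "visP A s r i2" using 3 Proponent P2 by (auto simp: visP_def)
        note o1 = IV_jump[OF ar l len(1) Proponent 3(1) j1]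
        note o2 = IV_jump[OF ar l len(2) P2 3(2) j2]
        have eq: "?pv (Suc j1) = ?pv (Suc j2)"
          using pv_visP[OF ar l len(1) v(1) j1] pv_visP[OF ar l len(2) v(2) j2] less.prems(3) i by auto
        \<comment> \<open>Proponent replies at once and in the same thread, so the state after a
          justifier is followed by a move of the thread, as \<open>no\<close> demands.\<close>
        have nx: "Suc j < length s \<and> root s (Suc j) = r" if "j < k" "k < length s"
            "owner A (move_at s j) = Opponent" "root s j = r" for j k
        proof -
          have "Suc j < length s" using that by simp
          moreover from this have "owner A (move_at s (Suc j)) = Proponent"
            using legal_alternates[OF l, of j] that(3) by (metis player_neq(1))
          ultimately show ?thesis
            using P_root[OF ar l, of "Suc j"] that(4) by simp
        qed
        have "prefix (?iv (Suc j1)) (?iv (Suc j2)) \<or> prefix (?iv (Suc j2)) (?iv (Suc j1))"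
          using less.hyps[of "Suc j1" "Suc j2"] eq i o1(2) o2(2) len by simp
        then have "?iv (Suc j1) = ?iv (Suc j2)"
          using no[of "Suc j1" "Suc j2"] no[of "Suc j2" "Suc j1"]
            nx[OF o1(2) len(1) o1(3,4)] nx[OF o2(2) len(2) o2(3,4)] eq
          unfolding strict_prefix_def by (metis less_imp_le)
        then show ?thesis
          using iv_jump[OF ar l len(1) v(1) j1] iv_jump[OF ar l len(2) v(2) j2] same i by simp
      qed
    qed
  qed
qed

text \<open>By \<open>iv_compare\<close> one state extends the other; a proper extension would end
  in a hidden move, while both states end in a move of the thread.\<close>

lemma iv_last_visible:
  assumes len: "n1 < length s" "n2 < length s" and r: "root s n1 = r" "root s n2 = r"
    and eq: "pv A s r (Suc n1) = pv A s r (Suc n2)"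
  shows "iv A s r (Suc n1) = iv A s r (Suc n2)"
proof -
  have *: "x = y" if "x = iv A s r (Suc m1)" "y = iv A s r (Suc m2)" "prefix x y" "m1 < length s" "m2 < length s"
    "root s m2 = r" "pv A s r (Suc m1) = pv A s r (Suc m2)" for m1 m2 x y
  proof (rule ccontr)
    assume "x \<noteq> y"
    then have "length x < length y"
      using \<open>prefix x y\<close> by (simp add: prefix_length_less strict_prefix_def)
    then have "length x \<le> rk (IV A s r (Suc m2)) m2"
      using last_iv(3)[OF ar l, of m2 r] that by simp
    then show False
      using hidden_beyond[OF ar l _ _ that(7), of m2] that by (simp add: IV_top)
  qed
  have "prefix (iv A s r (Suc n1)) (iv A s r (Suc n2)) \<or> prefix (iv A s r (Suc n2)) (iv A s r (Suc n1))"
    using iv_compare[OF _ _ eq] len by simp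
  then show ?thesis
    using *[of _ n1 _ n2] *[of _ n2 _ n1] len r eq by metis
qed

text \<open>The states before the two moves are comparable, and a strictly shorter one would have to
  go on with a hidden move. This is O-innocence of the thread, expressed through states.\<close>

lemma visible_O_det:
  assumes len: "n1 < length s" "n2 < length s" and r: "root s n1 = r" "root s n2 = r"
    and own: "owner A (move_at s n1) = Opponent"
    and eq: "pv A s r n1 = pv A s r n2"
  shows "iv A s r (Suc n1) = iv A s r (Suc n2)"
proof -
  have no: False if j: "j1 < length s" "j2 < length s" "pv A s r j1 = pv A s r j2"
    "strict_prefix (iv A s r j2) (iv A s r j1)" "root s j2 = r" for j1 j2
  proof -
    have le: "j2 \<le> length s" "j1 \<le> length s" using j by auto
    obtain i where "i < j1" "root s i \<noteq> r" "iv A s r i = iv A s r j2"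
      using hidden_next[OF ar l le j(3)[symmetric] j(4)] by metis
    then show False
      using hidden_det_root(1)[of i j2] j by simp
  qed
  have "prefix (iv A s r n1) (iv A s r n2) \<or> prefix (iv A s r n2) (iv A s r n1)"
    using iv_compare[OF _ _ eq] len by simp
  then have "iv A s r n1 = iv A s r n2"
    using no[of n1 n2] no[of n2 n1] len r eq unfolding strict_prefix_def by metis
  then show ?thesis
    using hidden_det[OF len] own by (simp add: visP_def)
qed

lemma O_innocent_thread: "O_innocent A (sub s (tset s r))"
  unfolding O_innocent_def
proof (intro allI impI, elim conjE)
  let ?t = "sub s (tset s r)"
  have bt: "backward ?t" by (rule back_sub[OF legal_backward[OF l]])
  fix s1 o1 s2 o2
  assume p: "prefix (s1 @ [o1]) ?t" "prefix (s2 @ [o2]) ?t"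
    and own: "owner A (fst o1) = Opponent" "owner A (fst o2) = Opponent"
    and eq: "oview A s1 = oview A s2"
  have *: "\<exists>i<length s. root s i = r \<and> move_at s i = fst x \<and> oview A w = pv A s r i \<and> oview A (w @ [x]) = pv A s r (Suc i)"
    if "prefix (w @ [x]) ?t" for w x
  proof -
    have len: "length w < length ?t" using prefix_length_le[OF that] by simp
    have w: "w = take (length w) ?t" "w @ [x] = take (Suc (length w)) ?t" "?t ! length w = x"
      using that by (auto simp: prefix_def)
    obtain i where i: "i < length s" "root s i = r" "rk (tset s r) i = length w"
      "rk (tset s r) (Suc i) = Suc (length w)" "move_at ?t (length w) = move_at s i"
      using thread_position[OF len] .
    have "oview A w = view A Opponent ?t (length w)"
      using oview_take[OF bt, of "length w" A] len w(1) by simp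
    then have "oview A w = pv A s r i"
      using pv_thread[OF ar l, of i r] i by simp
    moreover have "oview A (w @ [x]) = view A Opponent ?t (Suc (length w))"
      using oview_take[OF bt, of "Suc (length w)" A] len w(2) by simp
    then have "oview A (w @ [x]) = pv A s r (Suc i)"
      using pv_thread[OF ar l, of "Suc i" r] i by simp
    ultimately show ?thesis
      using i(1,2,5) w(3) by auto
  qed
  obtain i1 where i1: "i1 < length s" "root s i1 = r" "move_at s i1 = fst o1" "oview A s1 = pv A s r i1"
    "oview A (s1 @ [o1]) = pv A s r (Suc i1)"
    using *[OF p(1)] by blast
  obtain i2 where i2: "i2 < length s" "root s i2 = r" "move_at s i2 = fst o2" "oview A s2 = pv A s r i2"
    "oview A (s2 @ [o2]) = pv A s r (Suc i2)"
    using *[OF p(2)] by blast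
  have "iv A s r (Suc i1) = iv A s r (Suc i2)"
    by (rule visible_O_det) (use i1 i2 own eq in simp_all)
  then have "pv A s r (Suc i1) = pv A s r (Suc i2)"
    using iv_sync_pv[OF ar l l, of "Suc i1" "Suc i2" r] i1(1) i2(1) by simp
  then show "oview A (s1 @ [o1]) = oview A (s2 @ [o2])"
    using i1(5) i2(5) by simp
qed

end

section \<open>Parity, and O-views of complete plays\<close>

lemma legal_parity:
  assumes "arena A" "legal A s"
  shows "i < length s \<Longrightarrow> owner A (move_at s i) = Opponent \<longleftrightarrow> even i"
proof (induction i)
  case 0
  then show ?case using P_pos[OF assms 0] by (cases "owner A (move_at s 0)") auto
next
  case (Suc i)
  then have "owner A (move_at s i) = Opponent \<longleftrightarrow> even i" by simp
  moreover have "owner A (move_at s i) \<noteq> owner A (move_at s (Suc i))"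
    using legal_alternates[OF assms(2) Suc.prems] .
  ultimately show ?case
    by (cases "owner A (move_at s i)"; cases "owner A (move_at s (Suc i))") auto
qed

lemma view_ne: "backward s \<Longrightarrow> n \<le> length s \<Longrightarrow> view A p s n = [] \<longleftrightarrow> n = 0"
  using last_view(1)[of s "n - 1" A p] by (cases n) auto

lemma ovw_view:
  assumes "backward s"
  shows "ovw A s = {view A Opponent s n |n. n \<le> length s}"
proof -
  have "{t. prefix t s} = {take n s |n. n \<le> length s}"
  proof (intro equalityI subsetI)
    fix t assume "t \<in> {t. prefix t s}"
    then have "t = take (length t) s" "length t \<le> length s"
      by (auto simp: prefix_def)
    then show "t \<in> {take n s |n. n \<le> length s}" by blast
  qed (auto simp: take_is_prefix)
  moreover have "ovw A s = oview A ` {t. prefix t s}"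
    unfolding ovw_def by blast
  ultimately show ?thesis
    by (auto simp: oview_take[OF assms] image_iff) (metis oview_take[OF assms])
qed

text \<open>Opponent's view of a complete play consists of the first and last moves of its maximal
  well-bracketed blocks.\<close>

lemma complete_view_length:
  assumes ar: "arena A" and l: "legal A s" and m: "lo A s m = None"
  shows "n \<le> length s \<Longrightarrow> lo A s n = None \<Longrightarrow> even n \<Longrightarrow> m \<le> n \<Longrightarrow>
    length (view A Opponent s m) \<le> length (view A Opponent s n) \<and>
    (m < n \<longrightarrow> length (view A Opponent s m) < length (view A Opponent s n))"
proof (induction n rule: less_induct)
  case (less n)
  show ?case
  proof (cases "m = n")
    case False
    then obtain i where n: "n = Suc i" "m \<le> i"
      using less.prems(4) by (cases n) auto
    have len: "i < length s" using less.prems n by simp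
    have ans: "kind_of A (move_at s i) = Answer"
      using less.prems(2) lo_Question n by (metis kind_neq(1) option.distinct(1))
    then obtain j where j: "ptr s i = Some j" "lo A s i = Some j"
      using legal_answer[OF l len] by (metis not_None_eq)
    have own: "owner A (move_at s i) \<noteq> Opponent"
      using legal_parity[OF ar l len] less.prems(3) n by simp
    note o = gv_other[OF ar l len own j(1)]
    have loj: "lo A s j = None"
      using lo_Answer[OF ans j(1) o(2)] less.prems(2) n by simp
    \<comment> \<open>At a point strictly after \<open>j\<close> and not beyond its answer, the
      question \<open>j\<close> would still be open.\<close>
    have "m \<le> j"
    proof (rule ccontr)
      assume mj: "\<not> m \<le> j"
      have b: "bracketed_upto A s (length s)"
        using l by (simp add: legal_def well_bracketed_iff)
      have "open_at A s i j"
        using lo_open[OF bracketed_upto_mono[OF b, of i]] j(2) len by simp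
      then have "open_at A s m j"
        using mj n(2) by (auto simp: open_at_def)
      then show False
        using lo_open[OF bracketed_upto_mono[OF b, of m]] m n(2) len by simp
    qed
    moreover have "even j"
      using legal_parity[OF ar l, of j] o len by simp
    ultimately have "length (view A Opponent s m) \<le> length (view A Opponent s j)"
      using less.IH[of j] loj o(2) len n by simp
    moreover have "length (view A Opponent s n) = Suc (Suc (length (view A Opponent s j)))"
      using view_other[OF ar l len own j(1)] view_own[OF legal_backward[OF l], of j A Opponent] o len n
      by simp
    ultimately show ?thesis by simp
  qed simp
qed

text \<open>At even length Opponent is to move, so \<open>view_lo\<close> applies: the O-view shows
  whether a question is open.\<close>

lemma oview_lo:
  assumes ar: "arena A" and l: "legal A s" and n: "n \<le> length s" "even n"
  shows "lo A s n = None \<longleftrightarrow> lo A (view A Opponent s n) (length (view A Opponent s n)) = None"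
proof -
  have "n = 0 \<or> owner A (move_at s (n - 1)) \<noteq> Opponent"
    using legal_parity[OF ar l, of "n - 1"] n by (cases n) auto
  then show ?thesis
    using view_lo[OF ar l n(1) _ order_refl] length_view[OF n(1), of A Opponent]
    unfolding view_def by auto
qed

lemma view_parity:
  assumes ar: "arena A" and l: "legal A s" "legal A s'" and n: "n \<le> length s" "n' \<le> length s'"
    and eq: "view A p s n = view A p s' n'"
  shows "even n \<longleftrightarrow> even n'"
proof (cases n)
  case 0
  then show ?thesis
    using eq view_ne[OF legal_backward[OF l(2)] n(2), of A p] by simp
next
  case (Suc m)
  then obtain m' where m': "n' = Suc m'"
    using eq view_ne[OF legal_backward[OF l(2)] n(2), of A p] view_ne[OF legal_backward[OF l(1)] n(1), of A p]
    by (cases n') auto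
  have "move_at s m = move_at s' m'"
    using eq last_view(2)[OF legal_backward[OF l(1)], of m A p] last_view(2)[OF legal_backward[OF l(2)], of m' A p]
      n Suc m' by simp
  then show ?thesis
    using legal_parity[OF ar l(1), of m] legal_parity[OF ar l(2), of m'] n Suc m' by simp
qed

text \<open>Equality would make \<open>k\<close> a point of \<open>t\<close> without open questions,
  so the final O-view of \<open>t\<close> would be strictly longer than the one at \<open>k\<close>.
  But it also occurs in \<open>t'\<close>, at such a point, and so is at most as long as the final
  O-view of \<open>t'\<close>. The replay uses this to see that \<open>t'\<close> has not ended
  while the old thread goes on.\<close>

lemma complete_ovw_last:
  assumes ar: "arena A" and l: "legal A t" "legal A t'"
    and ev: "even (length t)" "even (length t')" and c: "complete A t" "complete A t'"
    and ovw: "ovw A t = ovw A t'" and k: "k < length t"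
  shows "view A Opponent t' (length t') \<noteq> view A Opponent t k"
proof
  assume eq: "view A Opponent t' (length t') = view A Opponent t k"
  have lot: "lo A t (length t) = None" "lo A t' (length t') = None"
    using c l by (auto simp: complete_iff_lo legal_def)
  have "even k"
    using view_parity[OF ar l(2,1) _ _ eq] ev k by simp
  then have "lo A t k = None"
    using oview_lo[OF ar l(1), of k] oview_lo[OF ar l(2), of "length t'"] eq lot k ev by simp
  then have 1: "length (view A Opponent t k) < length (view A Opponent t (length t))"
    using complete_view_length[OF ar l(1), of k "length t"] lot ev k by simp
  have "view A Opponent t (length t) \<in> ovw A t'"
    unfolding ovw[symmetric] ovw_view[OF legal_backward[OF l(1)]] by blast
  then obtain k' where k': "k' \<le> length t'" "view A Opponent t (length t) = view A Opponent t' k'"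
    unfolding ovw_view[OF legal_backward[OF l(2)]] by blast
  have "even k'"
    using view_parity[OF ar l _ k'(1) k'(2)] ev by simp
  then have "lo A t' k' = None"
    using oview_lo[OF ar l(1), of "length t"] oview_lo[OF ar l(2), of k'] k' lot ev by simp
  then show False
    using complete_view_length[OF ar l(2), of k' "length t'"] lot ev k' 1 eq by simp
qed

section \<open>Replacing a thread\<close>

abbreviation th :: "'m jseq \<Rightarrow> nat \<Rightarrow> 'm jseq" where
  "th s r \<equiv> sub s (tset s r)"

text \<open>The pointer \<open>p\<close> is left open here; where it matters, legality and the
  extended view determine it.\<close>

lemma th_snoc:
  assumes "backward (w @ [x])"
  shows "\<exists>p. th (w @ [x]) r = th w r @ (if root (w @ [x]) (length w) = r then [(fst x, p)] else [])"
proof -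
  have "sub w (tset (w @ [x]) r) = th w r"
    by (rule sub_cong) (use assms in \<open>auto simp: back_snoc tset_def root_append\<close>)
  then show ?thesis
    by (simp add: sub_snoc tset_def)
qed

lemma ovw_threadD:
  assumes ar: "arena A" and l: "legal A s" and x: "x \<in> ovw A (th s r)" "x \<noteq> []"
  obtains i where "i < length s" "root s i = r" "x = pv A s r (Suc i)" "fst (last x) = move_at s i"
proof -
  have b: "backward (th s r)" by (rule back_sub[OF legal_backward[OF l]])
  obtain n where n: "n \<le> length (th s r)" "x = view A Opponent (th s r) n"
    using x(1) unfolding ovw_view[OF b] by blast
  then obtain k where k: "n = Suc k" "k < length (th s r)"
    using x(2) by (cases n) auto
  obtain i where i: "i < length s" "root s i = r" "rk (tset s r) (Suc i) = Suc k"
    "move_at (th s r) k = move_at s i"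
    using thread_position[OF k(2)] by metis
  show ?thesis
  proof (rule that[OF i(1,2)])
    show "x = pv A s r (Suc i)"
      using pv_thread[OF ar l, of "Suc i" r] i(1,3) n(2) k(1) by simp
    show "fst (last x) = move_at s i"
      using last_view(2)[OF b k(2), of A Opponent] n(2) k(1) i(4) by simp
  qed
qed

section \<open>Replaying an interaction against another thread with the same O-views\<close>

context
  fixes A :: "('m, 'z) arena_scheme" and s t' :: "'m jseq" and r :: nat
    and OB VE VH :: "'m jseq set"
  assumes ar: "arena A" and l: "legal A s"
    and det: "det_views OB" "det_views VE" "det_views VH"
    and fol: "follows A r OB VE VH s"
    and t: "even (length (th s r))" "complete A (th s r)"
    and t': "legal A t'" "even (length t')" "complete A t'"
    and ovw: "ovw A (th s r) = ovw A t'"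
begin

text \<open>The invariant of the replay. The states of \<open>w\<close> may occur in another order
  than in \<open>s\<close>, and some may recur or be missing.\<close>

definition replay :: "'m jseq \<Rightarrow> bool" where
  "replay w \<longleftrightarrow> legal A w \<and> (\<forall>m\<le>length w. \<exists>n\<le>length s. iv A w r m = iv A s r n) \<and> prefix (th w r) t'"

lemma prefix_nth: "prefix u v \<Longrightarrow> length u < length v \<Longrightarrow> prefix (u @ [v ! length u]) v"
  by (metis append_one_prefix)

lemma oview_th: "legal A w \<Longrightarrow> view A Opponent (th w r) (length (th w r)) = pv A w r (length w)"
  using pv_thread[OF ar, of w "length w" r] by (simp add: length_sub)

text \<open>The mover's view is part of the common state, so the move can be copied. If it is an
  O-move of the thread, it must also be the next move of \<open>t'\<close>: the O-view of that next
  move occurs in the old thread, where \<open>visible_O_det\<close> leaves no choice.\<close>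

lemma replay_step_hidden_or_O:
  assumes w: "replay w" and n: "n < length s" and eq: "iv A w r (length w) = iv A s r n"
    and v: "\<not> visP A s r n"
  shows "\<exists>x. replay (w @ [x]) \<and> iv A (w @ [x]) r (Suc (length w)) = iv A s r (Suc n)"
proof -
  let ?p = "owner A (move_at s n)" and ?N = "length w"
  have lw: "legal A w" and pre: "prefix (th w r) t'" using w by (auto simp: replay_def)
  have le: "n \<le> length s" "?N \<le> length w" using n by auto
  note eq' = eq[symmetric]
  have hid: "0 < n \<and> root s (n - 1) \<noteq> r \<and> ?N > 0 \<and> root w (?N - 1) \<noteq> r" if "?p = Proponent"
  proof -
    have "0 < n" using P_pos[OF ar l n that] .
    moreover have "root s (n - 1) \<noteq> r"
      using v P_root[OF ar l n that] that by (simp add: visP_def)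
    ultimately show ?thesis
      using iv_sync_0[OF ar l lw le eq'] iv_sync_last(2)[OF ar l lw le eq'] by simp
  qed
  have view: "view A ?p s n = view A ?p w ?N"
  proof (cases ?p)
    case Opponent
    then show ?thesis using iv_sync_oview[OF ar l lw le eq'] by simp
  next
    case Proponent
    then show ?thesis using iv_sync_pview[OF ar l lw le eq'] hid by simp
  qed
  have tk: "take (Suc n) s = take n s @ [s ! n]"
    using n by (simp add: take_Suc_conv_app_nth)
  have b: "backward s" using l by (rule legal_backward)
  have "view A ?p w (length w) = view A ?p (take n s) (length (take n s))"
    using view view_take[OF b, of n n A ?p] n by simp
  from legal_extend[OF ar lw legal_take[OF l, of "Suc n", unfolded tk] refl this]
  obtain y where y: "legal A (w @ [y])" "fst y = move_at s n"
    "view A ?p (w @ [y]) (Suc ?N) = view A ?p (take (Suc n) s) (Suc n)"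
    using n unfolding tk by auto
  have viewS: "view A ?p s (Suc n) = view A ?p (w @ [y]) (Suc ?N)"
    using y(3) view_take[OF b, of "Suc n" "Suc n" A ?p] n by simp
  have bw: "backward (w @ [y])" using y(1) by (rule legal_backward)
  have mv: "move_at (w @ [y]) ?N = move_at s n" using y(2) by simp
  have v': "\<not> visP A (w @ [y]) r ?N"
  proof (cases ?p)
    case Proponent
    then have "root (w @ [y]) ?N = root w (?N - 1)"
      using P_root[OF ar y(1), of ?N] mv hid by (simp add: root_append)
    then show ?thesis using hid[OF Proponent] by (simp add: visP_def)
  qed (simp add: visP_def y(2))
  have eqw: "iv A s r n = iv A (w @ [y]) r ?N"
    using eq iv_append[OF bw, of ?N A r] by simp
  have step: "iv A s r (Suc n) = iv A (w @ [y]) r (Suc ?N)"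
    by (rule iv_sync_step[OF ar l y(1) le(1) _ eqw n _ v v' refl _ viewS]) (use mv in simp_all)
  have ivs: "\<forall>m\<le>length (w @ [y]). \<exists>n\<le>length s. iv A (w @ [y]) r m = iv A s r n"
  proof (intro allI impI)
    fix m assume "m \<le> length (w @ [y])"
    then consider "m \<le> ?N" | "m = Suc ?N" by fastforce
    then show "\<exists>n\<le>length s. iv A (w @ [y]) r m = iv A s r n"
    proof cases
      case 1
      then show ?thesis using w iv_append[OF bw, of m A r] by (simp add: replay_def)
    next
      case 2
      then show ?thesis using step n by (intro exI[of _ "Suc n"]) simp
    qed
  qed
  have "prefix (th (w @ [y]) r) t'"
  proof (cases "root (w @ [y]) ?N = r")
    case False
    then show ?thesis using th_snoc[OF bw, of r] pre by auto
  next
    case True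
    then have O: "?p = Opponent"
      using v' mv by (cases ?p) (auto simp: visP_def)
    have lew: "Suc n \<le> length s" "Suc ?N \<le> length (w @ [y])" using n by auto
    have rs: "root s n = r"
      using iv_sync_last(2)[OF ar l y(1) lew step] True by simp
    obtain z where z: "th (w @ [y]) r = th w r @ [z]" "fst z = move_at s n"
      using th_snoc[OF bw, of r] True y(2) by auto
    have lz: "legal A (th w r @ [z])"
      using legal_thread[OF ar y(1), of r] z(1) by simp
    have pvn: "view A Opponent (th w r) (length (th w r)) = pv A s r n"
      using oview_th[OF lw] iv_sync_pv[OF ar l lw le eq'] by simp
    have pvz: "view A Opponent (th w r @ [z]) (Suc (length (th w r))) = pv A s r (Suc n)"
      using oview_th[OF y(1)] iv_sync_pv[OF ar l y(1) lew step] z(1) by simp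
    let ?T = "tset s r"
    have "rk ?T n < length (th s r)"
      using n rs by (simp add: length_sub rk_less tset_def)
    moreover have "pv A s r n = view A Opponent (th s r) (rk ?T n)"
      using pv_thread[OF ar l le(1), of r] by simp
    \<comment> \<open>The old thread still has a move to come at this O-view, which by
      \<open>complete_ovw_last\<close> cannot be the final one of \<open>t'\<close>.\<close>
    ultimately have "th w r \<noteq> t'"
      using complete_ovw_last[OF ar legal_thread[OF ar l, of r] t'(1) t(1) t'(2) t(2) t'(3) ovw] pvn
      by metis
    then have lt: "length (th w r) < length t'"
      using pre by (simp add: prefix_length_less strict_prefix_def)
    let ?o = "t' ! length (th w r)"
    have pre': "prefix (th w r @ [?o]) t'"
      using prefix_nth[OF pre lt] .
    then have lo': "legal A (th w r @ [?o])"
      using legal_prefix[OF t'(1)] by blast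
    have oo: "owner A (fst ?o) = Opponent"
      using legal_parity[OF ar lo', of "length (th w r)"] legal_parity[OF ar lz, of "length (th w r)"] z(2) O
      by simp
    let ?v = "view A Opponent (th w r @ [?o]) (Suc (length (th w r)))"
    have "?v \<in> ovw A t'"
      unfolding ovw_def using pre' by (auto simp: oview_view intro!: exI[of _ "th w r @ [?o]"])
    moreover have "?v \<noteq> []"
      using view_ne[OF legal_backward[OF lo'], of "Suc (length (th w r))" A Opponent] by simp
    ultimately obtain i where i: "i < length s" "root s i = r" "?v = pv A s r (Suc i)"
      "fst (last ?v) = move_at s i"
      using ovw_threadD[OF ar l] unfolding ovw[symmetric] by metis
    have vs: "?v = pv A s r n @ [last ?v]"
      using view_snoc[OF lo' oo] pvn by simp
    have "owner A (move_at s i) = Opponent"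
      using i(4) vs view_snoc[OF lo' oo] oo by simp
    then have "pv A s r i = pv A s r n"
      using pv_visible_O[OF ar l i(1,2)] i(3) vs by (metis append1_eq_conv)
    then have "iv A s r (Suc n) = iv A s r (Suc i)"
      using visible_O_det[OF ar l det fol n i(1) rs i(2) O] by simp
    then have "pv A s r (Suc n) = pv A s r (Suc i)"
      using iv_sync_pv[OF ar l l, of "Suc n" "Suc i" r] n i(1) by simp
    then have "z = ?o"
      using view_snoc_inj[OF lz lo', of Opponent] z(2) O pvz i(3) by simp
    then show ?thesis
      using pre' z(1) by simp
  qed
  then show ?thesis
    using y(1) ivs step by (intro exI[of _ y]) (simp add: replay_def)
qed

text \<open>Here the new thread takes over: Proponent's move is that of \<open>t'\<close>, not that
  of \<open>s\<close>. Its O-view occurs in the old thread, after some position \<open>i\<close>.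
  Since the move jumps to its justifier, the state after it is the one after \<open>i\<close>, and
  the replay resumes there, possibly far from \<open>n\<close>.\<close>

lemma replay_step_visible_P:
  assumes w: "replay w" and n: "n < length s" and eq: "iv A w r (length w) = iv A s r n"
    and v: "visP A s r n"
  shows "\<exists>x. replay (w @ [x]) \<and> length (th (w @ [x]) r) = Suc (length (th w r))"
proof -
  let ?N = "length w"
  have lw: "legal A w" and pre: "prefix (th w r) t'" using w by (auto simp: replay_def)
  have le: "n \<le> length s" "?N \<le> length w" using n by auto
  note eq' = eq[symmetric]
  have P: "owner A (move_at s n) = Proponent" "root s n = r" using v by (auto simp: visP_def)
  have "0 < n" using P_pos[OF ar l n P(1)] .
  then have "?N > 0"
    using iv_sync_0[OF ar l lw le eq'] by simp
  have rw: "root w (?N - 1) = r"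
    using iv_sync_last(2)[OF ar l lw le eq' \<open>0 < n\<close>] P_root[OF ar l n P(1)] P(2) by simp
  have "owner A (move_at s (n - 1)) = Opponent"
    using legal_alternates[OF l, of "n - 1"] n \<open>0 < n\<close> P(1) by simp
  then have Ow: "owner A (move_at w (?N - 1)) = Opponent"
    using iv_sync_last(1)[OF ar l lw le eq' \<open>0 < n\<close>] by simp
  let ?T = "tset w r" and ?k = "rk (tset w r) (?N - 1)"
  have lenth: "length (th w r) = Suc ?k"
    using rk_Suc[of ?T "?N - 1"] \<open>?N > 0\<close> rw by (simp add: length_sub tset_def)
  have lth: "legal A (th w r)" using legal_thread[OF ar lw] .
  have "move_at (th w r) ?k = move_at w (?N - 1)"
    using sub_nth[of "?N - 1" w ?T] \<open>?N > 0\<close> rw by (simp add: tset_def)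
  then have "even ?k"
    using legal_parity[OF ar lth, of ?k] lenth Ow by simp
  \<comment> \<open>The thread of \<open>w\<close> has odd length so far and \<open>t'\<close> has
    even length, so a next move exists.\<close>
  then have lt: "length (th w r) < length t'"
    using prefix_length_le[OF pre] lenth t'(2) by (cases "length t' = Suc ?k") auto
  let ?o = "t' ! length (th w r)"
  have pre': "prefix (th w r @ [?o]) t'"
    using prefix_nth[OF pre lt] .
  then have lo': "legal A (th w r @ [?o])"
    using legal_prefix[OF t'(1)] by blast
  have oP: "owner A (fst ?o) = Proponent"
  proof -
    have "move_at (th w r @ [?o]) (length (th w r)) = fst ?o"
      by simp
    moreover have "odd (length (th w r))"
      using lenth \<open>even ?k\<close> by simp
    ultimately show ?thesis
      using legal_parity[OF ar lo', of "length (th w r)"]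
      by (metis length_append_singleton lessI player_neq(1))
  qed
  have "view A Proponent w (length w) = view A Proponent (th w r) (length (th w r))"
    using pview_thread[OF ar lw, of "?N - 1" r] rw \<open>?N > 0\<close> lenth by simp
  from legal_extend[OF ar lw lo' oP this]
  obtain y where y: "legal A (w @ [y])" "fst y = fst ?o"
    "view A Proponent (w @ [y]) (Suc ?N) = view A Proponent (th w r @ [?o]) (Suc (length (th w r)))"
    by blast
  have bw: "backward (w @ [y])" using y(1) by (rule legal_backward)
  have Py: "owner A (move_at (w @ [y]) ?N) = Proponent" using y(2) oP by simp
  have ry: "root (w @ [y]) ?N = r"
    using P_root[OF ar y(1), of ?N] Py rw \<open>?N > 0\<close> by (simp add: root_append)
  obtain z where z: "th (w @ [y]) r = th w r @ [z]" "fst z = fst ?o"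
    using th_snoc[OF bw, of r] ry y(2) by auto
  have lz: "legal A (th w r @ [z])"
    using legal_thread[OF ar y(1), of r] z(1) by simp
  have "rk (tset (w @ [y]) r) ?N = length (th w r)"
    unfolding length_sub by (rule rk_cong) (auto simp: tset_def root_append)
  then have "view A Proponent (th w r @ [z]) (Suc (length (th w r))) = view A Proponent (w @ [y]) (Suc ?N)"
    using pview_thread[OF ar y(1), of ?N r] ry z(1) by simp
  then have "z = ?o"
    using view_snoc_inj[OF lz lo', of Proponent] z(2) oP y(3) by simp
  then have pr: "prefix (th (w @ [y]) r) t'"
    using pre' z(1) by simp
  have vy: "visP A (w @ [y]) r ?N" using Py ry by (simp add: visP_def)
  obtain j where j: "ptr (w @ [y]) ?N = Some j"
    using legal_P_ptr[OF ar y(1) _ Py] by auto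
  note oj = IV_jump[OF ar y(1) _ Py ry j]
  have jN: "j < ?N" using oj(2) by simp
  obtain n3 where n3: "n3 \<le> length s" "iv A (w @ [y]) r (Suc j) = iv A s r n3"
  proof -
    have "Suc j \<le> length w" using jN by simp
    then show ?thesis
      using w iv_append[OF bw, of "Suc j" A r] that unfolding replay_def by metis
  qed
  have lej: "Suc j \<le> length (w @ [y])" using jN by simp
  note sync = iv_sync_0[OF ar y(1) l lej n3] iv_sync_last(2)[OF ar y(1) l lej n3]
  obtain m3 where m3: "n3 = Suc m3" "root s m3 = r"
    using sync oj(4) by (cases n3) auto
  have ivy: "iv A (w @ [y]) r (Suc ?N) = iv A s r n3 @ [(fst y, Some (length (iv A s r n3) - 1))]"
    using iv_jump[OF ar y(1) _ vy j] n3(2) by simp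
  obtain k where k: "pv A (w @ [y]) r (Suc ?N) = pv A s r n3 @ [(fst y, k)]"
    using pv_visP[OF ar y(1) _ vy j] iv_sync_pv[OF ar y(1) l lej n3] by auto
  have pvv: "pv A (w @ [y]) r (Suc ?N) = view A Opponent (th w r @ [?o]) (Suc (length (th w r)))"
    using oview_th[OF y(1)] z(1) \<open>z = ?o\<close> by simp
  have "pv A (w @ [y]) r (Suc ?N) \<in> ovw A t'"
    unfolding pvv ovw_def using pre' by (auto simp: oview_view intro!: exI[of _ "th w r @ [?o]"])
  then have mem: "pv A (w @ [y]) r (Suc ?N) \<in> ovw A (th s r)"
    unfolding ovw .
  have ne: "pv A (w @ [y]) r (Suc ?N) \<noteq> []" and last: "fst (last (pv A (w @ [y]) r (Suc ?N))) = fst y"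
    unfolding k by simp_all
  obtain i where i: "i < length s" "root s i = r" "pv A (w @ [y]) r (Suc ?N) = pv A s r (Suc i)"
    "fst y = move_at s i"
    using ovw_threadD[OF ar l mem ne] last by metis
  have Pi: "owner A (move_at s i) = Proponent" using i(4) y(2) oP by simp
  then have vi: "visP A s r i" using i(2) by (simp add: visP_def)
  obtain j2 where j2: "ptr s i = Some j2"
    using legal_P_ptr[OF ar l i(1) Pi] .
  note oj2 = IV_jump[OF ar l i(1) Pi i(2) j2]
  have "pv A s r (Suc j2) = pv A s r (Suc m3)"
    using pv_visP[OF ar l i(1) vi j2] k i(3) m3(1) by auto
  \<comment> \<open>Both justifiers are moves of the thread with the same thread view, so the states
    ending in them coincide; the two P-moves extend these states in the same way.\<close>
  then have "iv A s r (Suc j2) = iv A s r (Suc m3)"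
    using iv_last_visible[OF ar l det fol, of j2 m3] oj2 i(1) m3 n3(1) by simp
  then have ivi: "iv A (w @ [y]) r (Suc ?N) = iv A s r (Suc i)"
    using ivy iv_jump[OF ar l i(1) vi j2] i(4) m3(1) by simp
  have ivs: "\<forall>m\<le>length (w @ [y]). \<exists>n\<le>length s. iv A (w @ [y]) r m = iv A s r n"
  proof (intro allI impI)
    fix m assume "m \<le> length (w @ [y])"
    then consider "m \<le> ?N" | "m = Suc ?N" by fastforce
    then show "\<exists>n\<le>length s. iv A (w @ [y]) r m = iv A s r n"
    proof cases
      case 1
      then show ?thesis using w iv_append[OF bw, of m A r] by (simp add: replay_def)
    next
      case 2
      then show ?thesis using ivi i(1) by (intro exI[of _ "Suc i"]) simp
    qed
  qed
  show ?thesis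
    using y(1) ivs pr z(1) by (intro exI[of _ y]) (simp add: replay_def)
qed

lemma replay_Nil: "replay []"
  by (auto simp: replay_def)

text \<open>Each step either consumes a move of \<open>t'\<close> or, being hidden, lengthens the
  state, whose length is bounded by that of \<open>s\<close>. Consuming a move may shorten the state
  by up to \<open>length s\<close>, hence the weight \<open>Suc (length s)\<close>.\<close>

lemma replay_extend:
  "replay w \<Longrightarrow> \<exists>w'. replay w' \<and> iv A w' r (length w') = iv A s r (length s)"
proof (induction "(length t' - length (th w r)) * Suc (length s) + (length s - length (iv A w r (length w)))"
    arbitrary: w rule: less_induct)
  case less
  let ?M = "\<lambda>w. (length t' - length (th w r)) * Suc (length s) + (length s - length (iv A w r (length w)))"
  have pre: "prefix (th w r) t'" using less.prems by (simp add: replay_def)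
  obtain n where n: "n \<le> length s" "iv A w r (length w) = iv A s r n"
    using less.prems unfolding replay_def by blast
  have grow: "?M (w @ [x]) < ?M w" if x: "replay (w @ [x])" "length (th (w @ [x]) r) = Suc (length (th w r))" for x
  proof -
    have "length (th (w @ [x]) r) \<le> length t'"
      using x(1) prefix_length_le by (auto simp: replay_def)
    then obtain d where "length t' - length (th w r) = Suc d" "length t' - length (th (w @ [x]) r) = d"
      using x(2) by (metis Suc_diff_le diff_Suc_Suc)
    then show ?thesis by simp
  qed
  show ?case
  proof (cases "n = length s")
    case True
    then show ?thesis using n less.prems by blast
  next
    case False
    then have len: "n < length s" using n by simp
    have "\<exists>x. replay (w @ [x]) \<and> ?M (w @ [x]) < ?M w"
    proof (cases "visP A s r n")
      case True
      then show ?thesis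
        using replay_step_visible_P[OF less.prems len n(2)] grow by blast
    next
      case False
      obtain x where x: "replay (w @ [x])" "iv A (w @ [x]) r (Suc (length w)) = iv A s r (Suc n)"
        using replay_step_hidden_or_O[OF less.prems len n(2) False] by blast
      show ?thesis
      proof (cases "root (w @ [x]) (length w) = r")
        case True
        have "backward (w @ [x])" using x(1) legal_backward by (auto simp: replay_def)
        then have "length (th (w @ [x]) r) = Suc (length (th w r))"
          using th_snoc[of w x r] True by auto
        then show ?thesis using x(1) grow by blast
      next
        case r: False
        have "backward (w @ [x])" using x(1) legal_backward by (auto simp: replay_def)
        then have "th (w @ [x]) r = th w r"
          using th_snoc[of w x r] r by auto
        moreover have "length (iv A s r (Suc n)) = Suc (length (iv A s r n))" "length (iv A s r (Suc n)) \<le> length s"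
          using iv_step[OF ar l len False] length_iv_le[OF ar l, of "Suc n" r] len by auto
        ultimately show ?thesis
          using x n by (intro exI[of _ x]) simp
      qed
    qed
    then show ?thesis using less.hyps by blast
  qed
qed

text \<open>Obedience to the three view sets can be judged from the state after a move, and every
  state of \<open>w\<close> occurs in \<open>s\<close>.\<close>

lemma replay_follows:
  assumes "replay w"
  shows "follows A r OB VE VH w"
  unfolding follows_def
proof (intro allI impI)
  fix m assume m: "m < length w"
  have lw: "legal A w" using assms by (simp add: replay_def)
  have le: "Suc m \<le> length w" using m by simp
  obtain n where n: "n \<le> length s" "iv A w r (Suc m) = iv A s r n"
    using assms le unfolding replay_def by blast
  then obtain k where k: "n = Suc k"
    using iv_sync_0[OF ar lw l le n] by (cases n) auto
  note sync = iv_sync_last[OF ar lw l le n] k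
  have view: "view A Opponent w (Suc m) = view A Opponent s (Suc k)"
    "root w m \<noteq> r \<Longrightarrow> view A Proponent w (Suc m) = view A Proponent s (Suc k)"
    using iv_sync_oview[OF ar lw l le n] iv_sync_pview[OF ar lw l le n] k by auto
  have rt: "move_at w m = move_at s k" "root w m = r \<longleftrightarrow> root s k = r" "root w m < r \<longleftrightarrow> root s k < r"
    using sync by auto
  have f: "(owner A (move_at s k) = Opponent \<longrightarrow> view A Opponent s (Suc k) \<in> OB) \<and>
     (owner A (move_at s k) = Proponent \<and> root s k < r \<longrightarrow> view A Proponent s (Suc k) \<in> VE) \<and>
     (owner A (move_at s k) = Proponent \<and> r < root s k \<longrightarrow> view A Proponent s (Suc k) \<in> VH)"
    using fol n(1) k by (simp add: follows_def)
  show "(owner A (move_at w m) = Opponent \<longrightarrow> view A Opponent w (Suc m) \<in> OB) \<and>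
     (owner A (move_at w m) = Proponent \<and> root w m < r \<longrightarrow> view A Proponent w (Suc m) \<in> VE) \<and>
     (owner A (move_at w m) = Proponent \<and> r < root w m \<longrightarrow> view A Proponent w (Suc m) \<in> VH)"
  proof (intro conjI impI)
    assume "owner A (move_at w m) = Opponent"
    then show "view A Opponent w (Suc m) \<in> OB" using f view rt by simp
  next
    assume "owner A (move_at w m) = Proponent \<and> root w m < r"
    then show "view A Proponent w (Suc m) \<in> VE" using f view rt by simp
  next
    assume "owner A (move_at w m) = Proponent \<and> r < root w m"
    moreover from this have "r < root s k" using rt by (metis linorder_neqE_nat less_not_refl less_asym)
    ultimately show "view A Proponent w (Suc m) \<in> VH" using f view rt by simp
  qed
qed

text \<open>The final O-view is kept because the test gives its answer on it. The new thread may
  stop inside \<open>t'\<close>; prefix closure of the strategy takes care of that.\<close>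

lemma replace_thread:
  obtains w where "legal A w" "follows A r OB VE VH w" "prefix (th w r) t'"
    "view A Opponent w (length w) = view A Opponent s (length s)"
proof -
  obtain w where w: "replay w" "iv A w r (length w) = iv A s r (length s)"
    using replay_extend[OF replay_Nil] by blast
  show ?thesis
  proof (rule that)
    show lw: "legal A w" using w(1) by (simp add: replay_def)
    show "prefix (th w r) t'" using w(1) by (simp add: replay_def)
    show "follows A r OB VE VH w" by (rule replay_follows[OF w(1)])
    show "view A Opponent w (length w) = view A Opponent s (length s)"
      by (rule iv_sync_oview[OF ar lw l _ _ w(2)]) simp_all
  qed
qed

end

section \<open>Strategies given by views\<close>

text \<open>What the general facts on strategies use; \<open>A\<close> and its game of tests both
  provide it.\<close>

definition pregame :: "'m game \<Rightarrow> bool" where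
  "pregame G \<longleftrightarrow> arena G \<and> plays G \<subseteq> Collect (legal G) \<and>
     (\<forall>s t. t \<in> plays G \<and> prefix s t \<longrightarrow> s \<in> plays G)"

lemma game_pregame: "game A \<Longrightarrow> pregame A"
  unfolding game_def pregame_def by blast

text \<open>The view function of an innocent strategy as a set: P-views that include the P-move
  played.\<close>

definition VP :: "'m game \<Rightarrow> 'm jseq set \<Rightarrow> 'm jseq set" where
  "VP G \<sigma> = {view G Proponent h (length h) |h. h \<in> \<sigma> \<and> h \<noteq> []}"

lemma view_snoc2:
  assumes "arena G" "legal G (g @ [a, b])" "even (length g)"
  shows "\<exists>y. view G Proponent (g @ [a, b]) (Suc (Suc (length g))) =
      view G Proponent (g @ [a]) (Suc (length g)) @ [y]"
    and "owner G (fst b) = Proponent" and "legal G (g @ [a])"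
proof -
  have eq: "g @ [a, b] = (g @ [a]) @ [b]" by simp
  show "owner G (fst b) = Proponent"
    using legal_parity[OF assms(1,2), of "Suc (length g)"] assms(3) by (cases "owner G (fst b)") (auto simp: nth_append)
  then show "\<exists>y. view G Proponent (g @ [a, b]) (Suc (Suc (length g))) =
      view G Proponent (g @ [a]) (Suc (length g)) @ [y]"
    using view_snoc[OF assms(2)[unfolded eq], of Proponent] by auto
  show "legal G (g @ [a])"
    using legal_prefix[OF assms(2)] eq by (metis prefixI)
qed

lemma even_decomp:
  assumes "even (length h)" "h \<noteq> []"
  obtains g a b where "h = g @ [a, b]" "even (length g)"
proof -
  obtain h' b where h: "h = h' @ [b]" using assms(2) by (metis rev_exhaust)
  then have "h' \<noteq> []" using assms(1) by auto
  then obtain g a where "h' = g @ [a]" by (metis rev_exhaust)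
  then show ?thesis using that[of g a b] h assms(1) by simp
qed

context
  fixes G :: "'m game" and \<sigma> :: "'m jseq set"
  assumes G: "pregame G" and st: "innocent_strategy G \<sigma>"
begin

lemma strategy_play: "h \<in> \<sigma> \<Longrightarrow> h \<in> plays G" "h \<in> \<sigma> \<Longrightarrow> even (length h)" "h \<in> \<sigma> \<Longrightarrow> legal G h"
  using st G unfolding innocent_strategy_def strategy_def pregame_def by auto

lemma strategy_prefix: "h \<in> \<sigma> \<Longrightarrow> prefix g h \<Longrightarrow> even (length g) \<Longrightarrow> g \<in> \<sigma>"
  using st unfolding innocent_strategy_def strategy_def by blast

lemma strategy_Nil: "[] \<in> \<sigma>"
  using st unfolding innocent_strategy_def strategy_def
  by (metis Nil_prefix all_not_in_conv even_zero list.size(3))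

lemma strategy_det: "g @ [a, b] \<in> \<sigma> \<Longrightarrow> g @ [a, c] \<in> \<sigma> \<Longrightarrow> b = c"
  using st unfolding innocent_strategy_def strategy_def by blast

lemma strategy_innocent:
  assumes "g @ [a, b] \<in> \<sigma>" "g' \<in> \<sigma>" "g' @ [a'] \<in> plays G"
    "view G Proponent (g' @ [a']) (Suc (length g')) = view G Proponent (g @ [a]) (Suc (length g))"
  obtains b' where "g' @ [a', b'] \<in> \<sigma>"
    "view G Proponent (g' @ [a', b']) (Suc (Suc (length g'))) = view G Proponent (g @ [a, b]) (Suc (Suc (length g)))"
proof -
  have "innocent G \<sigma>" using st by (simp add: innocent_strategy_def)
  then have "\<exists>b'. g' @ [a', b'] \<in> \<sigma> \<and> pview G (g' @ [a', b']) = pview G (g @ [a, b])"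
    using innocent_def[THEN iffD1, rule_format, of G \<sigma> g a b g' a'] assms by (simp add: pview_view)
  then show ?thesis using that by (auto simp: pview_view)
qed

lemma strategy_decomp:
  assumes "h \<in> \<sigma>" "h \<noteq> []"
  obtains g a b where "h = g @ [a, b]" "even (length g)" "g \<in> \<sigma>" "legal G (g @ [a, b])" "g @ [a] \<in> plays G"
proof -
  obtain g a b where h: "h = g @ [a, b]" "even (length g)"
    using even_decomp[OF strategy_play(2)[OF assms(1)] assms(2)] .
  have "g @ [a] \<in> plays G"
    using strategy_play(1)[OF assms(1)] G unfolding pregame_def h(1)
    by (metis append.assoc append_Cons append_Nil prefixI)
  then show ?thesis
    using that[OF h] strategy_prefix[OF assms(1), of g] strategy_play(3)[OF assms(1)] h by simp
qed

text \<open>Equal views before the last move let innocence carry the reply of one play over to the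
  other, where determinism identifies it with the reply given there.\<close>

lemma det_VP: "det_views (VP G \<sigma>)"
  unfolding det_views_def
proof (intro allI impI, elim conjE)
  fix v x y assume "v @ [x] \<in> VP G \<sigma>" "v @ [y] \<in> VP G \<sigma>"
  then obtain h h' where h: "h \<in> \<sigma>" "h \<noteq> []" "v @ [x] = view G Proponent h (length h)"
    and h': "h' \<in> \<sigma>" "h' \<noteq> []" "v @ [y] = view G Proponent h' (length h')"
    by (auto simp: VP_def)
  obtain g a b where g: "h = g @ [a, b]" "even (length g)" "legal G (g @ [a, b])"
    using strategy_decomp[OF h(1,2)] by metis
  obtain g' a' b' where g': "h' = g' @ [a', b']" "even (length g')" "g' \<in> \<sigma>"
      "legal G (g' @ [a', b'])" "g' @ [a'] \<in> plays G"
    using strategy_decomp[OF h'(1,2)] by metis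
  have ar: "arena G" using G by (simp add: pregame_def)
  have "view G Proponent (g' @ [a']) (Suc (length g')) = view G Proponent (g @ [a]) (Suc (length g))"
    using view_snoc2(1)[OF ar g(3,2)] view_snoc2(1)[OF ar g'(4,2)] h(3) h'(3) g(1) g'(1) by auto
  then obtain c where c: "g' @ [a', c] \<in> \<sigma>"
    "view G Proponent (g' @ [a', c]) (Suc (Suc (length g'))) = v @ [x]"
    using strategy_innocent[of g a b g' a'] h g g' by auto
  have "c = b'"
    using strategy_det[of g' a' c b'] c(1) h'(1) g'(1) by simp
  then show "x = y"
    using c(2) h'(3) g'(1) by simp
qed

lemma VP_I: "h \<in> \<sigma> \<Longrightarrow> n < length h \<Longrightarrow> odd n \<Longrightarrow> view G Proponent h (Suc n) \<in> VP G \<sigma>"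
proof -
  assume h: "h \<in> \<sigma>" "n < length h" "odd n"
  have "take (Suc n) h \<in> \<sigma>"
    using strategy_prefix[OF h(1) take_is_prefix, of "Suc n"] h by simp
  moreover have "view G Proponent (take (Suc n) h) (Suc n) = view G Proponent h (Suc n)"
    using view_take[OF legal_backward[OF strategy_play(3)[OF h(1)]], of "Suc n" "Suc n"] h by simp
  ultimately show ?thesis
    unfolding VP_def using h by (intro CollectI exI[of _ "take (Suc n) h"]) auto
qed

text \<open>By induction the play without its last two moves belongs to \<sigma>. Innocence then
  yields a reply with the prescribed view, and \<open>view_snoc_inj\<close> identifies it with the
  given move.\<close>

lemma mem_by_views:
  "h \<in> plays G \<Longrightarrow> even (length h) \<Longrightarrow>
   (\<forall>n<length h. odd n \<longrightarrow> view G Proponent h (Suc n) \<in> VP G \<sigma>) \<Longrightarrow> h \<in> \<sigma>"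
proof (induction "length h" arbitrary: h rule: less_induct)
  case less
  show ?case
  proof (cases "h = []")
    case True
    then show ?thesis using strategy_Nil by simp
  next
    case False
    obtain g a b where g: "h = g @ [a, b]" "even (length g)"
      using even_decomp[OF less.prems(2) False] .
    have ar: "arena G" and lh: "legal G (g @ [a, b])"
      using G less.prems(1) g by (auto simp: pregame_def)
    have pl: "g \<in> plays G" "g @ [a] \<in> plays G"
      using less.prems(1) G unfolding pregame_def g(1) by (metis prefixI, metis append.assoc append_Cons append_Nil prefixI)
    have "g \<in> \<sigma>"
    proof (rule less.hyps)
      show "\<forall>n<length g. odd n \<longrightarrow> view G Proponent g (Suc n) \<in> VP G \<sigma>"
      proof (intro allI impI)
        fix n assume n: "n < length g" "odd n"
        then have "view G Proponent h (Suc n) \<in> VP G \<sigma>"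
          using less.prems(3) g by simp
        then show "view G Proponent g (Suc n) \<in> VP G \<sigma>"
          using view_append[OF legal_backward[OF lh], of "Suc n" G Proponent] n g(1) by simp
      qed
    qed (use pl g in auto)
    have "view G Proponent h (length h) \<in> VP G \<sigma>"
      using less.prems(3)[rule_format, of "Suc (length g)"] g by simp
    then obtain h' where h': "h' \<in> \<sigma>" "h' \<noteq> []" "view G Proponent h (length h) = view G Proponent h' (length h')"
      by (auto simp: VP_def)
    obtain g' a' b' where g': "h' = g' @ [a', b']" "even (length g')" "legal G (g' @ [a', b'])"
      using strategy_decomp[OF h'(1,2)] by metis
    have "view G Proponent (g @ [a]) (Suc (length g)) = view G Proponent (g' @ [a']) (Suc (length g'))"
      using view_snoc2(1)[OF ar lh g(2)] view_snoc2(1)[OF ar g'(3,2)] h'(3) g g' by auto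
    then obtain c where c: "g @ [a, c] \<in> \<sigma>"
      "view G Proponent (g @ [a, c]) (Suc (Suc (length g))) = view G Proponent (g @ [a, b]) (Suc (Suc (length g)))"
      using strategy_innocent[of g' a' b' g a] \<open>g \<in> \<sigma>\<close> pl(2) h' g' g(1) by auto
    have lc: "legal G (g @ [a, c])" using strategy_play(3)[OF c(1)] .
    have e: "g @ [a, c] = (g @ [a]) @ [c]" "g @ [a, b] = (g @ [a]) @ [b]" by simp_all
    have "c = b"
      using view_snoc_inj[OF lc[unfolded e] lh[unfolded e], of Proponent] view_snoc2(2)[OF ar lc g(2)] c(2)
      by simp
    then show ?thesis using c(1) g(1) by simp
  qed
qed

end

section \<open>Threads in a game\<close>

lemma th_ptr_None:
  assumes b: "backward s" and k: "k < length (th s r)" "ptr (th s r) k = None"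
  shows "k = 0"
proof -
  obtain i where i: "i < length s" "i \<in> tset s r" "rk (tset s r) i = k"
    using k(1) rk_ex by (metis length_sub)
  then have "ptr_map (tset s r) (ptr s i) = None"
    using sub_nth[OF i(1,2)] k(2) by simp
  then have "ptr s i = None"
    using tset_ptr[OF b i(1), of _ r] i(2) by (cases "ptr s i") auto
  then have "i = r"
    using i(2) by (simp add: tset_def root_None)
  moreover have "m \<notin> tset s r" if "m < r" for m
    using root_le[of s m] that by (auto simp: tset_def)
  then have "tset s r \<inter> {..<r} = {}" by blast
  ultimately show ?thesis
    using i(3) by (simp add: rk_def)
qed

text \<open>A game can only restrict the opening of further threads. A sequence with one initial
  move arises from an opening that every game admits by extensions that no game forbids.\<close>

lemma single_play:
  assumes A: "game A"
  shows "legal A h \<Longrightarrow> (\<And>k. k < length h \<Longrightarrow> ptr h k = None \<Longrightarrow> k = 0) \<Longrightarrow> h \<in> plays A"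
proof (induction h rule: rev_induct)
  case Nil
  then show ?case using A by (simp add: game_def)
next
  case (snoc x h)
  have "ptr h k = None \<Longrightarrow> k = 0" if "k < length h" for k
    using snoc.prems(2)[of k] that by (simp add: nth_append)
  then have h: "h \<in> plays A"
    using snoc.IH snoc.prems(1) by (simp add: legal_snoc)
  show ?case
  proof (cases "snd x")
    case None
    then have "h = []"
      using snoc.prems(2)[of "length h"] by simp
    moreover have "enables A None (fst x)"
      using legal_initial[OF snoc.prems(1), of "length h"] None by simp
    ultimately show ?thesis
      using A None unfolding game_def by (metis append_Nil prod.collapse)
  next
    case (Some j)
    then show ?thesis
      using A h snoc.prems(1) unfolding game_def by (metis prod.collapse)
  qed
qed

text \<open>Each thread of a legal sequence is legal and has only one initial move, so it is a play
  by \<open>single_play\<close>.\<close>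

lemma bang_plays_legal: "game A \<Longrightarrow> bang_plays A = Collect (legal A)"
proof -
  assume A: "game A"
  have ar: "arena A" using A by (simp add: game_def)
  have "threads s \<subseteq> plays A" if l: "legal A s" for s
  proof
    fix h assume "h \<in> threads s"
    then obtain i where i: "i < length s" "ptr s i = None" "h = th s i"
      using sub_thread[OF legal_backward[OF l]] by (auto simp: threads_def)
    show "h \<in> plays A"
      unfolding i(3)
      by (rule single_play[OF A legal_thread[OF ar l]]) (rule th_ptr_None[OF legal_backward[OF l]])
  qed
  then show ?thesis
    by (auto simp: bang_plays_def)
qed

lemma promote_iff:
  assumes "game A"
  shows "s \<in> promote A \<sigma> \<longleftrightarrow> legal A s \<and> (\<forall>i<length s. ptr s i = None \<longrightarrow> th s i \<in> \<sigma>)"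
proof (cases "legal A s")
  case True
  then have "threads s = {th s i |i. i < length s \<and> ptr s i = None}"
    unfolding threads_def using sub_thread[OF legal_backward[OF True]] by metis
  then show ?thesis
    using True assms by (auto simp: promote_def bang_plays_legal)
qed (use assms in \<open>simp add: promote_def bang_plays_legal\<close>)

text \<open>Proponent replies to an O-move in the same thread, so no thread of an even sequence ends
  in an O-move.\<close>

lemma even_thread:
  assumes ar: "arena A" and l: "legal A s" and ev: "even (length s)"
  shows "even (length (th s r))"
proof (cases "length (th s r)")
  case (Suc k)
  then have k: "k < length (th s r)" by simp
  obtain i where i: "i < length s" "root s i = r" "rk (tset s r) i = k" "rk (tset s r) (Suc i) = Suc k"
    "move_at (th s r) k = move_at s i"
    using thread_position[OF k] by metis
  have "owner A (move_at s i) \<noteq> Opponent"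
  proof
    assume O: "owner A (move_at s i) = Opponent"
    then have "Suc i < length s"
      using legal_parity[OF ar l i(1)] i(1) ev by (metis Suc_lessI even_Suc)
    moreover from this have "owner A (move_at s (Suc i)) = Proponent"
      using legal_alternates[OF l, of i] O by (metis player_neq(1))
    ultimately have "Suc i \<in> tset s r"
      using P_root[OF ar l, of "Suc i"] i(2) by (simp add: tset_def)
    then have "Suc k < length (th s r)"
      using rk_less[of "Suc i" "length s" "tset s r"] \<open>Suc i < length s\<close> i(4) by (simp add: length_sub)
    then show False using Suc by simp
  qed
  then show ?thesis
    using legal_parity[OF ar legal_thread[OF ar l] k] i(5) Suc by simp
qed simp

lemma thread_views:
  assumes A: "game A" and st: "innocent_strategy A \<sigma>" and l: "legal A s" and th: "th s r \<in> \<sigma>"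
    and n: "n < length s" "root s n = r" "owner A (move_at s n) = Proponent"
  shows "view A Proponent s (Suc n) \<in> VP A \<sigma>"
proof -
  have ar: "arena A" using A by (simp add: game_def)
  have k: "rk (tset s r) n < length (th s r)"
    using n by (simp add: length_sub rk_less tset_def)
  have "move_at (th s r) (rk (tset s r) n) = move_at s n"
    using sub_nth[of n s "tset s r"] n by (simp add: tset_def)
  then have "odd (rk (tset s r) n)"
    using legal_parity[OF ar legal_thread[OF ar l] k] n(3) by simp
  then show ?thesis
    using VP_I[OF game_pregame[OF A] st th k] pview_thread[OF ar l n(1,2)] by simp
qed

lemma thread_by_views:
  assumes A: "game A" and st: "innocent_strategy A \<sigma>" and l: "legal A s" and ev: "even (length s)"
    and v: "\<And>n. n < length s \<Longrightarrow> root s n = r \<Longrightarrow> owner A (move_at s n) = Proponent \<Longrightarrow>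
      view A Proponent s (Suc n) \<in> VP A \<sigma>"
  shows "th s r \<in> \<sigma>"
proof (rule mem_by_views[OF game_pregame[OF A] st])
  have ar: "arena A" using A by (simp add: game_def)
  have lt: "legal A (th s r)" by (rule legal_thread[OF ar l])
  show "th s r \<in> plays A"
    by (rule single_play[OF A lt]) (rule th_ptr_None[OF legal_backward[OF l]])
  show "even (length (th s r))" by (rule even_thread[OF ar l ev])
  show "\<forall>n<length (th s r). odd n \<longrightarrow> view A Proponent (th s r) (Suc n) \<in> VP A \<sigma>"
  proof (intro allI impI)
    fix k assume k: "k < length (th s r)" "odd k"
    obtain i where i: "i < length s" "root s i = r" "rk (tset s r) i = k" "move_at (th s r) k = move_at s i"
      using thread_position[OF k(1)] by metis
    have "owner A (move_at s i) \<noteq> Opponent"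
      using legal_parity[OF ar lt k(1)] k(2) i(4) by simp
    then show "view A Proponent (th s r) (Suc k) \<in> VP A \<sigma>"
      using v[OF i(1,2)] pview_thread[OF ar l i(1,2)] i(3) by simp
  qed
qed

text \<open>At odd length the thread of the last move would end in an O-move, although threads in
  \<sigma> have even length.\<close>

lemma promote_even:
  assumes A: "game A" and st: "innocent_strategy A \<sigma>" and s: "s \<in> promote A \<sigma>"
  shows "even (length s)"
proof (rule ccontr)
  assume odd: "odd (length s)"
  have ar: "arena A" using A by (simp add: game_def)
  have l: "legal A s" using s by (simp add: promote_iff[OF A])
  define n where "n = length s - 1"
  have n: "length s = Suc n" "even n" using odd by (auto simp: n_def)
  define r where "r = root s n"
  have "ptr s r = None" "r < length s"
    using ptr_root[OF legal_backward[OF l], of n] root_le[of s n] n by (auto simp: r_def)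
  then have "th s r \<in> \<sigma>" using s by (simp add: promote_iff[OF A])
  then have ev: "even (length (th s r))" by (rule strategy_play(2)[OF game_pregame[OF A] st])
  have nT: "n \<in> tset s r" by (simp add: tset_def r_def)
  have len: "length (th s r) = Suc (rk (tset s r) n)"
    unfolding length_sub n(1) rk_Suc using nT by simp
  have "move_at (th s r) (rk (tset s r) n) = move_at s n"
    using sub_nth[of n s "tset s r"] nT n(1) by simp
  moreover have "owner A (move_at s n) = Opponent"
    using legal_parity[OF ar l, of n] n by simp
  ultimately have "even (rk (tset s r) n)"
    using legal_parity[OF ar legal_thread[OF ar l], of "rk (tset s r) n" r] len by simp
  then show False using ev len by simp
qed

lemma complete_thread:
  assumes l: "legal A s" and c: "complete A s"
  shows "complete A (th s r)"
  unfolding complete_def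
proof
  let ?T = "tset s r"
  assume "\<exists>k. open_question A (th s r) k"
  then obtain k where k: "open_question A (th s r) k" by blast
  then have "k < length (th s r)" by (simp add: open_question_def)
  then obtain i where i: "i < length s" "i \<in> ?T" "rk ?T i = k"
    using rk_ex by (metis length_sub)
  have "kind_of A (move_at s i) = Question"
    using k sub_nth[OF i(1,2)] i(3) by (simp add: open_question_def)
  then obtain m where m: "m < length s" "kind_of A (move_at s m) = Answer" "ptr s m = Some i"
    using c i(1) unfolding complete_def open_question_def by blast
  have mT: "m \<in> ?T"
    using tset_ptr[OF legal_backward[OF l] m(1,3), of r] i(2) by simp
  have "rk ?T m < length (th s r)"
    using m(1) mT by (simp add: length_sub rk_less)
  moreover have "th s r ! rk ?T m = (move_at s m, Some k)"
    using sub_nth[OF m(1) mT] m(3) i by simp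
  ultimately show False
    using k m(2) unfolding open_question_def by (metis fst_conv snd_conv)
qed

lemma single_threaded_iff:
  assumes ar: "arena A" and l: "legal A s"
  shows "single_threaded A s \<longleftrightarrow> s \<noteq> [] \<and> (\<forall>k<length s. ptr s k = None \<longrightarrow> k = 0)"
proof -
  have eq: "{i. i < length s \<and> enables A None (move_at s i)} = {i. i < length s \<and> ptr s i = None}"
    using legal_initial_iff[OF ar l] by blast
  have 0: "ptr s 0 = None" if "s \<noteq> []"
    using backD[OF legal_backward[OF l], of 0] that by (cases "ptr s 0") auto
  show ?thesis
  proof
    assume "single_threaded A s"
    then obtain i where i: "{i. i < length s \<and> ptr s i = None} = {i}"
      unfolding single_threaded_def eq by (auto simp: card_1_singleton_iff)
    have mem: "(k < length s \<and> ptr s k = None) \<longleftrightarrow> k = i" for k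
      using eqset_imp_iff[OF i, of k] by simp
    then have "s \<noteq> []" using mem[of i] by (metis list.size(3) not_less0)
    then have "i = 0" using 0 mem[of 0] by simp
    then show "s \<noteq> [] \<and> (\<forall>k<length s. ptr s k = None \<longrightarrow> k = 0)"
      using mem \<open>s \<noteq> []\<close> by blast
  next
    assume s: "s \<noteq> [] \<and> (\<forall>k<length s. ptr s k = None \<longrightarrow> k = 0)"
    have mem: "(k < length s \<and> ptr s k = None) \<longleftrightarrow> k = 0" for k
    proof
      assume "k = 0"
      then show "k < length s \<and> ptr s k = None" using s 0 by simp
    qed (use s in blast)
    have "{i. i < length s \<and> ptr s i = None} = {0}"
      unfolding mem by simp
    then show "single_threaded A s"
      unfolding single_threaded_def eq by simp
  qed
qed

lemma th_single:
  assumes "backward s" "\<And>k. k < length s \<Longrightarrow> ptr s k = None \<Longrightarrow> k = 0"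
  shows "th s 0 = s"
proof (rule sub_full[OF assms(1)])
  show "{..<length s} \<subseteq> tset s 0"
  proof
    fix k assume "k \<in> {..<length s}"
    then have "root s k < length s" "ptr s (root s k) = None"
      using ptr_root[OF assms(1), of k] root_le[of s k] by auto
    then show "k \<in> tset s 0" using assms(2) by (simp add: tset_def)
  qed
qed

lemma single_promote:
  assumes A: "game A" and l: "legal A s" and st: "single_threaded A s"
  shows "s \<in> promote A \<sigma> \<longleftrightarrow> s \<in> \<sigma>"
proof -
  have ar: "arena A" using A by (simp add: game_def)
  have s: "s \<noteq> []" "\<And>k. k < length s \<Longrightarrow> ptr s k = None \<Longrightarrow> k = 0"
    using st by (auto simp: single_threaded_iff[OF ar l])
  have "ptr s 0 = None"
    using backD[OF legal_backward[OF l], of 0] s(1) by (cases "ptr s 0") auto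
  then show ?thesis
    using th_single[OF legal_backward[OF l] s(2)] s l unfolding promote_iff[OF A]
    by (metis length_greater_0_conv)
qed

section \<open>Plays against a test\<close>

abbreviation tests :: "'m game \<Rightarrow> ('m + sigma_move) game" where
  "tests A \<equiv> fun_game A Sigma_game"

lemma tests_simps [simp]:
  "owner (tests A) (Inl m) = opposite (owner A m)"
  "owner (tests A) (Inr Sigma_q) = Opponent"
  "owner (tests A) (Inr Sigma_a) = Proponent"
  "kind_of (tests A) (Inl m) = kind_of A m"
  "kind_of (tests A) (Inr Sigma_q) = Question"
  "kind_of (tests A) (Inr Sigma_a) = Answer"
  by (simp_all add: fun_game_def with_plays_def fun_arena_def Sigma_game_def)

lemma tests_enables [simp]:
  "enables (tests A) None (Inl m) = False"
  "enables (tests A) None (Inr c) \<longleftrightarrow> c = Sigma_q"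
  "enables (tests A) (Some (Inl m)) (Inl n) = enables A (Some m) n"
  "enables (tests A) (Some (Inl m)) (Inr c) = False"
  "enables (tests A) (Some (Inr c)) (Inl m) \<longleftrightarrow> c = Sigma_q \<and> enables A None m"
  "enables (tests A) (Some (Inr c)) (Inr d) \<longleftrightarrow> c = Sigma_q \<and> d = Sigma_a"
  by (auto simp: fun_game_def with_plays_def fun_arena_def Sigma_game_def)

lemma opposite_eq [simp]:
  "opposite p = opposite q \<longleftrightarrow> p = q"
  "opposite p = Opponent \<longleftrightarrow> p = Proponent" "opposite p = Proponent \<longleftrightarrow> p = Opponent"
  by (cases p; cases q; simp)+

lemma opposite_opposite [simp]: "opposite (opposite p) = p"
  by (cases p) simp_all

lemma moves_tests: "moves (tests A) = moves A <+> UNIV"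
  by (simp add: fun_game_def with_plays_def fun_arena_def Sigma_game_def)

lemma arena_tests:
  assumes "arena A"
  shows "arena (tests A)"
proof -
  have 1: "enables A x m \<Longrightarrow> m \<in> moves A" "enables A (Some n) m \<Longrightarrow> n \<in> moves A"
    "enables A (Some n) m \<Longrightarrow> owner A n \<noteq> owner A m"
    "enables A (Some n) m \<Longrightarrow> kind_of A m = Answer \<Longrightarrow> kind_of A n = Question"
    "enables A None m \<Longrightarrow> owner A m = Opponent \<and> kind_of A m = Question" for x m n
    using assms unfolding arena_def by fastforce+
  show ?thesis
    unfolding arena_def moves_tests
  proof (intro conjI allI impI)
    fix x m assume e: "enables (tests A) x m"
    show "m \<in> moves A <+> UNIV"
      using e 1(1) by (cases x; cases m; (cases "the x")?) auto
    show "set_option x \<subseteq> moves A <+> UNIV"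
      using e 1(2) by (cases x; cases m; (cases "the x")?) auto
  next
    fix m assume e: "enables (tests A) None m"
    then have m: "m = Inr Sigma_q" by (cases m) auto
    show "owner (tests A) m = Opponent" "kind_of (tests A) m = Question"
      using m by auto
    fix n show "\<not> enables (tests A) (Some n) m"
      using m by (cases n) auto
  next
    fix m n assume e: "enables (tests A) (Some m) n"
    show "owner (tests A) m \<noteq> owner (tests A) n"
      using e 1(3,5) by (cases m; cases n) auto
  next
    fix m n assume e: "enables (tests A) (Some m) n \<and> kind_of (tests A) n = Answer"
    show "kind_of (tests A) m = Question"
      using e 1(4,5) by (cases m; cases n) auto
  qed
qed

text \<open>A play of the test is determined by its component \<open>s\<close> in \<open>A\<close>, up to the final answer \<open>fin\<close>:
  the initial question comes first and justifies the initial moves of \<open>s\<close>.\<close>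

definition shift :: "'m \<times> nat option \<Rightarrow> ('m + sigma_move) \<times> nat option" where
  "shift x = (Inl (fst x), Some (case snd x of None \<Rightarrow> 0 | Some j \<Rightarrow> Suc j))"

definition emb :: "'m jseq \<Rightarrow> ('m + sigma_move) jseq" where
  "emb s = (Inr Sigma_q, None) # map shift s"

abbreviation fin :: "('m + sigma_move) \<times> nat option" where
  "fin \<equiv> (Inr Sigma_a, Some 0)"

lemma length_emb [simp]: "length (emb s) = Suc (length s)"
  by (simp add: emb_def)

lemma emb_Nil: "emb [] = [(Inr Sigma_q, None)]"
  by (simp add: emb_def)

lemma emb_snoc: "emb (s @ [x]) = emb s @ [shift x]"
  by (simp add: emb_def)

lemma emb_0 [simp]: "emb s ! 0 = (Inr Sigma_q, None)"
  by (simp add: emb_def)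

lemma emb_Suc [simp]: "i < length s \<Longrightarrow> emb s ! Suc i = shift (s ! i)"
  by (simp add: emb_def)

lemma shift_inj: "shift x = shift y \<longleftrightarrow> x = y"
  by (auto simp: shift_def split: option.splits intro: prod_eqI)

lemma shift_fin: "shift x \<noteq> fin"
  by (simp add: shift_def)

lemma emb_inj: "emb s = emb t \<longleftrightarrow> s = t"
  by (simp add: emb_def inj_map_eq_map[OF injI[of shift, OF shift_inj[THEN iffD1]]])

section \<open>Views, open questions and legality under the embedding\<close>

lemma backward_emb: "backward s \<Longrightarrow> backward (emb s)"
proof (induction s rule: rev_induct)
  case Nil
  then show ?case by (simp add: emb_def backward_def)
next
  case (snoc x s)
  then show ?case
    by (auto simp: emb_snoc back_snoc shift_def split: option.splits)
qed

text \<open>The players exchange roles, whence \<open>opposite p\<close>. A jump at an initial move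
  of \<open>A\<close> has nowhere to go in \<open>s\<close> and ends the reading; in the test it
  leads to the initial question, which is therefore always met.\<close>

lemma gv_emb:
  assumes ar: "arena A" and l: "legal A s"
  shows "n \<le> length s \<Longrightarrow>
    gv (tests A) p (emb s) (Suc n) = insert 0 (Suc ` gv A (opposite p) s n)"
proof (induction n rule: less_induct)
  case (less n)
  show ?case
  proof (cases n)
    case 0
    have "gv A (opposite p) s 0 = {}" "gv (tests A) p (emb s) 0 = {}"
      using gv_subset[of A "opposite p" s 0] gv_subset[of "tests A" p "emb s" 0] by auto
    then show ?thesis
      using 0 gv_own[of "tests A" "emb s" 0 p] gv_None[of "tests A" "emb s" 0 p]
      by (cases p) auto
  next
    case (Suc i)
    then have len: "i < length s" using less.prems by simp
    have nth: "emb s ! Suc i = shift (s ! i)" using len by simp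
    have own: "owner (tests A) (move_at (emb s) (Suc i)) = opposite (owner A (move_at s i))"
      by (simp add: nth shift_def)
    show ?thesis
    proof (cases "owner A (move_at s i) = opposite p")
      case True
      then have "gv (tests A) p (emb s) (Suc (Suc i)) = insert (Suc i) (gv (tests A) p (emb s) (Suc i))"
        by (intro gv_own) (simp add: own)
      moreover have "gv A (opposite p) s (Suc i) = insert i (gv A (opposite p) s i)"
        using True by (rule gv_own)
      ultimately show ?thesis
        using less.IH[of i] Suc len by auto
    next
      case False
      then have own': "owner (tests A) (move_at (emb s) (Suc i)) \<noteq> p"
        unfolding own by (metis opposite_opposite)
      show ?thesis
      proof (cases "ptr s i")
        case None
        then have p0: "ptr (emb s) (Suc i) = Some 0"
          by (simp add: nth shift_def)
        have "gv (tests A) p (emb s) (Suc (Suc i)) = insert (Suc i) (insert 0 (gv (tests A) p (emb s) 0))"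
          unfolding gv_def by (rule jv_jump) (use own' p0 in auto)
        moreover have "gv (tests A) p (emb s) 0 = {}"
          using gv_subset[of "tests A" p "emb s" 0] by auto
        ultimately show ?thesis
          unfolding Suc gv_None[OF False None] by auto
      next
        case (Some j)
        have j: "j < i" using legal_ptr(1)[OF l len Some] .
        have pj: "ptr (emb s) (Suc i) = Some (Suc j)"
          using Some by (simp add: nth shift_def)
        have "gv (tests A) p (emb s) (Suc (Suc i)) = insert (Suc i) (insert (Suc j) (gv (tests A) p (emb s) (Suc j)))"
          unfolding gv_def by (rule jv_jump) (use own' pj j in auto)
        moreover have "gv A (opposite p) s (Suc i) = insert i (insert j (gv A (opposite p) s j))"
          unfolding gv_def by (rule jv_jump) (use False Some j in auto)
        ultimately show ?thesis
          using less.IH[of j] Suc len j by auto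
      qed
    qed
  qed
qed

text \<open>The initial question stays open below all others, so position \<open>0\<close> takes the
  place of an empty stack.\<close>

lemma lo_emb:
  assumes l: "legal A s"
  shows "n \<le> length s \<Longrightarrow>
    lo (tests A) (emb s) (Suc n) = Some (case lo A s n of None \<Rightarrow> 0 | Some j \<Rightarrow> Suc j)"
proof (induction n rule: less_induct)
  case (less n)
  show ?case
  proof (cases n)
    case 0
    then show ?thesis by (simp add: lo_Question)
  next
    case (Suc i)
    then have len: "i < length s" using less.prems by simp
    have nth: "emb s ! Suc i = shift (s ! i)" using len by simp
    have k: "kind_of (tests A) (move_at (emb s) (Suc i)) = kind_of A (move_at s i)"
      by (simp add: nth shift_def)
    show ?thesis
    proof (cases "kind_of A (move_at s i)")
      case Question
      then show ?thesis
        unfolding Suc using k by (simp add: lo_Question)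
    next
      case Answer
      then obtain j where j: "ptr s i = Some j"
        using legal_answer(1)[OF l len] by auto
      have ji: "j < i" using legal_ptr(1)[OF l len j] .
      have "lo (tests A) (emb s) (Suc (Suc i)) = lo (tests A) (emb s) (Suc j)"
        by (rule lo_Answer) (use k Answer j ji in \<open>simp_all add: nth shift_def\<close>)
      moreover have "lo A s (Suc i) = lo A s j"
        by (rule lo_Answer[OF Answer j ji])
      ultimately show ?thesis
        using less.IH[of j] ji Suc len by simp
    qed
  qed
qed

lemma legal_emb:
  assumes ar: "arena A"
  shows "legal (tests A) (emb s) \<longleftrightarrow> legal A s"
proof (induction s rule: rev_induct)
  case Nil
  have "legal (tests A) ([] @ [(Inr Sigma_q, None)])"
    unfolding legal_snoc by (simp add: legal_at_def)
  then show ?case by (simp add: emb_Nil)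
next
  case (snoc x s)
  have "legal_at (tests A) (emb s @ [shift x]) (length (emb s)) \<longleftrightarrow> legal_at A (s @ [x]) (length s)"
    if l: "legal A s"
  proof -
    let ?p = "owner A (fst x)" and ?n = "length s"
    have x: "fst (shift x) = Inl (fst x)" "snd (shift x) = Some (case snd x of None \<Rightarrow> 0 | Some j \<Rightarrow> Suc j)"
      by (simp_all add: shift_def)
    have gv: "gv (tests A) (opposite ?p) (emb s) (Suc ?n) = insert 0 (Suc ` gv A ?p s ?n)"
      using gv_emb[OF ar l, of ?n "opposite ?p"] by simp
    have lo: "lo (tests A) (emb s) (Suc ?n) = Some (case lo A s ?n of None \<Rightarrow> 0 | Some j \<Rightarrow> Suc j)"
      using lo_emb[OF l, of ?n] by simp
    have prev: "owner (tests A) (move_at (emb s) ?n) = (if ?n = 0 then Opponent else opposite (owner A (move_at s (?n - 1))))"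
      by (cases ?n) (auto simp: shift_def)
    show ?thesis
    proof (cases "snd x")
      case None
      have "legal_at A (s @ [x]) ?n \<longleftrightarrow> (?n > 0 \<longrightarrow> owner A (move_at s (?n - 1)) \<noteq> ?p) \<and> enables A None (fst x)"
        using None arena_initial[OF ar, of "fst x"] by (auto simp: legal_at_def nth_append)
      moreover have "legal_at (tests A) (emb s @ [shift x]) (length (emb s)) \<longleftrightarrow>
        (?n > 0 \<longrightarrow> owner A (move_at s (?n - 1)) \<noteq> ?p) \<and> enables A None (fst x)"
        using None arena_initial[OF ar, of "fst x"] prev
        by (auto simp: legal_at_def nth_append x gv gv_append)
      ultimately show ?thesis by simp
    next
      case (Some j)
      have A: "legal_at A (s @ [x]) ?n \<longleftrightarrow> (?n > 0 \<longrightarrow> owner A (move_at s (?n - 1)) \<noteq> ?p) \<and>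
        j \<in> gv A ?p s ?n \<and> enables A (Some (move_at s j)) (fst x) \<and>
        (kind_of A (fst x) = Answer \<longrightarrow> lo A s ?n = Some j)"
        using Some gv_less[of j A ?p s ?n]
        by (auto simp: legal_at_def nth_append gv_append lo_append)
      have nth: "emb s ! Suc j = shift (s ! j)" if "j \<in> gv A ?p s ?n"
        using gv_less[OF that] by simp
      have lo': "Some (Suc j) = lo (tests A) (emb s) (Suc ?n) \<longleftrightarrow> lo A s ?n = Some j"
        unfolding lo by (auto split: option.splits)
      have F: "legal_at (tests A) (emb s @ [shift x]) (length (emb s)) \<longleftrightarrow>
        opposite ?p \<noteq> owner (tests A) (move_at (emb s) ?n) \<and>
        j \<in> gv A ?p s ?n \<and> enables A (Some (move_at s j)) (fst x) \<and>
        (kind_of A (fst x) = Answer \<longrightarrow> lo A s ?n = Some j)"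
      proof (cases "j \<in> gv A ?p s ?n")
        case True
        have "emb s ! Suc j = shift (s ! j)" "j < ?n"
          using nth[OF True] gv_less[OF True] by auto
        then have nthj: "(emb s @ [shift x]) ! Suc j = shift (s ! j)"
          by (simp add: nth_append)
        show ?thesis
          using True \<open>j < ?n\<close> Some
          unfolding legal_at_def
          by (simp add: nthj nth_append x gv gv_append lo_append lo'[symmetric])
            (auto simp: shift_def lo')
      next
        case False
        then show ?thesis
          using Some unfolding legal_at_def by (auto simp: nth_append x gv gv_append)
      qed
      have "(?n > 0 \<longrightarrow> owner A (move_at s (?n - 1)) \<noteq> ?p) \<longleftrightarrow> opposite ?p \<noteq> owner (tests A) (move_at (emb s) ?n)"
        if "j \<in> gv A ?p s ?n"
        using gv_less[OF that] prev by auto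
      then show ?thesis using A F by blast
    qed
  qed
  then show ?case
    using snoc.IH by (auto simp: emb_snoc legal_snoc)
qed

lemma rk_from_1: "rk {Suc 0..} (Suc j) = j"
proof -
  have "{Suc 0..} \<inter> {..<Suc j} = {Suc 0..<Suc j}" by auto
  then show ?thesis by (simp add: rk_def)
qed

lemma sub_emb_left: "sub (emb s) {Suc 0..} = map (\<lambda>x. (Inl (fst x), snd x)) s"
proof (induction s rule: rev_induct)
  case Nil
  have "sub ([] @ [(Inr Sigma_q, None)]) {Suc 0..} = ([] :: ('a + sigma_move) jseq)"
    unfolding sub_snoc by simp
  then show ?case by (simp add: emb_Nil)
next
  case (snoc x s)
  have "ptr_map {Suc 0..} (snd (shift x)) = snd x"
    by (cases "snd x") (simp_all add: shift_def rk_from_1)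
  then show ?case
    using snoc by (simp add: emb_snoc sub_snoc) (simp add: shift_def)
qed

lemma sub_emb_right: "sub (emb s) {0} = [(Inr Sigma_q, None)]"
proof (induction s rule: rev_induct)
  case Nil
  have "sub ([] @ [(Inr Sigma_q, None)]) {0} = ([(Inr Sigma_q, None)] :: ('a + sigma_move) jseq)"
    unfolding sub_snoc by simp
  then show ?case by (simp add: emb_Nil)
next
  case (snoc x s)
  then show ?case
    by (simp add: emb_snoc sub_snoc)
qed

lemma isl_emb: "i < Suc (length s) \<Longrightarrow> isl (move_at (emb s) i) \<longleftrightarrow> 0 < i"
  by (cases i) (auto simp: shift_def)

lemma left_emb:
  assumes "backward s"
  shows "left (emb s) = s" "left (emb s @ [fin]) = s"
proof -
  have c: "sub (emb s) I = map (\<lambda>x. (Inl (fst x), snd x)) s"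
    if "\<And>i. i < Suc (length s) \<Longrightarrow> i \<in> I \<longleftrightarrow> 0 < i" for I
  proof -
    have "sub (emb s) I = sub (emb s) {Suc 0..}"
      by (rule sub_cong[OF backward_emb[OF assms]]) (use that in auto)
    then show ?thesis by (simp add: sub_emb_left)
  qed
  have m: "map (apfst projl) (map (\<lambda>x. (Inl (fst x), snd x)) s) = s"
    by (simp add: comp_def)
  show "left (emb s) = s"
    unfolding left_def by (subst c) (use isl_emb m in auto)
  show "left (emb s @ [fin]) = s"
    unfolding left_def sub_snoc
    by (subst c) (use isl_emb m in \<open>auto simp: nth_append\<close>)
qed

lemma right_emb:
  assumes "backward s"
  shows "right (emb s) = [(Sigma_q, None)]" "right (emb s @ [fin]) = [(Sigma_q, None), (Sigma_a, Some 0)]"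
proof -
  have c: "sub (emb s) I = [(Inr Sigma_q, None)]"
    if "\<And>i. i < Suc (length s) \<Longrightarrow> i \<in> I \<longleftrightarrow> i = 0" for I
  proof -
    have "sub (emb s) I = sub (emb s) {0}"
      by (rule sub_cong[OF backward_emb[OF assms]]) (use that in auto)
    then show ?thesis by (simp add: sub_emb_right)
  qed
  show "right (emb s) = [(Sigma_q, None)]"
    unfolding right_def by (subst c) (use isl_emb in auto)
  have "rk I 0 = 0" for I by simp
  then show "right (emb s @ [fin]) = [(Sigma_q, None), (Sigma_a, Some 0)]"
    unfolding right_def sub_snoc
    by (subst c) (use isl_emb in \<open>auto simp: nth_append ptr_map_def\<close>)
qed

text \<open>After the answer Opponent is to move and sees only the initial question and its answer;
  the former enables no O-move, the latter nothing at all.\<close>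

lemma fin_final: "arena A \<Longrightarrow> \<not> legal (tests A) (emb s @ [fin] @ [(m, Some j)])"
proof
  let ?F = "tests A" and ?u = "emb s @ [fin]"
  assume ar: "arena A" and l: "legal ?F (emb s @ [fin] @ [(m, Some j)])"
  then have l': "legal ?F (?u @ [(m, Some j)])" by simp
  have lu: "legal ?F ?u" using l'[THEN legal_snoc[THEN iffD1]] by (rule conjunct1)
  have "owner ?F (move_at (?u @ [(m, Some j)]) (Suc (length s))) \<noteq> owner ?F (move_at (?u @ [(m, Some j)]) (Suc (Suc (length s))))"
    by (rule legal_alternates[OF l']) simp
  then have O: "owner ?F m = Opponent"
    by (cases "owner ?F m") (simp_all add: nth_append)
  have j: "j \<in> gv ?F Opponent ?u (length ?u)" "enables ?F (Some (move_at ?u j)) m"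
    using legal_snoc_ptr[OF l', of j] O by simp_all
  have "gv ?F Opponent ?u (Suc (Suc (length s))) = insert (Suc (length s)) (insert 0 (gv ?F Opponent ?u 0))"
    unfolding gv_def by (rule jv_jump) (auto simp: nth_append)
  moreover have "gv ?F Opponent ?u 0 = {}"
    using gv_subset[of ?F Opponent ?u 0] by auto
  ultimately have "j = Suc (length s) \<or> j = 0"
    using j(1) by simp
  then have "move_at ?u j = Inr Sigma_a \<or> move_at ?u j = Inr Sigma_q"
    by (auto simp: nth_append)
  then show False
    using j(2) O arena_initial[OF ar] by (cases m) auto
qed

text \<open>The condition on pointers excludes a second initial question, so each further move is a
  move of \<open>A\<close> or the final answer, after which nothing can follow.\<close>

lemma tests_shape:
  assumes ar: "arena A"
  shows "legal (tests A) u \<Longrightarrow> (\<forall>i<length u. ptr u i = None \<longrightarrow> i = 0) \<Longrightarrow>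
    u = [] \<or> (\<exists>s. legal A s \<and> u = emb s) \<or> (\<exists>s. legal A s \<and> u = emb s @ [fin])"
proof (induction u rule: rev_induct)
  case (snoc x u)
  let ?F = "tests A"
  have "\<forall>i<length u. ptr u i = None \<longrightarrow> i = 0"
    using snoc.prems(2) by (auto simp: nth_append)
  then have IH: "u = [] \<or> (\<exists>s. legal A s \<and> u = emb s) \<or> (\<exists>s. legal A s \<and> u = emb s @ [fin])"
    using snoc.IH snoc.prems(1) by (simp add: legal_snoc)
  show ?case
  proof (cases "u = []")
    case True
    then have "snd x = None"
      using legal_ptr(1)[OF snoc.prems(1), of 0] by (cases "snd x") auto
    moreover from this have "enables ?F None (fst x)"
      using legal_initial[OF snoc.prems(1), of 0] True by simp
    ultimately have "x = (Inr Sigma_q, None)"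
      by (cases x; cases "fst x") auto
    then show ?thesis
      using True emb_Nil legal_Nil by (metis append_Nil)
  next
    case False
    then obtain j where j: "snd x = Some j"
      using snoc.prems(2)[rule_format, of "length u"] by (cases "snd x") auto
    show ?thesis
    proof (cases "\<exists>s. u = emb s @ [fin]")
      case True
      then show ?thesis
        using fin_final[OF ar, of _ "fst x" j] snoc.prems(1) j by (metis append.assoc prod.collapse)
    next
      case nf: False
      then obtain s where s: "legal A s" "u = emb s" using IH False by blast
      have en: "enables ?F (Some (move_at u j)) (fst x)" "j < length u"
        using legal_snoc_ptr[OF snoc.prems(1) j] by auto
      show ?thesis
      proof (cases "fst x")
        case (Inl m)
        have "x = shift (m, if j = 0 then None else Some (j - 1))"
          using Inl j by (intro prod_eqI) (auto simp: shift_def)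
        then have "u @ [x] = emb (s @ [(m, if j = 0 then None else Some (j - 1))])"
          using s by (simp add: emb_snoc)
        then show ?thesis
          using legal_emb[OF ar] snoc.prems(1) by metis
      next
        case (Inr c)
        have "move_at u j = Inr Sigma_q \<and> c = Sigma_a"
          using en(1) Inr by (cases "move_at u j") auto
        moreover have "j = 0"
          using calculation en(2) s(2) by (cases j) (auto simp: shift_def)
        ultimately have "x = fin"
          using Inr j by (intro prod_eqI) auto
        then show ?thesis using s by blast
      qed
    qed
  qed
qed simp

text \<open>The plays of the function space are defined by legality for the bare arena record; this
  transfers it to the game record, which has the additional field \<open>plays\<close>.\<close>

lemma legal_field_cong:
  fixes X :: "('m, 'y) arena_scheme" and Y :: "('m, 'z) arena_scheme"
  assumes "owner X = owner Y" "kind_of X = kind_of Y" "enables X = enables Y"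
  shows "legal X = legal Y"
proof -
  have lo: "lo X s n = lo Y s n" for s n
  proof (induction n rule: less_induct)
    case (less n)
    show ?case
    proof (cases n)
      case (Suc i)
      have "\<And>j. j < i \<Longrightarrow> lo X s j = lo Y s j" using less Suc by simp
      then show ?thesis
        unfolding Suc lo.simps assms(2) by (auto split: option.splits)
    qed simp
  qed
  have gv: "gv X p s n = gv Y p s n" for p s n
    by (simp add: gv_def assms(1))
  show ?thesis
    by (rule ext) (simp only: legal_iff legal_at_def lo gv assms)
qed

lemma plays_tests_def:
  "plays (tests A) = {u. legal (tests A) u \<and> left u \<in> bang_plays A \<and> right u \<in> plays Sigma_game}"
proof -
  have "legal (fun_arena A Sigma_game) = legal (tests A)"
    by (rule legal_field_cong) (simp_all add: fun_game_def with_plays_def)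
  then show ?thesis
    by (simp add: fun_game_def with_plays_def)
qed

lemma left_right_Nil: "left [] = []" "right [] = []"
  by (simp_all add: left_def right_def)

text \<open>No play of \<open>Sigma_game\<close> has two initial questions, which gives the
  condition on pointers. Conversely, by \<open>tests_shape\<close> such a sequence has a legal left
  component and a play of \<open>Sigma_game\<close> on the right.\<close>

lemma plays_tests:
  assumes A: "game A"
  shows "plays (tests A) = {u. legal (tests A) u \<and> (\<forall>i<length u. ptr u i = None \<longrightarrow> i = 0)}"
    (is "_ = ?R")
proof (intro equalityI subsetI)
  fix u assume u: "u \<in> plays (tests A)"
  then have l: "legal (tests A) u" and rt: "right u \<in> plays Sigma_game"
    by (auto simp: plays_tests_def)
  let ?I = "{i. i < length u \<and> \<not> isl (move_at u i)}"
  have key: "k < length (right u) \<Longrightarrow> ptr (right u) k = None \<Longrightarrow> k = 0" for k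
    using rt by (auto simp: Sigma_game_def less_Suc_eq)
  have "i = 0" if i: "i < length u" "ptr u i = None" for i
  proof -
    have *: "i \<in> ?I \<and> rk ?I i = 0" if i: "i < length u" "ptr u i = None" for i
    proof -
      have "enables (tests A) None (move_at u i)" using legal_initial[OF l i] .
      then have iI: "i \<in> ?I" using i(1) by (cases "move_at u i") auto
      have "rk ?I i < length (sub u ?I)" using iI i(1) by (simp add: length_sub rk_less)
      moreover have "ptr (sub u ?I) (rk ?I i) = None" using sub_nth[OF i(1) iI] i(2) by simp
      ultimately have "rk ?I i = 0"
        using key[of "rk ?I i"] by (simp add: right_def)
      then show ?thesis using iI by blast
    qed
    have "ptr u 0 = None"
      using backD[OF legal_backward[OF l], of 0] i(1) by (cases "ptr u 0"; cases u) auto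
    moreover have "0 < length u" using i(1) by (cases u) auto
    ultimately show ?thesis
      using *[of 0] *[OF i] rk_inj[of i ?I 0] by metis
  qed
  then show "u \<in> ?R" using l by blast
next
  fix u assume "u \<in> ?R"
  then have l: "legal (tests A) u" and n: "\<forall>i<length u. ptr u i = None \<longrightarrow> i = 0" by auto
  have ar: "arena A" using A by (simp add: game_def)
  have "left u \<in> bang_plays A \<and> right u \<in> plays Sigma_game"
    using tests_shape[OF ar l n]
    by (auto simp: left_right_Nil left_emb[OF legal_backward] right_emb[OF legal_backward]
        bang_plays_legal[OF A] Sigma_game_def)
  then show "u \<in> plays (tests A)"
    using l by (simp add: plays_tests_def)
qed

lemma tests_cases:
  assumes "game A" "u \<in> plays (tests A)"
  obtains "u = []" | s where "legal A s" "u = emb s" | s where "legal A s" "u = emb s @ [fin]"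
  using assms tests_shape[of A u] by (auto simp: plays_tests game_def)

lemma tests_snoc:
  assumes "game A" "u \<in> plays (tests A)" "legal (tests A) (u @ [x])" "snd x \<noteq> None"
  shows "u @ [x] \<in> plays (tests A)"
  using assms by (auto simp: plays_tests nth_append less_Suc_eq)

lemma pregame_tests:
  assumes "game A"
  shows "pregame (tests A)"
  unfolding pregame_def
proof (intro conjI allI impI)
  show "arena (tests A)" using assms arena_tests by (auto simp: game_def)
  show "plays (tests A) \<subseteq> Collect (legal (tests A))" using assms by (auto simp: plays_tests)
  fix u v assume uv: "v \<in> plays (tests A) \<and> prefix u v"
  then have "legal (tests A) u" using legal_prefix assms by (auto simp: plays_tests)
  moreover have "ptr u i = None \<longrightarrow> i = 0" if "i < length u" for i
  proof -
    have "u ! i = v ! i" "i < length v"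
      using uv that prefix_length_le[of u v] by (auto simp: prefix_def nth_append)
    then show ?thesis using uv assms by (auto simp: plays_tests)
  qed
  ultimately show "u \<in> plays (tests A)" using assms by (simp add: plays_tests)
qed

lemma emb_play: "game A \<Longrightarrow> legal A s \<Longrightarrow> emb s \<in> plays (tests A)"
proof -
  assume A: "game A" "legal A s"
  have "i = 0" if "i < length (emb s)" "ptr (emb s) i = None" for i
    using that by (cases i) (auto simp: shift_def)
  then show ?thesis
    using A legal_emb[of A s] by (auto simp: plays_tests game_def)
qed

section \<open>What the test sees, and when it may answer\<close>

lemma gv_ptr:
  assumes ar: "arena A" and l: "legal A s" and n: "n \<le> length s"
    and k: "k \<in> gv A p s n" "ptr s k = Some j"
  shows "j \<in> gv A p s n"
proof -
  have len: "k < length s" using gv_less[OF k(1)] n by simp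
  show ?thesis
  proof (cases "owner A (move_at s k) = p")
    case True
    then have "j \<in> gv A p s (Suc k)"
      using legal_ptr(3)[OF l len k(2)] gv_own[OF True] by simp
    then show ?thesis using gv_mono[OF ar l n k(1)] by blast
  next
    case False
    then show ?thesis
      using gv_other(1)[OF ar l len False k(2)] gv_top gv_mono[OF ar l n k(1)] by blast
  qed
qed

lemma rk_insert_Suc: "rk (insert 0 (Suc ` K)) (Suc j) = Suc (rk K j)"
proof -
  have "insert 0 (Suc ` K) \<inter> {..<Suc j} = insert 0 (Suc ` (K \<inter> {..<j}))" by auto
  then show ?thesis
    by (simp add: rk_def card_image)
qed

lemma sub_emb:
  "(\<And>i j. i < length s \<Longrightarrow> i \<in> K \<Longrightarrow> ptr s i = Some j \<Longrightarrow> j \<in> K) \<Longrightarrow>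
   sub (emb s) (insert 0 (Suc ` K)) = emb (sub s K)"
proof (induction s rule: rev_induct)
  case Nil
  have "sub ([] @ [(Inr Sigma_q, None)]) (insert 0 (Suc ` K)) = ([(Inr Sigma_q, None)] :: ('a + sigma_move) jseq)"
    unfolding sub_snoc by simp
  then show ?case by (simp add: emb_Nil)
next
  case (snoc x s)
  have IH: "sub (emb s) (insert 0 (Suc ` K)) = emb (sub s K)"
  proof (rule snoc.IH)
    fix i j assume i: "i < length s" "i \<in> K" "ptr s i = Some j"
    show "j \<in> K" by (rule snoc.prems[of i j]) (use i in \<open>simp_all add: nth_append\<close>)
  qed
  show ?case
  proof (cases "length s \<in> K")
    case True
    have "\<And>j. snd x = Some j \<Longrightarrow> j \<in> K"
      using snoc.prems[of "length s"] True by simp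
    then have "(fst (shift x), ptr_map (insert 0 (Suc ` K)) (snd (shift x))) = shift (fst x, ptr_map K (snd x))"
      by (cases "snd x") (auto simp: shift_def ptr_map_def rk_insert_Suc)
    then show ?thesis
      using True IH by (simp add: emb_snoc sub_snoc)
  next
    case False
    then have "Suc (length s) \<notin> insert 0 (Suc ` K)" by auto
    then show ?thesis
      using False IH by (simp add: emb_snoc sub_snoc)
  qed
qed

text \<open>The dictionary between the two games: the test as Proponent sees what Opponent sees in
  \<open>A\<close>.\<close>

lemma view_emb:
  assumes ar: "arena A" and l: "legal A s" and n: "n \<le> length s"
  shows "view (tests A) Proponent (emb s) (Suc n) = emb (view A Opponent s n)"
  unfolding view_def gv_emb[OF ar l n] opposite.simps
  by (rule sub_emb) (rule gv_ptr[OF ar l n])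

lemma view_fin:
  assumes ar: "arena A" and l: "legal (tests A) (emb s @ [fin])" "legal A s"
  shows "view (tests A) Proponent (emb s @ [fin]) (Suc (Suc (length s))) = emb (view A Opponent s (length s)) @ [fin]"
proof -
  have "0 \<in> gv (tests A) Proponent (emb s) (Suc (length s))"
    using gv_emb[OF ar l(2), of "length s"] by simp
  then show ?thesis
    using view_snoc[OF l(1), of Proponent] view_emb[OF ar l(2), of "length s"] by simp
qed

text \<open>By well-bracketing the initial question can be answered only if no question of
  \<open>s\<close> is open; parity says that it is the test's turn.\<close>

lemma legal_fin:
  assumes ar: "arena A" and l: "legal A s"
  shows "legal (tests A) (emb s @ [fin]) \<longleftrightarrow> even (length s) \<and> complete A s"
proof -
  let ?F = "tests A"
  have le: "legal ?F (emb s)" using legal_emb[OF ar] l by simp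
  have own: "owner ?F (move_at (emb s) (length s)) = Opponent \<longleftrightarrow> even (length s)"
    using legal_parity[OF arena_tests[OF ar] le, of "length s"] by simp
  have gv: "0 \<in> gv ?F Proponent (emb s) (Suc (length s))"
    using gv_emb[OF ar l, of "length s"] by simp
  have c: "complete A s \<longleftrightarrow> lo ?F (emb s) (Suc (length s)) = Some 0"
    using complete_iff_lo[of A s] lo_emb[OF l, of "length s"] l by (auto simp: legal_def split: option.splits)
  have mv: "move_at (emb s @ [fin]) (length s) = move_at (emb s) (length s)" "move_at (emb s @ [fin]) 0 = Inr Sigma_q"
    by (simp_all add: nth_append)
  have fl: "(emb s @ [fin]) ! Suc (length s) = fin"
    using nth_append_length[of "emb s" fin] by simp
  have "legal_at ?F (emb s @ [fin]) (Suc (length s)) \<longleftrightarrow> even (length s) \<and> complete A s"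
    unfolding legal_at_def using own gv c
    by (auto simp: fl mv gv_append lo_append)
  then show ?thesis
    using le by (simp add: legal_snoc)
qed

section \<open>Tests given by views\<close>

definition strat_of :: "'m game \<Rightarrow> 'm jseq set \<Rightarrow> 'm jseq set" where
  "strat_of G W = {u \<in> plays G. even (length u) \<and>
     (\<forall>n<length u. odd n \<longrightarrow> view G Proponent u (Suc n) \<in> W)}"

text \<open>Membership is tested view by view, and determinism of \<open>W\<close> carries over. For
  innocence, \<open>legal_extend\<close> copies the reply; the copy is a play because a P-move is
  never initial.\<close>

lemma innocent_strat_of:
  assumes A: "game A" and det: "det_views W"
  shows "innocent_strategy (tests A) (strat_of (tests A) W)"
proof -
  let ?F = "tests A" and ?S = "strat_of (tests A) W"
  have G: "pregame ?F" by (rule pregame_tests[OF A])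
  have ar: "arena ?F" and legal: "\<And>u. u \<in> plays ?F \<Longrightarrow> legal ?F u"
    and pre: "\<And>u v. v \<in> plays ?F \<Longrightarrow> prefix u v \<Longrightarrow> u \<in> plays ?F"
    using G by (auto simp: pregame_def)
  have views: "view ?F Proponent u (Suc n) = view ?F Proponent v (Suc n)"
    if "v \<in> plays ?F" "prefix u v" "n < length u" for u v n
    using that view_append[OF legal_backward[OF legal], of u _ "Suc n" ?F Proponent]
    by (auto simp: prefix_def)
  have last: "view ?F Proponent (s @ [a, b]) (Suc (Suc (length s))) \<in> W" if "s @ [a, b] \<in> ?S" for s a b
  proof -
    have "even (length s)" using that by (simp add: strat_of_def)
    then show ?thesis
      using that[unfolded strat_of_def, simplified] by (metis even_Suc lessI)
  qed
  have pf: "s \<in> ?S" if t: "t \<in> ?S" "prefix s t" "even (length s)" for s t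
  proof -
    have "n < length s \<Longrightarrow> n < length t" for n
      using prefix_length_le[OF t(2)] by simp
    then show ?thesis
      using t pre[OF _ t(2)] views[OF _ t(2)] unfolding strat_of_def by auto
  qed
  have emptyS: "[] \<in> ?S"
    using A by (simp add: strat_of_def plays_tests)
  have strat: "strategy ?F ?S"
    unfolding strategy_def
  proof (intro conjI allI impI)
    show "?S \<subseteq> {s \<in> plays ?F. even (length s)}" by (auto simp: strat_of_def)
    show "?S \<noteq> {}" using emptyS by blast
    show "s \<in> ?S" if "t \<in> ?S \<and> prefix s t \<and> even (length s)" for s t
      using that pf by blast
    fix s a b c assume s: "s @ [a, b] \<in> ?S \<and> s @ [a, c] \<in> ?S"
    have e: "s @ [a, x] = (s @ [a]) @ [x]" for x by simp
    have l: "legal ?F (s @ [a, b])" "legal ?F (s @ [a, c])"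
      using s legal by (auto simp: strat_of_def)
    have ev: "even (length s)" using s by (simp add: strat_of_def)
    obtain x y where xy: "view ?F Proponent (s @ [a, b]) (Suc (Suc (length s))) = view ?F Proponent (s @ [a]) (Suc (length s)) @ [x]"
      "view ?F Proponent (s @ [a, c]) (Suc (Suc (length s))) = view ?F Proponent (s @ [a]) (Suc (length s)) @ [y]"
      using view_snoc2(1)[OF ar l(1) ev] view_snoc2(1)[OF ar l(2) ev] by blast
    then have "x = y"
      using last[of s a b] last[of s a c] s det_viewsD[OF det] by metis
    then show "b = c"
      using view_snoc_inj[OF l[unfolded e], of Proponent] view_snoc2(2)[OF ar l(1) ev] xy by simp
  qed
  have "innocent ?F ?S"
    unfolding innocent_def
  proof (intro allI impI, elim conjE)
    fix s a b t a'
    assume s: "s @ [a, b] \<in> ?S" and t: "t \<in> ?S" and ta: "t @ [a'] \<in> plays ?F"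
      and eq: "pview ?F (t @ [a']) = pview ?F (s @ [a])"
    have e: "s @ [a, b] = (s @ [a]) @ [b]" by simp
    have l: "legal ?F (s @ [a, b])" using s legal by (auto simp: strat_of_def)
    have ev: "even (length s)" "even (length t)" using s t by (auto simp: strat_of_def)
    note own = view_snoc2(2)[OF ar l ev(1)]
    have "view ?F Proponent (t @ [a']) (length (t @ [a'])) = view ?F Proponent (s @ [a]) (length (s @ [a]))"
      using eq by (simp add: pview_view)
    from legal_extend[OF ar legal[OF ta] l[unfolded e] own this]
    obtain y where y: "legal ?F ((t @ [a']) @ [y])" "fst y = fst b"
      "view ?F Proponent ((t @ [a']) @ [y]) (Suc (length (t @ [a']))) = view ?F Proponent ((s @ [a]) @ [b]) (Suc (length (s @ [a])))"
      by blast
    have "owner ?F (fst y) = Proponent" using own y(2) by simp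
    then have "snd y \<noteq> None"
      using legal_initial[OF y(1), of "length (t @ [a'])"] arena_initial[OF ar, of "fst y"]
      unfolding nth_append_length by auto
    then have pl: "(t @ [a']) @ [y] \<in> plays ?F"
      using tests_snoc[OF A ta y(1)] by simp
    have "view ?F Proponent (t @ [a', y]) (Suc n) \<in> W" if n: "n < length (t @ [a', y])" "odd n" for n
    proof (cases "n < length t")
      case True
      then have "view ?F Proponent t (Suc n) \<in> W"
        using t n by (simp add: strat_of_def)
      then show ?thesis
        using views[OF _ _ True, of "t @ [a', y]"] pl by simp
    next
      case False
      then have "n = Suc (length t)"
        using n ev(2) by (auto simp: less_Suc_eq)
      then show ?thesis
        using y(3) last[OF s] by simp
    qed
    then have "t @ [a', y] \<in> ?S"
      using pl ev(2) by (simp add: strat_of_def)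
    moreover have "pview ?F (t @ [a', y]) = pview ?F (s @ [a, b])"
      using y(3) by (simp add: pview_view)
    ultimately show "\<exists>b'. t @ [a', b'] \<in> ?S \<and> pview ?F (t @ [a', b']) = pview ?F (s @ [a, b])"
      by blast
  qed
  then show ?thesis
    using strat by (simp add: innocent_strategy_def)
qed

text \<open>A play \<open>emb s\<close> with \<open>s\<close> in the promoted strategy has odd
  length and is not in \<alpha>. Hence only \<open>[]\<close> and plays ending in \<open>fin\<close>
  contribute to the composite.\<close>

lemma compose_iff:
  assumes A: "game A" and st: "innocent_strategy A \<sigma>" and \<alpha>: "innocent_strategy (tests A) \<alpha>"
  shows "compose A \<sigma> \<alpha> = Sigma_top \<longleftrightarrow> (\<exists>s. s \<in> promote A \<sigma> \<and> emb s @ [fin] \<in> \<alpha>)"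
proof -
  have G: "pregame (tests A)" by (rule pregame_tests[OF A])
  have lp: "legal A s" if "s \<in> promote A \<sigma>" for s
    using that by (simp add: promote_iff[OF A])
  have up: "right u = [] \<or> (\<exists>s. s \<in> promote A \<sigma> \<and> emb s @ [fin] \<in> \<alpha> \<and> right u = [(Sigma_q, None), (Sigma_a, Some 0)])"
    if u: "left u \<in> promote A \<sigma>" "u \<in> \<alpha>" for u
    using tests_cases[OF A strategy_play(1)[OF G \<alpha> u(2)]]
  proof cases
    case 1
    then show ?thesis by (simp add: left_right_Nil)
  next
    case (2 s)
    then have "s \<in> promote A \<sigma>" using u(1) left_emb(1)[OF legal_backward[OF 2(1)]] by simp
    then have "even (length s)" by (rule promote_even[OF A st])
    moreover have "even (length u)" using strategy_play(2)[OF G \<alpha> u(2)] .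
    ultimately show ?thesis using 2 by simp
  next
    case (3 s)
    then show ?thesis
      using u left_emb(2)[OF legal_backward[OF 3(1)]] right_emb(2)[OF legal_backward[OF 3(1)]] by auto
  qed
  have nil: "[] \<in> compose A \<sigma> \<alpha>"
    unfolding compose_def using strategy_Nil[OF G \<alpha>]
    by (auto simp: left_right_Nil promote_iff[OF A] intro!: exI[of _ "[]"])
  show ?thesis
  proof
    assume "compose A \<sigma> \<alpha> = Sigma_top"
    then have "[(Sigma_q, None), (Sigma_a, Some 0)] \<in> compose A \<sigma> \<alpha>"
      by (simp add: Sigma_top_def)
    then obtain u where "left u \<in> promote A \<sigma>" "u \<in> \<alpha>" "right u = [(Sigma_q, None), (Sigma_a, Some 0)]"
      unfolding compose_def by (smt (verit) mem_Collect_eq)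
    then have "left u \<in> promote A \<sigma>" "u \<in> \<alpha>" "right u \<noteq> []" by simp_all
    then show "\<exists>s. s \<in> promote A \<sigma> \<and> emb s @ [fin] \<in> \<alpha>"
      using up by blast
  next
    assume "\<exists>s. s \<in> promote A \<sigma> \<and> emb s @ [fin] \<in> \<alpha>"
    then obtain s where s: "s \<in> promote A \<sigma>" "emb s @ [fin] \<in> \<alpha>" by blast
    then have "[(Sigma_q, None), (Sigma_a, Some 0)] \<in> compose A \<sigma> \<alpha>"
      unfolding compose_def
      using left_emb(2)[OF legal_backward[OF lp[OF s(1)]]] right_emb(2)[OF legal_backward[OF lp[OF s(1)]]]
      by (intro CollectI exI[of _ "emb s @ [fin]"]) simp
    moreover have "compose A \<sigma> \<alpha> \<subseteq> Sigma_top"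
      unfolding compose_def Sigma_top_def using up by blast
    ultimately show "compose A \<sigma> \<alpha> = Sigma_top"
      using nil by (auto simp: Sigma_top_def)
  qed
qed

section \<open>Equal observations imply equivalence\<close>

text \<open>The bound \<open>k\<close> counts positions rather than threads, so lowering it by one
  concerns the thread opened at that position, if there is one.\<close>

definition hybrid :: "'m game \<Rightarrow> 'm jseq set \<Rightarrow> 'm jseq set \<Rightarrow> ('m + sigma_move) jseq set \<Rightarrow> nat \<Rightarrow> 'm jseq \<Rightarrow> bool" where
  "hybrid A \<sigma> \<tau> \<alpha> k s \<longleftrightarrow> legal A s \<and> even (length s) \<and> emb s @ [fin] \<in> \<alpha> \<and>
     (\<forall>i<length s. ptr s i = None \<longrightarrow> th s i \<in> (if i < k then \<sigma> else \<tau>))"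

lemma hybrid_step:
  assumes A: "game A" and st: "innocent_strategy A \<sigma>" "innocent_strategy A \<tau>"
    and \<alpha>: "innocent_strategy (tests A) \<alpha>" and ob: "obs A \<sigma> \<subseteq> obs A \<tau>"
    and h: "hybrid A \<sigma> \<tau> \<alpha> (Suc k) s"
  shows "\<exists>w. hybrid A \<sigma> \<tau> \<alpha> k w"
proof (cases "k < length s \<and> ptr s k = None")
  case False
  have "th s i \<in> (if i < k then \<sigma> else \<tau>)" if i: "i < length s" "ptr s i = None" for i
  proof -
    have "i \<noteq> k" using False i by blast
    then have "i < Suc k \<longleftrightarrow> i < k" by auto
    then show ?thesis using h i unfolding hybrid_def by metis
  qed
  then show ?thesis using h unfolding hybrid_def by blast
next
  case True
  then have k: "k < length s" "ptr s k = None" by auto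
  let ?F = "tests A"
  \<comment> \<open>The view function of the test, translated into O-views of \<open>A\<close>. The
    final answer is not an embedded move and is treated separately below.\<close>
  define OB where "OB = {v. emb v \<in> VP ?F \<alpha>}"
  have ar: "arena A" and G: "pregame ?F" and GA: "pregame A"
    using A pregame_tests game_pregame by (auto simp: game_def)
  have l: "legal A s" and ev: "even (length s)" and \<alpha>s: "emb s @ [fin] \<in> \<alpha>"
    and ths: "\<And>i. i < length s \<Longrightarrow> ptr s i = None \<Longrightarrow> th s i \<in> (if i < Suc k then \<sigma> else \<tau>)"
    using h by (auto simp: hybrid_def)
  have lf: "legal ?F (emb s @ [fin])" using strategy_play(3)[OF G \<alpha> \<alpha>s] .
  have le: "legal ?F (emb s)" using legal_emb[OF ar] l by simp
  have comp: "complete A s" using legal_fin[OF ar l] lf by simp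
  have det: "det_views OB" "det_views (VP A \<sigma>)" "det_views (VP A \<tau>)"
  proof -
    show "det_views OB"
      unfolding det_views_def
    proof (intro allI impI, elim conjE)
      fix v x y assume "v @ [x] \<in> OB" "v @ [y] \<in> OB"
      then have "shift x = shift y"
        using det_viewsD[OF det_VP[OF G \<alpha>], of "emb v"] by (simp add: OB_def emb_snoc)
      then show "x = y" by (simp only: shift_inj)
    qed
  qed (rule det_VP[OF GA] st)+
  have rooted: "root s n < length s" "ptr s (root s n) = None" if "n < length s" for n
    using ptr_root[OF legal_backward[OF l] that] root_le[of s n] that by auto
  have fol: "follows A k OB (VP A \<sigma>) (VP A \<tau>) s"
    unfolding follows_def
  proof (intro allI impI conjI)
    fix n assume n: "n < length s"
    show "view A Opponent s (Suc n) \<in> OB" if O: "owner A (move_at s n) = Opponent"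
    proof -
      have "even n" using legal_parity[OF ar l n] O by simp
      then have "view ?F Proponent (emb s @ [fin]) (Suc (Suc n)) \<in> VP ?F \<alpha>"
        using VP_I[OF G \<alpha> \<alpha>s, of "Suc n"] n by simp
      then have "view ?F Proponent (emb s) (Suc (Suc n)) \<in> VP ?F \<alpha>"
        using view_append[OF legal_backward[OF lf], of "Suc (Suc n)" ?F Proponent] n by simp
      then show ?thesis
        using view_emb[OF ar l, of "Suc n"] n by (simp add: OB_def)
    qed
    show "view A Proponent s (Suc n) \<in> VP A \<sigma>" if P: "owner A (move_at s n) = Proponent \<and> root s n < k"
      using thread_views[OF A st(1) l _ n refl] ths[OF rooted[OF n]] P by simp
    show "view A Proponent s (Suc n) \<in> VP A \<tau>" if P: "owner A (move_at s n) = Proponent \<and> k < root s n"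
      using thread_views[OF A st(2) l _ n refl] ths[OF rooted[OF n]] P by simp
  qed
  let ?t = "th s k"
  have t\<sigma>: "?t \<in> \<sigma>" using ths[OF k] by simp
  have lt: "legal A ?t" using legal_thread[OF ar l] .
  have "k \<in> tset s k" using k(2) by (simp add: tset_def root_None)
  then have "0 < length ?t"
    using k(1) rk_less[of k "length s" "tset s k"] by (simp add: length_sub)
  then have "single_threaded A ?t"
    using th_ptr_None[OF legal_backward[OF l]] by (auto simp: single_threaded_iff[OF ar lt])
  then have "ovw A ?t \<in> obs A \<sigma>"
    unfolding obs_def using t\<sigma> complete_thread[OF l comp] O_innocent_thread[OF ar l det fol] by blast
  then obtain t' where t': "t' \<in> \<tau>" "complete A t'" "ovw A ?t = ovw A t'"
    using ob unfolding obs_def by auto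
  obtain w where w: "legal A w" "follows A k OB (VP A \<sigma>) (VP A \<tau>) w" "prefix (th w k) t'"
    "view A Opponent w (length w) = view A Opponent s (length s)"
    using replace_thread[OF ar l det fol even_thread[OF ar l ev] complete_thread[OF l comp]
        strategy_play(3)[OF GA st(2) t'(1)] strategy_play(2)[OF GA st(2) t'(1)] t'(2,3)] .
  have evw: "even (length w)"
    using view_parity[OF ar w(1) l _ _ w(4)] ev by simp
  have lew: "legal ?F (emb w)" using legal_emb[OF ar] w(1) by simp
  have \<alpha>w: "emb w @ [fin] \<in> \<alpha>"
  proof (rule mem_by_views[OF G \<alpha>])
    \<comment> \<open>Whether the answer is allowed shows in the final O-view, which the replacement
      has preserved.\<close>
    have "lo A w (length w) = None"
    proof -
      have "lo A s (length s) = None"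
        using comp l by (auto simp: complete_iff_lo legal_def)
      then show ?thesis
        using oview_lo[OF ar l, of "length s"] oview_lo[OF ar w(1), of "length w"] w(4) ev evw by simp
    qed
    then have "complete A w"
      using w(1) by (auto simp: complete_iff_lo legal_def)
    then have lfw: "legal ?F (emb w @ [fin])"
      using legal_fin[OF ar w(1)] evw by simp
    show "emb w @ [fin] \<in> plays ?F"
      using tests_snoc[OF A emb_play[OF A w(1)] lfw] by simp
    show "even (length (emb w @ [fin]))" using evw by simp
    show "\<forall>n<length (emb w @ [fin]). odd n \<longrightarrow> view ?F Proponent (emb w @ [fin]) (Suc n) \<in> VP ?F \<alpha>"
    proof (intro allI impI)
      fix n assume n: "n < length (emb w @ [fin])" "odd n"
      then obtain m where m: "n = Suc m" "even m" "m \<le> length w" by (cases n) auto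
      show "view ?F Proponent (emb w @ [fin]) (Suc n) \<in> VP ?F \<alpha>"
      proof (cases "m = length w")
        case True
        have "view ?F Proponent (emb s @ [fin]) (Suc (Suc (length s))) \<in> VP ?F \<alpha>"
          using VP_I[OF G \<alpha> \<alpha>s, of "Suc (length s)"] ev by simp
        then show ?thesis
          using view_fin[OF ar lf l] view_fin[OF ar lfw w(1)] w(4) m True by simp
      next
        case False
        then have mw: "m < length w" using m by simp
        then have "owner A (move_at w m) = Opponent"
          using legal_parity[OF ar w(1)] m(2) by simp
        then have "emb (view A Opponent w (Suc m)) \<in> VP ?F \<alpha>"
          using w(2) mw by (simp add: follows_def OB_def)
        then show ?thesis
          using view_emb[OF ar w(1), of "Suc m"] view_append[OF legal_backward[OF lfw], of "Suc (Suc m)" ?F Proponent]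
            mw m(1) by simp
      qed
    qed
  qed
  have "th w i \<in> (if i < k then \<sigma> else \<tau>)" for i
  proof -
    consider "i < k" | "i = k" | "k < i" by linarith
    then show ?thesis
    proof cases
      case 1
      have "th w i \<in> \<sigma>"
        by (rule thread_by_views[OF A st(1) w(1) evw]) (use w(2) 1 in \<open>auto simp: follows_def\<close>)
      then show ?thesis using 1 by simp
    next
      case 2
      then show ?thesis
        using strategy_prefix[OF GA st(2) t'(1) w(3) even_thread[OF ar w(1) evw]] by simp
    next
      case 3
      have "th w i \<in> \<tau>"
        by (rule thread_by_views[OF A st(2) w(1) evw]) (use w(2) 3 in \<open>auto simp: follows_def\<close>)
      then show ?thesis using 3 by simp
    qed
  qed
  then show ?thesis
    using w(1) evw \<alpha>w unfolding hybrid_def by blast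
qed

lemma obs_leq_ib:
  assumes A: "game A" and st: "innocent_strategy A \<sigma>" "innocent_strategy A \<tau>"
    and ob: "obs A \<sigma> \<subseteq> obs A \<tau>"
  shows "leq_ib A \<sigma> \<tau>"
  unfolding leq_ib_def
proof (intro allI impI)
  fix \<alpha> assume \<alpha>: "innocent_strategy (tests A) \<alpha>" and "compose A \<sigma> \<alpha> = Sigma_top"
  then obtain s where s: "s \<in> promote A \<sigma>" "emb s @ [fin] \<in> \<alpha>"
    using compose_iff[OF A st(1) \<alpha>] by blast
  \<comment> \<open>With bound \<open>length s\<close> every thread belongs to \<sigma>; with bound
    \<open>0\<close> every thread belongs to \<tau>.\<close>
  then have "hybrid A \<sigma> \<tau> \<alpha> (length s) s"
    using promote_even[OF A st(1)] by (auto simp: hybrid_def promote_iff[OF A])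
  moreover have "(\<exists>w. hybrid A \<sigma> \<tau> \<alpha> k w) \<Longrightarrow> (\<exists>w. hybrid A \<sigma> \<tau> \<alpha> 0 w)" for k
  proof (induction k)
    case (Suc k)
    then show ?case using hybrid_step[OF A st \<alpha> ob] by blast
  qed
  ultimately obtain w where "hybrid A \<sigma> \<tau> \<alpha> 0 w" by blast
  then have "w \<in> promote A \<tau>" "emb w @ [fin] \<in> \<alpha>"
    by (auto simp: hybrid_def promote_iff[OF A])
  then show "compose A \<tau> \<alpha> = Sigma_top"
    using compose_iff[OF A st(2) \<alpha>] by blast
qed

section \<open>Equivalence implies equal observations\<close>

lemma ovw_last_O:
  assumes l: "legal A s" and v: "v @ [x] \<in> ovw A s" and own: "owner A (fst x) = Opponent"
  obtains r y where "prefix (r @ [y]) s" "owner A (fst y) = Opponent" "oview A r = v" "oview A (r @ [y]) = v @ [x]"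
proof -
  obtain u where u: "prefix u s" "oview A u = v @ [x]"
    using v unfolding ovw_def mem_Collect_eq by metis
  have lu: "legal A u" using legal_prefix[OF l u(1)] .
  have "u \<noteq> []" using u(2) by (auto simp: oview_view)
  then obtain r y where ry: "u = r @ [y]" by (metis rev_exhaust)
  have "fst y = fst x"
    using last_view(2)[OF legal_backward[OF lu], of "length r" A Opponent] u(2) ry by (simp add: oview_view)
  then have O: "owner A (fst y) = Opponent" using own by simp
  have "oview A (r @ [y]) = oview A r @ [(fst y, ptr_map (gv A Opponent r (length r)) (snd y))]"
    using view_snoc[OF lu[unfolded ry] O] by (simp add: oview_view)
  then have "oview A r = v" using u(2) ry by simp
  then show ?thesis using that[of r y] u ry O by simp
qed

lemma oview_snoc_O:
  assumes "legal A (r @ [y])" "owner A (fst y) = Opponent"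
  shows "\<exists>x. fst x = fst y \<and> oview A (r @ [y]) = oview A r @ [x]"
  using view_snoc[OF assms] by (simp add: oview_view)

lemma oview_ovw_O:
  assumes l: "legal A s" and s': "legal A (r @ [y])" "owner A (fst y) = Opponent"
    and mem: "oview A (r @ [y]) \<in> ovw A s"
  obtains r' y' where "prefix (r' @ [y']) s" "owner A (fst y') = Opponent" "oview A r' = oview A r"
    "oview A (r' @ [y']) = oview A (r @ [y])"
proof -
  obtain x where x: "fst x = fst y" "oview A (r @ [y]) = oview A r @ [x]"
    using oview_snoc_O[OF s'] by blast
  show ?thesis
    using ovw_last_O[OF l, of "oview A r" x] mem x s'(2) that by metis
qed

text \<open>The test prescribes Opponent's moves on each view, but \<tau> may leave some of these
  views unvisited, so this gives only an inclusion. The equality of final O-views is recorded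
  because \<open>play_unique\<close> uses it to locate the end of the play.\<close>

lemma leq_ib_obs:
  assumes A: "game A" and st: "innocent_strategy A \<sigma>" "innocent_strategy A \<tau>"
    and leq: "leq_ib A \<sigma> \<tau>"
    and s: "s \<in> \<sigma>" "complete A s" "O_innocent A s" "single_threaded A s"
  shows "\<exists>t. t \<in> \<tau> \<and> complete A t \<and> O_innocent A t \<and> single_threaded A t \<and> ovw A t \<subseteq> ovw A s \<and>
    oview A t = oview A s"
proof -
  let ?F = "tests A"
  have ar: "arena A" and GA: "pregame A" and G: "pregame ?F"
    using A pregame_tests game_pregame by (auto simp: game_def)
  have l: "legal A s" and ev: "even (length s)"
    using strategy_play[OF GA st(1) s(1)] by auto
  have b: "backward s" using l by (rule legal_backward)
  have los: "lo A s (length s) = None"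
    using s(2) l by (auto simp: complete_iff_lo legal_def)
  define W where "W = {emb (v @ [x]) |v x. v @ [x] \<in> ovw A s \<and> owner A (fst x) = Opponent} \<union> {emb (oview A s) @ [fin]}"
  \<comment> \<open>At the final O-view the test must answer and not move on; completeness prevents
    this view from preceding an O-move of \<open>s\<close>.\<close>
  have last_ne: "v \<noteq> oview A s" if vx: "v @ [x] \<in> ovw A s" "owner A (fst x) = Opponent" for v x
  proof
    assume eq: "v = oview A s"
    obtain r y where r: "prefix (r @ [y]) s" "oview A r = v"
      using ovw_last_O[OF l vx] by metis
    then have len: "length r < length s" using prefix_length_le by fastforce
    have "oview A r = view A Opponent s (length r)"
      using oview_take[OF b, of "length r" A] len r(1) by (auto simp: prefix_def)
    then show False
      using complete_ovw_last[OF ar l l ev ev s(2,2) refl len] r(2) eq by (simp add: oview_view)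
  qed
  have det: "det_views W"
    unfolding det_views_def
  proof (intro allI impI, elim conjE)
    fix v x y assume xy: "v @ [x] \<in> W" "v @ [y] \<in> W"
    have W: "(\<exists>u z. v = emb u \<and> x = shift z \<and> u @ [z] \<in> ovw A s \<and> owner A (fst z) = Opponent) \<or>
      (v = emb (oview A s) \<and> x = fin)" if "v @ [x] \<in> W" for x
      using that by (auto simp: W_def emb_snoc)
    have det1: "x = y" if x: "u @ [x] \<in> ovw A s" "owner A (fst x) = Opponent" and y: "u @ [y] \<in> ovw A s" "owner A (fst y) = Opponent" for u x y
    proof -
      obtain r1 z1 where 1: "prefix (r1 @ [z1]) s" "owner A (fst z1) = Opponent" "oview A r1 = u" "oview A (r1 @ [z1]) = u @ [x]"
        using ovw_last_O[OF l x] .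
      obtain r2 z2 where 2: "prefix (r2 @ [z2]) s" "owner A (fst z2) = Opponent" "oview A r2 = u" "oview A (r2 @ [z2]) = u @ [y]"
        using ovw_last_O[OF l y] .
      have "oview A (r1 @ [z1]) = oview A (r2 @ [z2])"
        using s(3) 1 2 unfolding O_innocent_def by metis
      then show ?thesis using 1 2 by simp
    qed
    show "x = y"
      using W[OF xy(1)] W[OF xy(2)] det1 last_ne by (metis emb_inj)
  qed
  let ?\<alpha> = "strat_of ?F W"
  have \<alpha>: "innocent_strategy ?F ?\<alpha>" by (rule innocent_strat_of[OF A det])
  have lf: "legal ?F (emb s @ [fin])"
    using legal_fin[OF ar l] ev s(2) by simp
  have "emb s @ [fin] \<in> ?\<alpha>"
    unfolding strat_of_def
  proof (intro CollectI conjI allI impI)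
    show "emb s @ [fin] \<in> plays ?F"
      using tests_snoc[OF A emb_play[OF A l] lf] by simp
    show "even (length (emb s @ [fin]))" using ev by simp
    fix n assume n: "n < length (emb s @ [fin])" "odd n"
    then obtain m where m: "n = Suc m" "even m" "m \<le> length s" by (cases n) auto
    show "view ?F Proponent (emb s @ [fin]) (Suc n) \<in> W"
    proof (cases "m = length s")
      case True
      then show ?thesis
        using view_fin[OF ar lf l] m(1) by (simp add: W_def oview_view)
    next
      case False
      then have ms: "m < length s" using m by simp
      then have O: "owner A (move_at s m) = Opponent"
        using legal_parity[OF ar l] m(2) by simp
      have "view A Opponent s (Suc m) \<in> ovw A s"
        using ms unfolding ovw_view[OF b] by (intro CollectI exI[of _ "Suc m"]) simp
      then have "emb (view A Opponent s (Suc m)) \<in> W"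
        using view_own[OF b ms O] O unfolding W_def by fastforce
      then show ?thesis
        using view_emb[OF ar l, of "Suc m"] view_append[OF legal_backward[OF lf], of "Suc (Suc m)" ?F Proponent]
          ms m(1) by simp
    qed
  qed
  moreover have "s \<in> promote A \<sigma>"
    using single_promote[OF A l s(4)] s(1) by blast
  ultimately have "compose A \<sigma> ?\<alpha> = Sigma_top"
    using compose_iff[OF A st(1) \<alpha>] by blast
  then have "compose A \<tau> ?\<alpha> = Sigma_top"
    using leq \<alpha> unfolding leq_ib_def by blast
  then obtain t where t: "t \<in> promote A \<tau>" "emb t @ [fin] \<in> ?\<alpha>"
    using compose_iff[OF A st(2) \<alpha>] by blast
  have ltf: "legal ?F (emb t @ [fin])" using strategy_play(3)[OF G \<alpha> t(2)] .
  have lt: "legal A t" using t(1) by (simp add: promote_iff[OF A])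
  have bt: "backward t" using lt by (rule legal_backward)
  have evt: "even (length t)" and ct: "complete A t"
    using legal_fin[OF ar lt] ltf by auto
  have viewW: "view ?F Proponent (emb t @ [fin]) (Suc (Suc m)) \<in> W" if "m \<le> length t" "even m" for m
    using t(2) that unfolding strat_of_def by simp
  \<comment> \<open>A view that ends in \<open>fin\<close> can only come from the second part of
    \<open>W\<close>.\<close>
  have last: "oview A t = oview A s"
    using viewW[of "length t"] evt view_fin[OF ar ltf lt]
    by (auto simp: W_def emb_snoc emb_inj oview_view shift_fin shift_fin[symmetric])
  have O_views: "view A Opponent t (Suc m) \<in> ovw A s" if m: "m < length t" "even m" for m
  proof -
    have O: "owner A (move_at t m) = Opponent" using legal_parity[OF ar lt m(1)] m(2) by simp
    obtain z where z: "view A Opponent t (Suc m) = view A Opponent t m @ [z]"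
      using view_own[OF bt m(1) O] by blast
    have "emb (view A Opponent t (Suc m)) \<in> W"
      using viewW[of m] m view_emb[OF ar lt, of "Suc m"]
        view_append[OF legal_backward[OF ltf], of "Suc (Suc m)" ?F Proponent] by simp
    then show ?thesis
      unfolding W_def z by (auto simp: emb_snoc emb_inj shift_inj shift_fin)
  qed
  have O_views': "oview A (r @ [y]) \<in> ovw A s" if r: "prefix (r @ [y]) t" "owner A (fst y) = Opponent" for r y
  proof -
    have len: "length r < length t" using prefix_length_le[OF r(1)] by simp
    have "move_at t (length r) = fst y" "r @ [y] = take (Suc (length r)) t"
      using r(1) by (auto simp: prefix_def nth_append)
    then show ?thesis
      using O_views[OF len] legal_parity[OF ar lt len] r(2) oview_take[OF bt, of "Suc (length r)" A] len by simp
  qed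
  have sub: "ovw A t \<subseteq> ovw A s"
  proof
    fix v assume "v \<in> ovw A t"
    then obtain n where n: "n \<le> length t" "v = view A Opponent t n"
      unfolding ovw_view[OF bt] by blast
    show "v \<in> ovw A s"
    proof (cases "even n")
      case False
      then obtain m where "n = Suc m" "even m" by (cases n) auto
      then show ?thesis using O_views[of m] n by simp
    next
      case True
      show ?thesis
      proof (cases "n = length t")
        case True
        then have "v = oview A s" using n last by (simp add: oview_view)
        then show ?thesis unfolding ovw_def by blast
      next
        case False
        then have len: "n < length t" using n by simp
        have tk: "take (Suc n) t = take n t @ [t ! n]"
          using len by (simp add: take_Suc_conv_app_nth)
        have O: "owner A (fst (t ! n)) = Opponent"
          using legal_parity[OF ar lt len] True by simp
        have p: "prefix (take n t @ [t ! n]) t" unfolding tk[symmetric] by (rule take_is_prefix)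
        \<comment> \<open>Before an O-move the O-view is that of the move without its last entry;
          the view of the move occurs in \<open>s\<close>, hence so does the shortened one.\<close>
        obtain r' y' where r': "prefix (r' @ [y']) s" "oview A r' = oview A (take n t)"
          using oview_ovw_O[OF l legal_prefix[OF lt p] O O_views'[OF p O]] by metis
        have "v = oview A r'"
          using r'(2) n oview_take[OF bt n(1), of A] by simp
        moreover have "prefix r' s"
          using r'(1) by (meson append_prefixD)
        ultimately show ?thesis unfolding ovw_def by blast
      qed
    qed
  qed
  have s_single: "s \<noteq> []" "\<And>k. k < length s \<Longrightarrow> ptr s k = None \<Longrightarrow> k = 0"
    using s(4) by (auto simp: single_threaded_iff[OF ar l])
  have "t \<noteq> []"
  proof
    assume "t = []"
    then have "view A Opponent s (length s) = []" using last by (simp add: oview_view)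
    then show False using view_ne[OF b, of "length s" A Opponent] s_single(1) by simp
  qed
  \<comment> \<open>A later initial move of \<open>t\<close> would have an O-view of length at least
    two. In \<open>s\<close> that view would end in the only initial move, at position
    \<open>0\<close>, where it has length one.\<close>
  moreover have "k = 0" if k: "k < length t" "ptr t k = None" for k
  proof (rule ccontr)
    assume "k \<noteq> 0"
    have en: "enables A None (move_at t k)" using legal_initial[OF lt k] .
    then have O: "owner A (move_at t k) = Opponent" using arena_initial[OF ar] by blast
    then have "even k" using legal_parity[OF ar lt k(1)] by simp
    then have "view A Opponent t (Suc k) \<in> ovw A s" using O_views[OF k(1)] by blast
    then obtain n where n: "n \<le> length s" "view A Opponent t (Suc k) = view A Opponent s n"
      unfolding ovw_view[OF b] by blast
    have "view A Opponent t (Suc k) \<noteq> []" using last_view(1)[OF bt k(1)] .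
    then obtain m where m: "n = Suc m" using n(2) by (cases n) auto
    have "move_at s m = move_at t k"
      using last_view(2)[OF bt k(1), of A Opponent] last_view(2)[OF b, of m A Opponent] n m by simp
    then have "ptr s m = None"
      using legal_initial_iff[OF ar l, of m] en n(1) m by simp
    then have "m = 0" using s_single(2) n(1) m by simp
    then have "length (view A Opponent s n) = 1"
      using last_view(3)[OF b, of 0 A Opponent] m s_single(1) by simp
    moreover have "view A Opponent t k \<noteq> []"
      using view_ne[OF bt, of k A Opponent] \<open>k \<noteq> 0\<close> k(1) by simp
    ultimately show False
      using view_own[OF bt k(1) O] n(2) by simp
  qed
  ultimately have tst: "single_threaded A t"
    by (auto simp: single_threaded_iff[OF ar lt])
  have "O_innocent A t"
    unfolding O_innocent_def
  proof (intro allI impI, elim conjE)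
    fix s1 o1 s2 o2
    assume p: "prefix (s1 @ [o1]) t" "prefix (s2 @ [o2]) t"
      and O: "owner A (fst o1) = Opponent" "owner A (fst o2) = Opponent"
      and eq: "oview A s1 = oview A s2"
    obtain r1 y1 where 1: "prefix (r1 @ [y1]) s" "owner A (fst y1) = Opponent" "oview A r1 = oview A s1"
      "oview A (r1 @ [y1]) = oview A (s1 @ [o1])"
      using oview_ovw_O[OF l legal_prefix[OF lt p(1)] O(1) O_views'[OF p(1) O(1)]] .
    obtain r2 y2 where 2: "prefix (r2 @ [y2]) s" "owner A (fst y2) = Opponent" "oview A r2 = oview A s2"
      "oview A (r2 @ [y2]) = oview A (s2 @ [o2])"
      using oview_ovw_O[OF l legal_prefix[OF lt p(2)] O(2) O_views'[OF p(2) O(2)]] .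
    have "oview A (r1 @ [y1]) = oview A (r2 @ [y2])"
      using s(3) 1 2 eq unfolding O_innocent_def by metis
    then show "oview A (s1 @ [o1]) = oview A (s2 @ [o2])"
      using 1 2 by simp
  qed
  moreover have "t \<in> \<tau>"
    using single_promote[OF A lt tst] t(1) by blast
  ultimately show ?thesis
    using ct tst sub last by blast
qed

text \<open>The plays cannot first differ at an O-move, as both O-views occur in \<open>s\<close>
  and \<open>s\<close> is O-innocent, nor at a P-move, as \<sigma> is deterministic. So one is a
  prefix of the other, and equal final O-views exclude a proper prefix, since O-views at points
  without open questions grow strictly.\<close>

lemma play_unique:
  assumes A: "game A" and st: "innocent_strategy A \<sigma>"
    and s: "s \<in> \<sigma>" "complete A s" "O_innocent A s" and t: "t \<in> \<sigma>" "complete A t"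
    and sub: "ovw A t \<subseteq> ovw A s" and last: "oview A t = oview A s"
  shows "t = s"
proof -
  have ar: "arena A" and GA: "pregame A"
    using A game_pregame by (auto simp: game_def)
  have l: "legal A s" "legal A t" and ev: "even (length s)" "even (length t)"
    using strategy_play[OF GA st] s(1) t(1) by auto
  have ext: "u = v" if p: "prefix u v" and uv: "legal A v" "complete A u" "complete A v" "even (length v)"
      "oview A u = oview A v" for u v
  proof (rule ccontr)
    assume "u \<noteq> v"
    then have len: "length u < length v"
      using p by (simp add: prefix_length_less strict_prefix_def)
    have lu: "legal A u" by (rule legal_prefix[OF uv(1) p])
    have u: "u = take (length u) v" using p by (auto simp: prefix_def)
    have "lo A u (length u) = None" "lo A v (length v) = None"
      using uv lu by (auto simp: complete_iff_lo legal_def)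
    moreover have "lo A u (length u) = lo A v (length u)"
      using lo_take[of "length u" "length u" v A] u len by simp
    ultimately have "length (view A Opponent v (length u)) < length (view A Opponent v (length v))"
      using complete_view_length[OF ar uv(1), of "length u" "length v"] len uv(4) by simp
    moreover have "view A Opponent v (length u) = oview A u"
      using oview_take[OF legal_backward[OF uv(1)], of "length u" A] u len by simp
    ultimately show False using uv(5) by (simp add: oview_view)
  qed
  have "prefix s t \<or> prefix t s"
  proof (rule ccontr)
    assume "\<not> (prefix s t \<or> prefix t s)"
    then have "s \<parallel> t" by blast
    then obtain as x bs y cs where d: "x \<noteq> y" "s = as @ x # bs" "t = as @ y # cs"
      using parallel_decomp by blast
    have p: "prefix (as @ [x]) s" "prefix (as @ [y]) t" using d by auto
    have lp: "legal A (as @ [x])" "legal A (as @ [y])"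
      using legal_prefix[OF l(1) p(1)] legal_prefix[OF l(2) p(2)] by auto
    show False
    proof (cases "even (length as)")
      case True
      then have O: "owner A (fst x) = Opponent" "owner A (fst y) = Opponent"
        using legal_parity[OF ar lp(1), of "length as"] legal_parity[OF ar lp(2), of "length as"] by auto
      have "oview A (as @ [y]) \<in> ovw A s"
        using sub p(2) unfolding ovw_def by blast
      then obtain r z where r: "prefix (r @ [z]) s" "owner A (fst z) = Opponent" "oview A r = oview A as"
        "oview A (r @ [z]) = oview A (as @ [y])"
        using oview_ovw_O[OF l(1) lp(2) O(2)] by metis
      have "oview A (as @ [x]) = oview A (r @ [z])"
        using s(3) p(1) O(1) r unfolding O_innocent_def by metis
      then have "view A Opponent (as @ [x]) (Suc (length as)) = view A Opponent (as @ [y]) (Suc (length as))"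
        using r(4) by (simp add: oview_view)
      then show False
        using view_snoc_inj[OF lp O(1)] d(1) by simp
    next
      case False
      then have "as \<noteq> []" by auto
      then obtain g a where as: "as = g @ [a]" by (metis rev_exhaust)
      have "g @ [a, x] \<in> \<sigma>" "g @ [a, y] \<in> \<sigma>"
        using strategy_prefix[OF GA st s(1) p(1)] strategy_prefix[OF GA st t(1) p(2)] False as by auto
      then show False using strategy_det[OF GA st] d(1) by blast
    qed
  qed
  then show ?thesis
    using ext[of s t] ext[of t s] l ev s(2) t(2) last by auto
qed

lemma equiv_obs:
  assumes A: "game A" and st: "innocent_strategy A \<sigma>" "innocent_strategy A \<tau>"
    and leq: "leq_ib A \<sigma> \<tau>" "leq_ib A \<tau> \<sigma>"
  shows "obs A \<sigma> \<subseteq> obs A \<tau>"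
proof
  fix x assume "x \<in> obs A \<sigma>"
  then obtain s where s: "x = ovw A s" "s \<in> \<sigma>" "complete A s" "O_innocent A s" "single_threaded A s"
    unfolding obs_def by blast
  obtain t where t: "t \<in> \<tau>" "complete A t" "O_innocent A t" "single_threaded A t" "ovw A t \<subseteq> ovw A s"
    "oview A t = oview A s"
    using leq_ib_obs[OF A st leq(1) s(2-)] by blast
  obtain s' where s': "s' \<in> \<sigma>" "complete A s'" "ovw A s' \<subseteq> ovw A t" "oview A s' = oview A t"
    using leq_ib_obs[OF A st(2,1) leq(2) t(1-4)] by blast
  have "s' = s"
    using play_unique[OF A st(1) s(2-4) s'(1,2)] s'(3,4) t(5,6) by simp
  then have "ovw A t = ovw A s" using t(5) s'(3) by blast
  then show "x \<in> obs A \<tau>"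
    unfolding obs_def using s(1) t by blast
qed

theorem theorem1:
  fixes A :: "'m game" and \<sigma> \<tau> :: "'m jseq set"
  assumes "game A"
    and "innocent_strategy A \<sigma>"
    and "innocent_strategy A \<tau>"
  shows "leq_ib A \<sigma> \<tau> \<and> leq_ib A \<tau> \<sigma> \<longleftrightarrow> obs A \<sigma> = obs A \<tau>"
proof
  assume "leq_ib A \<sigma> \<tau> \<and> leq_ib A \<tau> \<sigma>"
  then show "obs A \<sigma> = obs A \<tau>"
    using equiv_obs[OF assms] equiv_obs[OF assms(1,3,2)] by blast
next
  assume "obs A \<sigma> = obs A \<tau>"
  then show "leq_ib A \<sigma> \<tau> \<and> leq_ib A \<tau> \<sigma>"
    using obs_leq_ib[OF assms] obs_leq_ib[OF assms(1,3,2)] by blast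
qed

end
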